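(* Assume the following three conditions on the SPDE (E) displayed in the context. (1) For every $x\in H$ there exists a unique global solution $X^x=(X^x(t))_{t\ge 0}$ to (E), and $\{X^x, x\in H\}$ forms a strong Markov process. (2) For every $h\in H$ there exists $\eta_h>0$ such that for every $\eta\in(0,\eta_h]$ there exist $\epsilon\in(0,\frac{\eta}{2}]$ and $t\in(0,\infty)$ with $\inf_{\tilde h\in B(h,\epsilon)}\mathbb{P}(\tau^{\eta}_{\tilde h,h}\ge t)>0$, where $\tau^{\eta}_{x,y}=\inf\{s\ge 0: X^x(s)\notin B(y,\eta)\}$. (3) For every $\hbar,y\in H$ with $\hbar\ne y$ and every $\bar\eta>0$ there exist $n,m\in\mathbb{N}$ and $\{l_i, i=1,\dots,n\}\subset Z_m$ such that, for every $\eta\in(0,\frac{\bar\eta}{2})$, there exist $\{\epsilon_i, i=1,\dots,n\}\subset(0,\infty)$ and $\{\eta_i, i=0,1,\dots,n\}\subset(0,\infty)$ such that, denoting $q_0=\hbar$ and $q_i=q_{i-1}+\sigma(q_{i-1},l_i)$ for $i=1,\dots,n$: - $0<\eta_0\le\eta_1\le\dots\le\eta_n\le\eta$; - for every $i=0,1,\dots,n-1$, $\{\tilde q+\sigma(\tilde q,l): \tilde q\in B(q_i,\eta_i),\ l\in B(l_{i+1},\epsilon_{i+1})\}\subset B(q_{i+1},\eta_{i+1})$; - $B(q_n,\eta_n)\subset B(y,\frac{\bar\eta}{2})$; - for every $i=1,\dots,n$, $\nu(B(l_i,\epsilon_i))>0$; - there exists $m_0\ge m$ such that $\bigcup_{i=1}^n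 B(l_i,\epsilon_i)\subset Z_{m_0}$. Then the Markov process $\{X^x, x\in H\}$ is irreducible in $H$, that is, for every $t>0$ and $x\in H$, $\mathbb{P}(X^x(t)\in B)>0$ for every non-empty open set $B\subset H$.
   Context: Let $V\subset H\simeq H^*\subset V^*$ be a Gelfand triple: $(H,\langle\cdot,\cdot\rangle_H)$ is a separable Hilbert space identified with its dual, $V$ is a reflexive Banach space continuously and densely embedded into $H$, and the duality pairing ${}_{V^*}\langle\cdot,\cdot\rangle_V$ satisfies ${}_{V^*}\langle u,v\rangle_V=\langle u,v\rangle_H$ for $u\in H$, $v\in V$. Let $(\Omega,\mathcal F,\mathbb F=\{\mathcal F_t\}_{t\ge0},\mathbb P)$ be a filtered probability space satisfying the usual conditions. In a metric space $(X,d_X)$, $B(x,l)=\{y: d_X(y,x)<l\}$. Let $Z$ be a metric space with Borel $\sigma$-field $\mathcal B(Z)$ and $\nu$ a $\sigma$-finite measure on it; fix $Z_n\in\mathcal B(Z)$, $n\in\mathbb N$, with $Z_n\uparrow Z$ and $\nu(Z_n)<\infty$. Let $N$ be a time homogeneous Poisson random measure on $Z$ with intensity measure $\nu$, and $\tilde N(dz,dt)=N(dz,dt)-\nu(dz)dt$. $Z_m^c$ is the complement of $Z_m$ in $Z$. Let $\mathcal A:V\to V^*$ and $\sigma:H\times Z\to H$ be Borel measurable. The SPDE is $$(E)\quad dX(t)=\mathcal A(X(t))dt+\int_{Z_1^c}\sigma(X(t-),z)\tilde N(dz,dt)+\int_{Z_1}\sigma(X(t-),z)N(dz,dt),\quad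 X(0)=x.$$ A solution of (E) is an $H$-valued càdlàg $\mathbb F$-adapted process $X$ such that: (I) $X(t,\omega)\in V$ for $dt\otimes\mathbb P$-almost all $(t,\omega)\in[0,\infty)\times\Omega$; (II) $\mathbb P$-a.s., for all $t\ge0$, $\int_0^t\|\mathcal A(X(s))\|_{V^*}ds+\int_0^t\int_{Z_1^c}\|\sigma(X(s),z)\|_H^2\nu(dz)ds+\int_0^t\int_{Z_1}\|\sigma(X(s-),z)\|_HN(dz,ds)<\infty$; (III) $\mathbb P$-a.s., for all $t\ge 0$, $X(t)=x+\int_0^t\mathcal A(X(s))ds+\int_0^t\int_{Z_1^c}\sigma(X(s-),z)\tilde N(dz,ds)+\int_0^t\int_{Z_1}\sigma(X(s-),z)N(dz,ds)$ as an equation in $V^*$. $X^x$ denotes the solution starting from $x$. *)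

theory Defs
  imports "HOL-Probability.Probability"
begin

section \<open>Gelfand triple\<close>

text \<open>
  The inclusion of V in H is an injective bounded operator \<open>\<iota>\<close>; the dual of V is the type
  \<^typ>\<open>'v \<Rightarrow>\<^sub>L real\<close> with the operator norm. Separability of V is not assumed: it follows from
  reflexivity and the separability of H.
\<close>

locale gelfand_triple =
  fixes \<iota> :: "'v::banach \<Rightarrow>\<^sub>L 'h::{real_inner, banach, second_countable_topology}"
  assumes inj_embedding: "inj (blinfun_apply \<iota>)"
    and dense_embedding: "closure (range (blinfun_apply \<iota>)) = UNIV"
    and reflexive: "\<And>\<phi> :: ('v \<Rightarrow>\<^sub>L real) \<Rightarrow>\<^sub>L real. \<exists>v. \<forall>f. blinfun_apply \<phi> f = blinfun_apply f v"

text \<open>The inclusion of H in the dual of V, that is, \<open>v \<mapsto> \<langle>h, v\<rangle>\<^sub>H\<close>.\<close>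

definition to_dual ::
    "('v::real_normed_vector \<Rightarrow>\<^sub>L 'h::real_inner) \<Rightarrow> 'h \<Rightarrow> ('v \<Rightarrow>\<^sub>L real)" where
  "to_dual \<iota> h = blinfun_inner_left h o\<^sub>L \<iota>"

text \<open>
  \<open>\<A>\<close> evaluated at a point of H; the value 0 off V is immaterial, because a solution
  is in V for almost all times.
\<close>

definition on_V ::
    "('v::real_normed_vector \<Rightarrow>\<^sub>L 'h::real_normed_vector) \<Rightarrow> ('v \<Rightarrow> ('v \<Rightarrow>\<^sub>L real))
      \<Rightarrow> 'h \<Rightarrow> ('v \<Rightarrow>\<^sub>L real)" where
  "on_V \<iota> \<A> h =
     (if h \<in> range (blinfun_apply \<iota>) then \<A> (inv (blinfun_apply \<iota>) h) else 0)"

text \<open>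
  The Bochner integral in a normed space, word for word as \<^const>\<open>has_bochner_integral\<close>. The
  library version cannot be used for the dual of V, since the type \<^typ>\<open>'v \<Rightarrow>\<^sub>L real\<close> is not an
  instance of \<^class>\<open>second_countable_topology\<close>.
\<close>

definition has_bochner_integral_in ::
    "'a measure \<Rightarrow> ('a \<Rightarrow> 'b::real_normed_vector) \<Rightarrow> 'b \<Rightarrow> bool" where
  "has_bochner_integral_in M f I \<longleftrightarrow>
     f \<in> borel_measurable M \<and>
     (\<exists>s :: nat \<Rightarrow> 'a \<Rightarrow> 'b.
        (\<forall>i. Bochner_Integration.simple_bochner_integrable M (s i)) \<and>
        (\<lambda>i. \<integral>\<^sup>+x. ennreal (norm (f x - s i x)) \<partial>M) \<longlonglongrightarrow> 0 \<and>
        (\<lambda>i. Bochner_Integration.simple_bochner_integral M (s i)) \<longlonglongrightarrow> I)"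

section \<open>Stochastic basis and processes\<close>

text \<open>
  Time is the set of nonnegative reals inside \<^typ>\<open>real\<close>. The values of filtrations and processes at
  negative times play no role; a filtration indexed by the nonnegative reals is extended
  by its value at 0.
\<close>

locale usual_filtered_prob_space =
  prob_space M + complete_measure M + filtration "space M" F
  for M :: "'w measure" and F :: "real \<Rightarrow> 'w measure" +
  assumes sub_events: "\<And>t. sets (F t) \<subseteq> sets M"
    and right_continuous: "\<And>t. 0 \<le> t \<Longrightarrow> sets (F t) = (\<Inter>s\<in>{t<..}. sets (F s))"
    and null_sets_initial: "null_sets M \<subseteq> sets (F 0)"

definition cadlag :: "(real \<Rightarrow> 'h::topological_space) \<Rightarrow> bool" where
  "cadlag f \<longleftrightarrow> (\<forall>t\<ge>0. (f \<longlongrightarrow> f t) (at_right t)) \<and> (\<forall>t>0. \<exists>l. (f \<longlongrightarrow> l) (at_left t))"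

definition left_lim :: "(real \<Rightarrow> 'h::t2_space) \<Rightarrow> real \<Rightarrow> 'h" where
  "left_lim f t = (if t \<le> 0 then f 0 else Lim (at_left t) f)"

definition cadlag_adapted ::
    "'w measure \<Rightarrow> (real \<Rightarrow> 'w measure) \<Rightarrow> (real \<Rightarrow> 'w \<Rightarrow> 'h::topological_space) \<Rightarrow> bool" where
  "cadlag_adapted M F X \<longleftrightarrow>
     (\<forall>t\<ge>0. X t \<in> borel_measurable (F t)) \<and> (\<forall>\<omega>\<in>space M. cadlag (\<lambda>t. X t \<omega>))"

definition predictable :: "'w measure \<Rightarrow> (real \<Rightarrow> 'w measure) \<Rightarrow> (real \<times> 'w) measure" where
  "predictable M F = sigma ({0..} \<times> space M)
     ({{0} \<times> A | A. A \<in> sets (F 0)} \<union>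
      {{s<..t} \<times> A | s t A. 0 \<le> s \<and> s \<le> t \<and> A \<in> sets (F s)})"

section \<open>Poisson random measures\<close>

definition mark_time :: "'z measure \<Rightarrow> ('z \<times> real) measure" where
  "mark_time \<nu> = \<nu> \<Otimes>\<^sub>M restrict_space lborel {0..}"

text \<open>
  Time homogeneous Poisson random measure with intensity \<open>\<nu>(dz) dt\<close> on the given
  filtered probability space: adapted, with increments after time \<open>t\<close> independent of \<open>F t\<close>.
  Sets of infinite intensity are not mentioned, because by sigma-finiteness they have infinite mass
  almost surely.
\<close>

locale poisson_random_measure =
  usual_filtered_prob_space M F + \<nu>: sigma_finite_measure \<nu>
  for M :: "'w measure" and F :: "real \<Rightarrow> 'w measure" and \<nu> :: "'z measure" +
  fixes N :: "'w \<Rightarrow> ('z \<times> real) measure"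
  assumes sets_N: "\<And>\<omega>. \<omega> \<in> space M \<Longrightarrow> sets (N \<omega>) = sets (mark_time \<nu>)"
    and integer_valued: "\<And>\<omega> A. \<omega> \<in> space M \<Longrightarrow> A \<in> sets (mark_time \<nu>) \<Longrightarrow>
          \<exists>k. emeasure (N \<omega>) A = ennreal_of_enat k"
    and measurable_N: "\<And>A. A \<in> sets (mark_time \<nu>) \<Longrightarrow>
          (\<lambda>\<omega>. emeasure (N \<omega>) A) \<in> borel_measurable M"
    and poisson_distributed: "\<And>A k. A \<in> sets (mark_time \<nu>) \<Longrightarrow> emeasure (mark_time \<nu>) A < \<infinity> \<Longrightarrow>
          prob {\<omega> \<in> space M. emeasure (N \<omega>) A = of_nat k} =
            exp (- measure (mark_time \<nu>) A) * measure (mark_time \<nu>) A ^ k / fact k"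
    and independently_scattered: "\<And>(n::nat) A. (\<forall>i<n. A i \<in> sets (mark_time \<nu>)) \<Longrightarrow>
          disjoint_family_on A {..<n} \<Longrightarrow>
          indep_vars (\<lambda>_. borel) (\<lambda>i \<omega>. emeasure (N \<omega>) (A i)) {..<n}"
    and adapted_N: "\<And>t A. 0 \<le> t \<Longrightarrow> A \<in> sets (mark_time \<nu>) \<Longrightarrow> A \<subseteq> UNIV \<times> {0..t} \<Longrightarrow>
          (\<lambda>\<omega>. emeasure (N \<omega>) A) \<in> borel_measurable (F t)"
    and future_independent: "\<And>t. 0 \<le> t \<Longrightarrow>
          indep_set (sets (F t))
            (sigma_sets (space M)
              {{\<omega> \<in> space M. emeasure (N \<omega>) A \<in> S} | A S.
                 A \<in> sets (mark_time \<nu>) \<and> A \<subseteq> UNIV \<times> {t<..} \<and> S \<in> sets borel})"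

section \<open>Stochastic integral with respect to the compensated measure\<close>

text \<open>
  An entry \<open>(a, b, B, \<xi>)\<close> stands for the integrand \<open>1\<^bsub>(a, b]\<^esub>(s) 1\<^bsub>B\<^esub>(z) \<xi>(\<omega>)\<close>, a list for the sum
  of its entries.
\<close>

type_synonym ('w, 'z, 'h) elementary = "(real \<times> real \<times> 'z set \<times> ('w \<Rightarrow> 'h)) list"

definition elementary_predictable ::
    "'w measure \<Rightarrow> (real \<Rightarrow> 'w measure) \<Rightarrow> 'z measure
      \<Rightarrow> ('w, 'z, 'h::real_normed_vector) elementary \<Rightarrow> bool" where
  "elementary_predictable M F \<nu> e \<longleftrightarrow>
     (\<forall>(a, b, B, \<xi>) \<in> set e.
        0 \<le> a \<and> a \<le> b \<and> B \<in> sets \<nu> \<and> emeasure \<nu> B < \<infinity> \<and>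
        \<xi> \<in> borel_measurable (F a) \<and> bounded (\<xi> ` space M))"

definition elementary_integrand ::
    "('w, 'z, 'h::real_normed_vector) elementary \<Rightarrow> real \<Rightarrow> 'w \<Rightarrow> 'z \<Rightarrow> 'h" where
  "elementary_integrand e s \<omega> z =
     (\<Sum>(a, b, B, \<xi>) \<leftarrow> e. (indicator {a<..b} s * indicator B z) *\<^sub>R \<xi> \<omega>)"

definition elementary_integral ::
    "'z measure \<Rightarrow> ('w \<Rightarrow> ('z \<times> real) measure) \<Rightarrow> ('w, 'z, 'h::real_normed_vector) elementary
      \<Rightarrow> real \<Rightarrow> 'w \<Rightarrow> 'h" where
  "elementary_integral \<nu> N e t \<omega> =
     (\<Sum>(a, b, B, \<xi>) \<leftarrow> e.
        (measure (N \<omega>) (B \<times> {min a t<..min b t}) - measure \<nu> B * (min b t - min a t)) *\<^sub>R \<xi> \<omega>)"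

definition predictable_integrand ::
    "'w measure \<Rightarrow> (real \<Rightarrow> 'w measure) \<Rightarrow> 'z measure
      \<Rightarrow> (real \<Rightarrow> 'w \<Rightarrow> 'z \<Rightarrow> 'h::topological_space) \<Rightarrow> bool" where
  "predictable_integrand M F \<nu> f \<longleftrightarrow>
     (\<lambda>((s, \<omega>), z). f s \<omega> z) \<in> borel_measurable (predictable M F \<Otimes>\<^sub>M \<nu>)"

definition square_norm ::
    "'w measure \<Rightarrow> 'z measure \<Rightarrow> real \<Rightarrow> (real \<Rightarrow> 'w \<Rightarrow> 'z \<Rightarrow> 'h::real_normed_vector) \<Rightarrow> ennreal" where
  "square_norm M \<nu> t f =
     (\<integral>\<^sup>+\<omega>. (\<integral>\<^sup>+s\<in>{0..t}. (\<integral>\<^sup>+z. ennreal ((norm (f s \<omega> z))\<^sup>2) \<partial>\<nu>) \<partial>lborel) \<partial>M)"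

text \<open>
  \<open>I\<close> is (a version of) the stochastic integral process of \<open>f\<close>. First for square integrable \<open>f\<close>,
  as the extension of the elementary integral by the Ito isometry; then for \<open>f\<close> that is
  locally square integrable in time, by localization along stopping times.
\<close>

definition compensated_integral_L2 ::
    "'w measure \<Rightarrow> (real \<Rightarrow> 'w measure) \<Rightarrow> 'z measure \<Rightarrow> ('w \<Rightarrow> ('z \<times> real) measure)
      \<Rightarrow> (real \<Rightarrow> 'w \<Rightarrow> 'z \<Rightarrow> 'h::real_normed_vector) \<Rightarrow> (real \<Rightarrow> 'w \<Rightarrow> 'h) \<Rightarrow> bool" where
  "compensated_integral_L2 M F \<nu> N f I \<longleftrightarrow>
     predictable_integrand M F \<nu> f \<and> (\<forall>t\<ge>0. square_norm M \<nu> t f < \<infinity>) \<and>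
     cadlag_adapted M F I \<and>
     (\<forall>t\<ge>0. \<exists>e :: nat \<Rightarrow> ('w, 'z, 'h) elementary.
        (\<forall>k. elementary_predictable M F \<nu> (e k)) \<and>
        (\<lambda>k. square_norm M \<nu> t (\<lambda>s \<omega> z. f s \<omega> z - elementary_integrand (e k) s \<omega> z)) \<longlonglongrightarrow> 0 \<and>
        (\<lambda>k. \<integral>\<^sup>+\<omega>. ennreal ((norm (I t \<omega> - elementary_integral \<nu> N (e k) t \<omega>))\<^sup>2) \<partial>M) \<longlonglongrightarrow> 0)"

definition compensated_integral ::
    "'w measure \<Rightarrow> (real \<Rightarrow> 'w measure) \<Rightarrow> 'z measure \<Rightarrow> ('w \<Rightarrow> ('z \<times> real) measure)
      \<Rightarrow> (real \<Rightarrow> 'w \<Rightarrow> 'z \<Rightarrow> 'h::real_normed_vector) \<Rightarrow> (real \<Rightarrow> 'w \<Rightarrow> 'h) \<Rightarrow> bool" where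
  "compensated_integral M F \<nu> N f I \<longleftrightarrow>
     predictable_integrand M F \<nu> f \<and> cadlag_adapted M F I \<and>
     (\<exists>\<tau> :: nat \<Rightarrow> 'w \<Rightarrow> real.
        (\<forall>k. stopping_time F (\<tau> k) \<and> (\<forall>\<omega>\<in>space M. 0 \<le> \<tau> k \<omega>)) \<and>
        (AE \<omega> in M. incseq (\<lambda>k. \<tau> k \<omega>) \<and> filterlim (\<lambda>k. \<tau> k \<omega>) at_top sequentially) \<and>
        (\<forall>k. compensated_integral_L2 M F \<nu> N
               (\<lambda>s \<omega> z. indicator {..\<tau> k \<omega>} s *\<^sub>R f s \<omega> z) (\<lambda>t \<omega>. I (min t (\<tau> k \<omega>)) \<omega>)))"

section \<open>The equation\<close>

text \<open>
  \<open>Zs n\<close> is the set \<open>Z\<^sub>n\<close> for \<open>n \<ge> 1\<close>; \<open>Zs 0\<close> is only a filler and may be empty.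
  The Borel sigma-field of \<open>H \<times> Z\<close> is the product sigma-field, since H is separable.
\<close>

locale levy_spde =
  gelfand_triple \<iota> + poisson_random_measure M F \<nu> N
  for \<iota> :: "'v::banach \<Rightarrow>\<^sub>L 'h::{real_inner, banach, second_countable_topology}"
    and M :: "'w measure" and F :: "real \<Rightarrow> 'w measure"
    and \<nu> :: "'z::metric_space measure" and N :: "'w \<Rightarrow> ('z \<times> real) measure" +
  fixes Zs :: "nat \<Rightarrow> 'z set"
    and \<A> :: "'v \<Rightarrow> ('v \<Rightarrow>\<^sub>L real)"
    and \<sigma> :: "'h \<Rightarrow> 'z \<Rightarrow> 'h"
  assumes sets_\<nu>: "sets \<nu> = sets borel"
    and Zs_borel: "\<And>n. Zs n \<in> sets borel"
    and Zs_incseq: "incseq Zs"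
    and Zs_exhaust: "(\<Union>n. Zs n) = UNIV"
    and Zs_finite: "\<And>n. emeasure \<nu> (Zs n) < \<infinity>"
    and \<A>_borel: "\<A> \<in> borel_measurable borel"
    and \<sigma>_borel: "case_prod \<sigma> \<in> borel_measurable (borel \<Otimes>\<^sub>M borel)"

definition is_solution ::
    "('v::banach \<Rightarrow>\<^sub>L 'h::{real_inner, banach, second_countable_topology})
      \<Rightarrow> 'w measure \<Rightarrow> (real \<Rightarrow> 'w measure) \<Rightarrow> 'z::metric_space measure
      \<Rightarrow> ('w \<Rightarrow> ('z \<times> real) measure) \<Rightarrow> (nat \<Rightarrow> 'z set)
      \<Rightarrow> ('v \<Rightarrow> ('v \<Rightarrow>\<^sub>L real)) \<Rightarrow> ('h \<Rightarrow> 'z \<Rightarrow> 'h) \<Rightarrow> 'h \<Rightarrow> (real \<Rightarrow> 'w \<Rightarrow> 'h) \<Rightarrow> bool" where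
  "is_solution \<iota> M F \<nu> N Zs \<A> \<sigma> x X \<longleftrightarrow>
     cadlag_adapted M F X \<and>
     (AE (t, \<omega>) in restrict_space lborel {0..} \<Otimes>\<^sub>M M. X t \<omega> \<in> range (blinfun_apply \<iota>)) \<and>
     (AE \<omega> in M. \<forall>t\<ge>0.
        (\<integral>\<^sup>+s\<in>{0..t}. ennreal (norm (on_V \<iota> \<A> (X s \<omega>))) \<partial>lborel)
        + (\<integral>\<^sup>+s\<in>{0..t}. (\<integral>\<^sup>+z\<in>- Zs 1. ennreal ((norm (\<sigma> (X s \<omega>) z))\<^sup>2) \<partial>\<nu>) \<partial>lborel)
        + (\<integral>\<^sup>+p\<in>Zs 1 \<times> {0<..t}.
             ennreal (norm (\<sigma> (left_lim (\<lambda>r. X r \<omega>) (snd p)) (fst p))) \<partial>N \<omega>) < \<infinity>) \<and>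
     (\<exists>J. compensated_integral M F \<nu> N
            (\<lambda>s \<omega> z. indicator (- Zs 1) z *\<^sub>R \<sigma> (left_lim (\<lambda>r. X r \<omega>) s) z) J \<and>
          (AE \<omega> in M. \<forall>t\<ge>0. \<exists>a.
             has_bochner_integral_in (restrict_space lborel {0..t}) (\<lambda>s. on_V \<iota> \<A> (X s \<omega>)) a \<and>
             to_dual \<iota> (X t \<omega>) =
               to_dual \<iota> x + a + to_dual \<iota> (J t \<omega>)
               + to_dual \<iota> (LINT p:Zs 1 \<times> {0<..t}|N \<omega>.
                   \<sigma> (left_lim (\<lambda>r. X r \<omega>) (snd p)) (fst p))))"

definition indistinguishable ::
    "'w measure \<Rightarrow> (real \<Rightarrow> 'w \<Rightarrow> 'h) \<Rightarrow> (real \<Rightarrow> 'w \<Rightarrow> 'h) \<Rightarrow> bool" where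
  "indistinguishable M X Y \<longleftrightarrow> (AE \<omega> in M. \<forall>t\<ge>0. X t \<omega> = Y t \<omega>)"

definition is_unique_solution ::
    "('v::banach \<Rightarrow>\<^sub>L 'h::{real_inner, banach, second_countable_topology})
      \<Rightarrow> 'w measure \<Rightarrow> (real \<Rightarrow> 'w measure) \<Rightarrow> 'z::metric_space measure
      \<Rightarrow> ('w \<Rightarrow> ('z \<times> real) measure) \<Rightarrow> (nat \<Rightarrow> 'z set)
      \<Rightarrow> ('v \<Rightarrow> ('v \<Rightarrow>\<^sub>L real)) \<Rightarrow> ('h \<Rightarrow> 'z \<Rightarrow> 'h) \<Rightarrow> 'h \<Rightarrow> (real \<Rightarrow> 'w \<Rightarrow> 'h) \<Rightarrow> bool" where
  "is_unique_solution \<iota> M F \<nu> N Zs \<A> \<sigma> x X \<longleftrightarrow>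
     is_solution \<iota> M F \<nu> N Zs \<A> \<sigma> x X \<and>
     (\<forall>Y. is_solution \<iota> M F \<nu> N Zs \<A> \<sigma> x Y \<longrightarrow> indistinguishable M X Y)"

section \<open>Markov families and irreducibility\<close>

text \<open>
  Real-valued stopping times suffice: for a general \<open>\<tau>\<close> the strong Markov property on \<open>{\<tau> < \<infinity>}\<close>
  follows from the one for \<open>min \<tau> n\<close>.
\<close>

definition strong_markov ::
    "'w measure \<Rightarrow> (real \<Rightarrow> 'w measure) \<Rightarrow> ('h::topological_space \<Rightarrow> real \<Rightarrow> 'w \<Rightarrow> 'h) \<Rightarrow> bool" where
  "strong_markov M F X \<longleftrightarrow>
     (\<forall>t\<ge>0. \<forall>B\<in>sets borel.
        (\<lambda>x. measure M {\<omega> \<in> space M. X x t \<omega> \<in> B}) \<in> borel_measurable borel) \<and>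
     (\<forall>x \<tau>. stopping_time F \<tau> \<and> (\<forall>\<omega>\<in>space M. 0 \<le> \<tau> \<omega>) \<longrightarrow>
        (\<forall>t\<ge>0. \<forall>B\<in>sets borel. AE \<omega> in M.
           real_cond_exp M (filtration.pre_sigma (space M) F \<tau>)
             (\<lambda>\<omega>'. indicator B (X x (\<tau> \<omega>' + t) \<omega>')) \<omega> =
           measure M {\<omega>' \<in> space M. X (X x (\<tau> \<omega>) \<omega>) t \<omega>' \<in> B}))"

definition irreducible_family ::
    "'w measure \<Rightarrow> ('h::topological_space \<Rightarrow> real \<Rightarrow> 'w \<Rightarrow> 'h) \<Rightarrow> bool" where
  "irreducible_family M X \<longleftrightarrow>
     (\<forall>t>0. \<forall>x. \<forall>B. open B \<and> B \<noteq> {} \<longrightarrow> 0 < measure M {\<omega> \<in> space M. X x t \<omega> \<in> B})"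

text \<open>\<open>\<tau>\<^sup>\<eta>\<^bsub>x,y\<^esub>\<close> is \<open>exit_time (X x) y \<eta>\<close>; it is infinite if the path never leaves the ball.\<close>

definition exit_time :: "(real \<Rightarrow> 'w \<Rightarrow> 'h::metric_space) \<Rightarrow> 'h \<Rightarrow> real \<Rightarrow> 'w \<Rightarrow> ennreal" where
  "exit_time Y y \<eta> \<omega> = Inf {ennreal s | s. 0 \<le> s \<and> Y s \<omega> \<notin> ball y \<eta>}"

primrec jump_chain :: "('h \<Rightarrow> 'z \<Rightarrow> 'h::plus) \<Rightarrow> (nat \<Rightarrow> 'z) \<Rightarrow> 'h \<Rightarrow> nat \<Rightarrow> 'h" where
  "jump_chain \<sigma> l h 0 = h"
| "jump_chain \<sigma> l h (Suc i) = jump_chain \<sigma> l h i + \<sigma> (jump_chain \<sigma> l h i) (l (Suc i))"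

end

theory Submission
  imports Defs
begin

text \<open>
  The process is carried into the target by its own jumps and then stays there. Fix a starting point and a time
  \<open>u\<close> shortly before \<open>t\<close>. The law of the process at \<open>u\<close> lives on a separable space, so it charges every ball
  around some point \<open>h\<close>. The jump condition provides a chain of balls from \<open>h\<close> to a small ball around a point
  \<open>y\<close> of the target, each of which is mapped into the next one by a jump with mark in a set \<open>G\<close> with
  \<open>0 < \<nu> G < \<infinity>\<close>.

  Suppose that the process is in one ball of the chain with positive probability at some fixed time. Its paths
  are right-continuous, so they stay there for a short random time. Such a stay is a predictable event, and by the
  compensation formula the mean number of jumps with mark in \<open>G\<close> during the stay is \<open>\<nu> G\<close> times its mean length,
  which is positive. Hence with positive probability a jump into the next ball occurs, and by right-continuity the
  process is in that ball with positive probability at a fixed time again, as soon afterwards as desired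
  (\<open>reach_step\<close>). After finitely many steps, at a fixed time \<open>s < t\<close>, the process is near \<open>y\<close>
  with positive probability (\<open>reach_chain\<close>). The Markov property at \<open>s\<close> and the condition on staying near \<open>y\<close>
  keep it in the target until \<open>t\<close>.

  What this uses about the equation is that an atom of the random measure at \<open>t\<close> with mark \<open>z\<close> moves a
  solution by \<open>\<sigma>\<close>, evaluated at the left limit and \<open>z\<close> (\<open>solution_jump\<close>). The difficult term is the
  compensated integral, which is given only as a limit in mean square for each fixed time. Its jumps are still
  controlled simultaneously: the sum of the squared increments along a grid has a mean that is bounded, by the isometry,
  by a multiple of the squared norm of the integrand, and it dominates the square of every single jump in the limit. So jumps
  of approximating elementary integrals, which can be read off, converge to those of the integral
  (\<open>L2_integral_jump\<close>). The tools are the isometry (\<open>isometry\<close>), the compensation formula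
  (\<open>compensation\<close>), and the fact that disjoint sets of marks have no common jump times (\<open>AE_no_common_jumps\<close>).
\<close>

section \<open>Moments of the Poisson random measure\<close>

lemma sums_poisson_weights:
  fixes c :: real
  shows "(\<lambda>k. exp (- c) * c ^ k / fact k) sums 1"
proof -
  have "(\<lambda>k. exp (- c) * (c ^ k / fact k)) sums (exp (- c) * exp c)"
    by (intro sums_mult) (use exp_converges[of c] in \<open>simp add: field_simps scaleR_conv_of_real\<close>)
  then show ?thesis by (simp add: exp_minus)
qed

lemma sums_poisson_mean:
  fixes c :: real
  shows "(\<lambda>k. real k * (exp (- c) * c ^ k / fact k)) sums c"
proof -
  have "(\<lambda>k. real (Suc k) * (exp (- c) * c ^ Suc k / fact (Suc k))) = (\<lambda>k. c * (exp (- c) * c ^ k / fact k))"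
    by (rule ext) (simp add: field_simps del: of_nat_Suc)
  then have "(\<lambda>k. real (Suc k) * (exp (- c) * c ^ Suc k / fact (Suc k))) sums c"
    using sums_mult[OF sums_poisson_weights[of c], of c] by simp
  then show ?thesis by (subst (asm) sums_Suc_iff) simp
qed

lemma sums_poisson_second_moment:
  fixes c :: real
  shows "(\<lambda>k. (real k)\<^sup>2 * (exp (- c) * c ^ k / fact k)) sums (c\<^sup>2 + c)"
proof -
  have "(\<lambda>k. (real (Suc k))\<^sup>2 * (exp (- c) * c ^ Suc k / fact (Suc k)))
      = (\<lambda>k. c * (real k * (exp (- c) * c ^ k / fact k)) + c * (exp (- c) * c ^ k / fact k))"
  proof
    fix k
    have "(real (Suc k))\<^sup>2 * (exp (- c) * c ^ Suc k / fact (Suc k)) =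
        (real (Suc k) * c * exp (- c) * c ^ k) / fact k"
      by (simp add: power2_eq_square field_simps del: of_nat_Suc)
    then show "(real (Suc k))\<^sup>2 * (exp (- c) * c ^ Suc k / fact (Suc k))
        = c * (real k * (exp (- c) * c ^ k / fact k)) + c * (exp (- c) * c ^ k / fact k)"
      by (simp add: field_simps)
  qed
  moreover have "(\<lambda>k. c * (real k * (exp (- c) * c ^ k / fact k)) + c * (exp (- c) * c ^ k / fact k))
      sums (c * c + c * 1)"
    by (intro sums_add sums_mult sums_poisson_weights sums_poisson_mean)
  ultimately have "(\<lambda>k. (real (Suc k))\<^sup>2 * (exp (- c) * c ^ Suc k / fact (Suc k))) sums (c\<^sup>2 + c)"
    by (simp add: power2_eq_square)
  then show ?thesis by (subst (asm) sums_Suc_iff) simp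
qed

lemma space_mark_time: "space (mark_time \<nu>) = space \<nu> \<times> {0..}"
  by (simp add: mark_time_def space_pair_measure)

context poisson_random_measure
begin

abbreviation "\<Lambda> \<equiv> mark_time \<nu>"

text \<open>
  Real-valued, so that it can be centred and multiplied. An infinite mass counts as 0; for sets of finite
  intensity this has probability zero.
\<close>

definition mass :: "('z \<times> real) set \<Rightarrow> 'w \<Rightarrow> real" where
  "mass A \<omega> = measure (N \<omega>) A"

definition centred_mass :: "('z \<times> real) set \<Rightarrow> 'w \<Rightarrow> real" where
  "centred_mass A \<omega> = mass A \<omega> - measure \<Lambda> A"

lemma sigma_finite_time: "sigma_finite_measure (restrict_space lborel {0::real..})"
  by (intro sigma_finite_measure_restrict_space lborel.sigma_finite_measure_axioms) auto

lemma sigma_finite_\<Lambda>: "sigma_finite_measure \<Lambda>"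
proof -
  interpret T: sigma_finite_measure "restrict_space lborel {0::real..}" by (rule sigma_finite_time)
  interpret pair_sigma_finite \<nu> "restrict_space lborel {0::real..}" ..
  show ?thesis unfolding mark_time_def by unfold_locales
qed

lemma box_sets:
  assumes "B \<in> sets \<nu>" "I \<in> sets borel" "I \<subseteq> {0..}"
  shows "B \<times> I \<in> sets \<Lambda>"
  using assms by (auto simp: mark_time_def sets_restrict_space_iff intro!: pair_measureI)

lemma emeasure_box:
  assumes "B \<in> sets \<nu>" "I \<in> sets borel" "I \<subseteq> {0..}"
  shows "emeasure \<Lambda> (B \<times> I) = emeasure \<nu> B * emeasure lborel I"
proof -
  interpret T: sigma_finite_measure "restrict_space lborel {0::real..}" by (rule sigma_finite_time)
  show ?thesis using assms unfolding mark_time_def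
    by (subst T.emeasure_pair_measure_Times) (auto simp: sets_restrict_space_iff emeasure_restrict_space)
qed

lemma box_fmeasurable:
  assumes "B \<in> fmeasurable \<nu>" "I \<in> sets borel" "I \<subseteq> {0..T}"
  shows "B \<times> I \<in> fmeasurable \<Lambda>"
proof -
  have "I \<subseteq> {0..}" using assms by auto
  moreover have "emeasure lborel I < \<infinity>"
    using emeasure_mono[of I "{0..T}" lborel] assms
    by (auto simp: emeasure_lborel_Icc_eq less_top[symmetric] top_unique split: if_splits)
  ultimately show ?thesis using assms
    by (auto simp: fmeasurable_def box_sets emeasure_box ennreal_mult_less_top)
qed

text \<open>
  The Poisson weights sum to one, so no probability is left for the value infinity.
\<close>

lemma AE_emeasure_N_nat:
  assumes A: "A \<in> fmeasurable \<Lambda>"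
  shows "AE \<omega> in M. \<exists>k::nat. emeasure (N \<omega>) A = of_nat k"
proof -
  have [measurable]: "(\<lambda>\<omega>. emeasure (N \<omega>) A) \<in> borel_measurable M"
    using A by (auto intro: measurable_N simp: fmeasurable_def)
  let ?E = "\<lambda>k::nat. {\<omega> \<in> space M. emeasure (N \<omega>) A = of_nat k}"
  have "(\<lambda>k. prob (?E k)) sums prob (\<Union>k. ?E k)"
    by (rule finite_measure_UNION) (auto simp: disjoint_family_on_def)
  moreover have "(\<lambda>k. prob (?E k)) sums 1"
    using A sums_poisson_weights[of "measure \<Lambda> A"]
    by (simp add: poisson_distributed fmeasurable_def less_top)
  ultimately have "prob (\<Union>k. ?E k) = 1" by (rule sums_unique2)
  then have "AE \<omega> in M. \<omega> \<in> (\<Union>k. ?E k)" by (rule AE_prob_1)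
  then show ?thesis by (auto elim!: AE_mp)
qed

lemma nn_integral_count:
  assumes A: "A \<in> fmeasurable \<Lambda>" and [measurable]: "h \<in> borel_measurable borel"
  shows "(\<integral>\<^sup>+\<omega>. h (emeasure (N \<omega>) A) \<partial>M) =
    (\<Sum>k. h (of_nat k) * ennreal (exp (- measure \<Lambda> A) * measure \<Lambda> A ^ k / fact k))"
proof -
  have [measurable]: "(\<lambda>\<omega>. emeasure (N \<omega>) A) \<in> borel_measurable M"
    using A by (auto intro: measurable_N simp: fmeasurable_def)
  let ?E = "\<lambda>k::nat. {\<omega> \<in> space M. emeasure (N \<omega>) A = of_nat k}"
  have "(\<integral>\<^sup>+\<omega>. h (emeasure (N \<omega>) A) \<partial>M) = (\<integral>\<^sup>+\<omega>. (\<Sum>k. h (of_nat k) * indicator (?E k) \<omega>) \<partial>M)"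
  proof (rule nn_integral_cong_AE)
    show "AE \<omega> in M. h (emeasure (N \<omega>) A) = (\<Sum>k. h (of_nat k) * indicator (?E k) \<omega>)"
      using AE_emeasure_N_nat[OF A] AE_space
    proof eventually_elim
      case (elim \<omega>)
      then obtain k :: nat where k: "emeasure (N \<omega>) A = of_nat k" by auto
      have "(\<Sum>i. h (of_nat i) * indicator (?E i) \<omega>) = (\<Sum>i\<in>{k}. h (of_nat i) * indicator (?E i) \<omega>)"
        by (rule suminf_finite) (auto simp: k)
      then show ?case using elim k by simp
    qed
  qed
  also have "\<dots> = (\<Sum>k. h (of_nat k) * emeasure M (?E k))"
    by (subst nn_integral_suminf) (auto simp: nn_integral_cmult_indicator)
  also have "\<dots> = (\<Sum>k. h (of_nat k) * ennreal (exp (- measure \<Lambda> A) * measure \<Lambda> A ^ k / fact k))"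
    using A by (simp add: emeasure_eq_measure poisson_distributed fmeasurable_def less_top)
  finally show ?thesis .
qed

lemma mass_measurable: "A \<in> sets \<Lambda> \<Longrightarrow> mass A \<in> borel_measurable M"
  unfolding mass_def[abs_def] measure_def by (intro borel_measurable_enn2real measurable_N)

lemma centred_mass_measurable: "A \<in> sets \<Lambda> \<Longrightarrow> centred_mass A \<in> borel_measurable M"
  unfolding centred_mass_def[abs_def] by (intro borel_measurable_diff mass_measurable) auto

lemma
  assumes A: "A \<in> fmeasurable \<Lambda>"
  shows integrable_mass: "integrable M (mass A)"
    and expectation_mass: "expectation (mass A) = measure \<Lambda> A"
    and integrable_mass_sq: "integrable M (\<lambda>\<omega>. (mass A \<omega>)\<^sup>2)"
    and expectation_mass_sq: "expectation (\<lambda>\<omega>. (mass A \<omega>)\<^sup>2) = (measure \<Lambda> A)\<^sup>2 + measure \<Lambda> A"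
proof -
  have [measurable]: "mass A \<in> borel_measurable M"
    using A by (auto intro: mass_measurable simp: fmeasurable_def)
  have 1: "(\<integral>\<^sup>+\<omega>. ennreal (mass A \<omega>) \<partial>M) = ennreal (measure \<Lambda> A)"
  proof -
    have "(\<integral>\<^sup>+\<omega>. ennreal (mass A \<omega>) \<partial>M) = (\<integral>\<^sup>+\<omega>. (\<lambda>x. ennreal (enn2real x)) (emeasure (N \<omega>) A) \<partial>M)"
      by (simp add: mass_def measure_def)
    also have "\<dots> = (\<Sum>k. ennreal (real k * (exp (- measure \<Lambda> A) * measure \<Lambda> A ^ k / fact k)))"
      by (subst nn_integral_count[OF A]) (auto simp: ennreal_mult[symmetric] enn2real_of_nat)
    also have "\<dots> = ennreal (measure \<Lambda> A)"
      using sums_poisson_mean[of "measure \<Lambda> A"] by (intro suminf_ennreal_eq) auto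
    finally show ?thesis .
  qed
  have 2: "(\<integral>\<^sup>+\<omega>. ennreal ((mass A \<omega>)\<^sup>2) \<partial>M) = ennreal ((measure \<Lambda> A)\<^sup>2 + measure \<Lambda> A)"
  proof -
    have "(\<integral>\<^sup>+\<omega>. ennreal ((mass A \<omega>)\<^sup>2) \<partial>M) = (\<integral>\<^sup>+\<omega>. (\<lambda>x. ennreal ((enn2real x)\<^sup>2)) (emeasure (N \<omega>) A) \<partial>M)"
      by (simp add: mass_def measure_def)
    also have "\<dots> = (\<Sum>k. ennreal ((real k)\<^sup>2 * (exp (- measure \<Lambda> A) * measure \<Lambda> A ^ k / fact k)))"
      by (subst nn_integral_count[OF A]) (auto simp: ennreal_mult[symmetric] enn2real_of_nat)
    also have "\<dots> = ennreal ((measure \<Lambda> A)\<^sup>2 + measure \<Lambda> A)"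
      using sums_poisson_second_moment[of "measure \<Lambda> A"] by (intro suminf_ennreal_eq) auto
    finally show ?thesis .
  qed
  have nonneg: "0 \<le> mass A \<omega>" for \<omega> by (simp add: mass_def)
  have "has_bochner_integral M (mass A) (measure \<Lambda> A)"
    using 1 nonneg by (intro has_bochner_integral_nn_integral) auto
  then show "integrable M (mass A)" "expectation (mass A) = measure \<Lambda> A"
    by (auto simp: has_bochner_integral_iff)
  have "has_bochner_integral M (\<lambda>\<omega>. (mass A \<omega>)\<^sup>2) ((measure \<Lambda> A)\<^sup>2 + measure \<Lambda> A)"
    using 2 by (intro has_bochner_integral_nn_integral) auto
  then show "integrable M (\<lambda>\<omega>. (mass A \<omega>)\<^sup>2)"
    "expectation (\<lambda>\<omega>. (mass A \<omega>)\<^sup>2) = (measure \<Lambda> A)\<^sup>2 + measure \<Lambda> A"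
    by (auto simp: has_bochner_integral_iff)
qed

lemma mass_Un:
  assumes "\<omega> \<in> space M" "A \<in> sets \<Lambda>" "B \<in> sets \<Lambda>" "A \<inter> B = {}"
    "emeasure (N \<omega>) (A \<union> B) \<noteq> \<infinity>"
  shows "mass (A \<union> B) \<omega> = mass A \<omega> + mass B \<omega>"
proof -
  have s: "A \<in> sets (N \<omega>)" "B \<in> sets (N \<omega>)" using assms sets_N by auto
  have "emeasure (N \<omega>) A \<noteq> \<infinity>" "emeasure (N \<omega>) B \<noteq> \<infinity>"
    using emeasure_mono[of A "A \<union> B" "N \<omega>"] emeasure_mono[of B "A \<union> B" "N \<omega>"] s assms(5)
    by (auto simp: top_unique)
  then show ?thesis unfolding mass_def using s assms by (intro measure_Union) auto
qed

lemma AE_centred_mass_Un: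
  assumes "A \<in> fmeasurable \<Lambda>" "B \<in> fmeasurable \<Lambda>" "A \<inter> B = {}"
  shows "AE \<omega> in M. centred_mass (A \<union> B) \<omega> = centred_mass A \<omega> + centred_mass B \<omega>"
  using AE_emeasure_N_nat[OF fmeasurable.Un[OF assms(1,2)]] AE_space
proof eventually_elim
  case (elim \<omega>)
  then have "mass (A \<union> B) \<omega> = mass A \<omega> + mass B \<omega>"
    using assms by (intro mass_Un) auto
  moreover have "measure \<Lambda> (A \<union> B) = measure \<Lambda> A + measure \<Lambda> B"
    using assms by (intro measure_Union) (auto simp: fmeasurable_def)
  ultimately show ?case by (simp add: centred_mass_def)
qed

lemma
  assumes A: "A \<in> fmeasurable \<Lambda>"
  shows integrable_centred_mass: "integrable M (centred_mass A)"
    and expectation_centred_mass: "expectation (centred_mass A) = 0"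
    and integrable_centred_mass_sq: "integrable M (\<lambda>\<omega>. (centred_mass A \<omega>)\<^sup>2)"
    and expectation_centred_mass_sq: "expectation (\<lambda>\<omega>. centred_mass A \<omega> * centred_mass A \<omega>) = measure \<Lambda> A"
proof -
  have int: "integrable M (mass A)" "integrable M (\<lambda>\<omega>. (mass A \<omega>)\<^sup>2)"
    using A by (auto intro: integrable_mass integrable_mass_sq)
  show "integrable M (centred_mass A)" "expectation (centred_mass A) = 0"
    unfolding centred_mass_def[abs_def] using int expectation_mass[OF A] by (auto simp: prob_space)
  have eq: "(\<lambda>\<omega>. (centred_mass A \<omega>)\<^sup>2) = (\<lambda>\<omega>. (mass A \<omega>)\<^sup>2 - 2 * measure \<Lambda> A * mass A \<omega> + (measure \<Lambda> A)\<^sup>2)"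
    by (rule ext) (simp add: centred_mass_def power2_eq_square algebra_simps)
  show "integrable M (\<lambda>\<omega>. (centred_mass A \<omega>)\<^sup>2)" unfolding eq using int by auto
  have "expectation (\<lambda>\<omega>. (centred_mass A \<omega>)\<^sup>2) = measure \<Lambda> A" unfolding eq
    using int expectation_mass[OF A] expectation_mass_sq[OF A]
    by (simp add: prob_space power2_eq_square algebra_simps)
  then show "expectation (\<lambda>\<omega>. centred_mass A \<omega> * centred_mass A \<omega>) = measure \<Lambda> A"
    by (simp add: power2_eq_square)
qed

text \<open>
  Disjoint sets carry independent masses, hence uncorrelated ones.
\<close>

lemma
  assumes A: "A \<in> fmeasurable \<Lambda>" and B: "B \<in> fmeasurable \<Lambda>" and disj: "A \<inter> B = {}"
  shows integrable_centred_mass_disjoint: "integrable M (\<lambda>\<omega>. centred_mass A \<omega> * centred_mass B \<omega>)"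
    and expectation_centred_mass_disjoint: "expectation (\<lambda>\<omega>. centred_mass A \<omega> * centred_mass B \<omega>) = 0"
proof -
  let ?A = "\<lambda>i::nat. if i = 0 then A else B"
  let ?Y = "\<lambda>i. centred_mass (?A i)"
  have iv: "indep_vars (\<lambda>_. borel) (\<lambda>i \<omega>. emeasure (N \<omega>) (?A i)) {..<2::nat}"
    using assms by (intro independently_scattered) (auto simp: disjoint_family_on_def fmeasurable_def)
  have "indep_vars (\<lambda>_. borel) (\<lambda>i \<omega>. centred_mass (?A i) \<omega>) {..<2::nat}"
    unfolding centred_mass_def mass_def measure_def[of "N _"] by (rule indep_vars_compose2[OF iv]) auto
  then have iv: "indep_vars (\<lambda>_. borel) ?Y {..<2::nat}" .
  have int: "\<And>i. i \<in> {..<2::nat} \<Longrightarrow> integrable M (?Y i)"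
    using A B by (auto intro: integrable_centred_mass)
  have eq: "(\<lambda>\<omega>. \<Prod>i\<in>{..<2::nat}. ?Y i \<omega>) = (\<lambda>\<omega>. centred_mass A \<omega> * centred_mass B \<omega>)"
    by (auto simp: numeral_2_eq_2)
  show "integrable M (\<lambda>\<omega>. centred_mass A \<omega> * centred_mass B \<omega>)"
    using indep_vars_integrable[OF _ iv int] unfolding eq by simp
  have "expectation (\<lambda>\<omega>. \<Prod>i\<in>{..<2::nat}. ?Y i \<omega>) = (\<Prod>i\<in>{..<2::nat}. expectation (?Y i))"
    by (rule indep_vars_lebesgue_integral[OF _ iv int]) auto
  then show "expectation (\<lambda>\<omega>. centred_mass A \<omega> * centred_mass B \<omega>) = 0"
    unfolding eq using A B by (simp add: numeral_2_eq_2 expectation_centred_mass)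
qed

end

section \<open>Covariances, past and future\<close>

context poisson_random_measure
begin

text \<open>
  Both sets are split along their intersection; only the square of the common part has a nonzero mean.
\<close>

lemma
  assumes A: "A \<in> fmeasurable \<Lambda>" and B: "B \<in> fmeasurable \<Lambda>"
  shows integrable_centred_mass_mult: "integrable M (\<lambda>\<omega>. centred_mass A \<omega> * centred_mass B \<omega>)"
    and covariance_centred_mass: "expectation (\<lambda>\<omega>. centred_mass A \<omega> * centred_mass B \<omega>) = measure \<Lambda> (A \<inter> B)"
proof -
  let ?C = "A \<inter> B" and ?A = "A - B" and ?B = "B - A"
  have fm: "?C \<in> fmeasurable \<Lambda>" "?A \<in> fmeasurable \<Lambda>" "?B \<in> fmeasurable \<Lambda>"
    using A B by (auto intro: fmeasurable.Int fmeasurable.Diff)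
  have meas: "(\<lambda>\<omega>. centred_mass A \<omega> * centred_mass B \<omega>) \<in> borel_measurable M"
    using A B by (intro borel_measurable_times centred_mass_measurable) auto
  let ?S = "\<lambda>\<omega>. centred_mass ?C \<omega> * centred_mass ?C \<omega> + centred_mass ?C \<omega> * centred_mass ?B \<omega> + (centred_mass ?A \<omega> * centred_mass ?C \<omega> + centred_mass ?A \<omega> * centred_mass ?B \<omega>)"
  have "AE \<omega> in M. centred_mass (?C \<union> ?A) \<omega> = centred_mass ?C \<omega> + centred_mass ?A \<omega>"
    "AE \<omega> in M. centred_mass (?C \<union> ?B) \<omega> = centred_mass ?C \<omega> + centred_mass ?B \<omega>"
    using fm by (auto intro!: AE_centred_mass_Un)
  moreover have "?C \<union> ?A = A" "?C \<union> ?B = B" by auto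
  ultimately have ae: "AE \<omega> in M. centred_mass A \<omega> * centred_mass B \<omega> = ?S \<omega>"
    by (auto elim!: eventually_elim2 simp: algebra_simps)
  have int: "integrable M (\<lambda>\<omega>. centred_mass ?C \<omega> * centred_mass ?C \<omega>)" "integrable M (\<lambda>\<omega>. centred_mass ?C \<omega> * centred_mass ?B \<omega>)"
    "integrable M (\<lambda>\<omega>. centred_mass ?A \<omega> * centred_mass ?C \<omega>)" "integrable M (\<lambda>\<omega>. centred_mass ?A \<omega> * centred_mass ?B \<omega>)"
    using integrable_centred_mass_sq[OF fm(1)] fm
    by (auto intro!: integrable_centred_mass_disjoint simp: power2_eq_square)
  have measS: "?S \<in> borel_measurable M" using int by auto
  have "integrable M ?S" using int by auto
  then show "integrable M (\<lambda>\<omega>. centred_mass A \<omega> * centred_mass B \<omega>)"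
    using integrable_cong_AE[OF meas measS ae] by simp
  have "expectation (\<lambda>\<omega>. centred_mass A \<omega> * centred_mass B \<omega>) = expectation ?S"
    by (rule integral_cong_AE[OF meas measS ae])
  also have "\<dots> = measure \<Lambda> ?C + 0 + (0 + 0)"
  proof -
    have "expectation (\<lambda>\<omega>. centred_mass ?C \<omega> * centred_mass ?B \<omega>) = 0"
      "expectation (\<lambda>\<omega>. centred_mass ?A \<omega> * centred_mass ?C \<omega>) = 0"
      "expectation (\<lambda>\<omega>. centred_mass ?A \<omega> * centred_mass ?B \<omega>) = 0"
      using fm by (auto intro!: expectation_centred_mass_disjoint)
    then show ?thesis
      using int expectation_centred_mass_sq[OF fm(1)] by (simp only: Bochner_Integration.integral_add Bochner_Integration.integrable_add)
  qed
  finally show "expectation (\<lambda>\<omega>. centred_mass A \<omega> * centred_mass B \<omega>) = measure \<Lambda> (A \<inter> B)" by simp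
qed

definition future :: "real \<Rightarrow> 'w measure" where
  "future t = sigma (space M)
     {{\<omega> \<in> space M. emeasure (N \<omega>) A \<in> S} | A S.
        A \<in> sets \<Lambda> \<and> A \<subseteq> UNIV \<times> {t<..} \<and> S \<in> sets borel}"

lemma space_future: "space (future t) = space M"
  unfolding future_def by (rule space_measure_of) auto

lemma sets_future: "sets (future t) = sigma_sets (space M)
     {{\<omega> \<in> space M. emeasure (N \<omega>) A \<in> S} | A S.
        A \<in> sets \<Lambda> \<and> A \<subseteq> UNIV \<times> {t<..} \<and> S \<in> sets borel}"
  unfolding future_def by (rule sets_measure_of) auto

lemma centred_mass_future:
  assumes "A \<in> sets \<Lambda>" "A \<subseteq> UNIV \<times> {t<..}"
  shows "centred_mass A \<in> borel_measurable (future t)"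
proof -
  have "(\<lambda>\<omega>. emeasure (N \<omega>) A) \<in> borel_measurable (future t)"
  proof (rule measurableI)
    fix S :: "ennreal set" assume "S \<in> sets borel"
    then have "{\<omega> \<in> space M. emeasure (N \<omega>) A \<in> S} \<in> sets (future t)"
      using assms by (auto simp: sets_future)
    moreover have "{\<omega> \<in> space M. emeasure (N \<omega>) A \<in> S} = (\<lambda>\<omega>. emeasure (N \<omega>) A) -` S \<inter> space (future t)"
      by (auto simp: space_future)
    ultimately show "(\<lambda>\<omega>. emeasure (N \<omega>) A) -` S \<inter> space (future t) \<in> sets (future t)" by simp
  qed auto
  then show ?thesis
    unfolding centred_mass_def[abs_def] mass_def measure_def[of "N _"]
    by (intro borel_measurable_diff borel_measurable_enn2real) auto
qed

lemma measurable_F_M: "f \<in> measurable (F t) K \<Longrightarrow> f \<in> measurable M K"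
  using sub_events[of t] space_F[of t] by (auto simp: measurable_def)

lemma measurable_F_mono: "f \<in> measurable (F s) K \<Longrightarrow> s \<le> t \<Longrightarrow> f \<in> measurable (F t) K"
  using sets_F_mono[of s t] space_F by (auto simp: measurable_def)

text \<open>
  Independence of the increments after \<open>t\<close> from the past, in the form in which it is used below.
\<close>

lemma
  fixes \<zeta> Y :: "'w \<Rightarrow> real"
  assumes t: "0 \<le> t" and \<zeta>: "\<zeta> \<in> borel_measurable (F t)" "integrable M \<zeta>"
    and Y: "Y \<in> borel_measurable (future t)" "integrable M Y"
  shows integrable_past_future: "integrable M (\<lambda>\<omega>. \<zeta> \<omega> * Y \<omega>)"
    and expectation_past_future: "expectation (\<lambda>\<omega>. \<zeta> \<omega> * Y \<omega>) = expectation \<zeta> * expectation Y"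
proof -
  have "indep_set (sets (F t)) (sets (future t))"
    using future_independent[OF t] by (simp add: sets_future)
  moreover have "sigma_sets (space M) {\<zeta> -` A \<inter> space M |A. A \<in> sets borel} \<subseteq> sets (F t)"
  proof -
    have "{\<zeta> -` A \<inter> space M |A. A \<in> sets borel} \<subseteq> sets (F t)"
      using measurable_sets[OF \<zeta>(1)] by (auto simp: space_F)
    then show ?thesis using sets.sigma_sets_subset[of _ "F t"] by (simp add: space_F)
  qed
  moreover have "sigma_sets (space M) {Y -` A \<inter> space M |A. A \<in> sets borel} \<subseteq> sets (future t)"
  proof -
    have "{Y -` A \<inter> space M |A. A \<in> sets borel} \<subseteq> sets (future t)"
      using measurable_sets[OF Y(1)] by (auto simp: space_future)
    then show ?thesis using sets.sigma_sets_subset[of _ "future t"] by (simp add: space_future)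
  qed
  ultimately have "indep_set (sigma_sets (space M) {\<zeta> -` A \<inter> space M |A. A \<in> sets borel})
      (sigma_sets (space M) {Y -` A \<inter> space M |A. A \<in> sets borel})"
    unfolding indep_sets2_eq by (meson subsetD subset_trans)
  moreover have "\<zeta> \<in> borel_measurable M" "Y \<in> borel_measurable M" using \<zeta> Y by auto
  ultimately have iv: "indep_var borel \<zeta> borel Y" by (simp add: indep_var_eq)
  show "integrable M (\<lambda>\<omega>. \<zeta> \<omega> * Y \<omega>)" by (rule indep_var_integrable[OF iv \<zeta>(2) Y(2)])
  show "expectation (\<lambda>\<omega>. \<zeta> \<omega> * Y \<omega>) = expectation \<zeta> * expectation Y"
    by (rule indep_var_lebesgue_integral[OF iv \<zeta>(2) Y(2)])
qed

text \<open>
  The core of the isometry. The part of \<open>A\<close> up to time \<open>r\<close> is, like the weight, known at \<open>r\<close>,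
  and the mass of \<open>B\<close> is centred and independent of the past: that part has mean zero. The part after \<open>r\<close>
  lies in the future together with \<open>B\<close>, and the weight factors out.
\<close>

lemma
  fixes \<zeta> :: "'w \<Rightarrow> real"
  assumes r: "0 \<le> r" and \<zeta>: "\<zeta> \<in> borel_measurable (F r)" "\<And>\<omega>. \<omega> \<in> space M \<Longrightarrow> \<bar>\<zeta> \<omega>\<bar> \<le> K"
    and A: "A \<in> fmeasurable \<Lambda>" and B: "B \<in> fmeasurable \<Lambda>" "B \<subseteq> UNIV \<times> {r<..}"
  shows integrable_weighted_centred_mass: "integrable M (\<lambda>\<omega>. \<zeta> \<omega> * (centred_mass A \<omega> * centred_mass B \<omega>))"
    and expectation_weighted_centred_mass:
      "expectation (\<lambda>\<omega>. \<zeta> \<omega> * (centred_mass A \<omega> * centred_mass B \<omega>)) = expectation \<zeta> * measure \<Lambda> (A \<inter> B)"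
proof -
  define A1 where "A1 = A \<inter> (space \<nu> \<times> {0..r})"
  define A2 where "A2 = A \<inter> (space \<nu> \<times> {r<..})"
  have Asp: "A \<subseteq> space \<nu> \<times> {0..}"
    using A sets.sets_into_space[of A \<Lambda>] by (auto simp: space_mark_time fmeasurable_def)
  have fm: "A1 \<in> fmeasurable \<Lambda>" "A2 \<in> fmeasurable \<Lambda>"
    using A r unfolding A1_def A2_def by (auto intro!: fmeasurable_Int_fmeasurable box_sets)
  have A_eq: "A1 \<union> A2 = A" "A1 \<inter> A2 = {}" using Asp by (auto simp: A1_def A2_def)
  have \<zeta>M: "\<zeta> \<in> borel_measurable M" using \<zeta>(1) by (rule measurable_F_M)
  have int\<zeta>: "integrable M \<zeta>"
    using \<zeta>M \<zeta>(2) by (intro integrable_const_bound[where B=K]) auto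
  have A1F: "centred_mass A1 \<in> borel_measurable (F r)"
  proof -
    have "(\<lambda>\<omega>. emeasure (N \<omega>) A1) \<in> borel_measurable (F r)"
      using fm r by (intro adapted_N) (auto simp: A1_def)
    then show ?thesis unfolding centred_mass_def[abs_def] mass_def measure_def[of "N _"]
      by (intro borel_measurable_diff borel_measurable_enn2real) auto
  qed
  have int1: "integrable M (\<lambda>\<omega>. \<zeta> \<omega> * centred_mass A1 \<omega>)"
  proof (rule Bochner_Integration.integrable_bound)
    show "integrable M (\<lambda>\<omega>. K * centred_mass A1 \<omega>)" using integrable_centred_mass[OF fm(1)] by simp
    show "(\<lambda>\<omega>. \<zeta> \<omega> * centred_mass A1 \<omega>) \<in> borel_measurable M"
      using \<zeta>M integrable_centred_mass[OF fm(1)] by auto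
    show "AE \<omega> in M. norm (\<zeta> \<omega> * centred_mass A1 \<omega>) \<le> norm (K * centred_mass A1 \<omega>)"
      using \<zeta>(2) by (auto simp: abs_mult intro!: mult_right_mono order_trans[OF \<zeta>(2) abs_ge_self])
  qed
  have BF: "centred_mass B \<in> borel_measurable (future r)" "centred_mass A2 \<in> borel_measurable (future r)"
    using B fm by (auto intro!: centred_mass_future simp: A2_def)
  have m1: "(\<lambda>\<omega>. \<zeta> \<omega> * centred_mass A1 \<omega>) \<in> borel_measurable (F r)" using \<zeta>(1) A1F by auto
  have m2: "(\<lambda>\<omega>. centred_mass A2 \<omega> * centred_mass B \<omega>) \<in> borel_measurable (future r)" using BF by auto
  note i1 = integrable_past_future[OF r m1 int1 BF(1) integrable_centred_mass[OF B(1)]]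
  note e1 = expectation_past_future[OF r m1 int1 BF(1) integrable_centred_mass[OF B(1)]]
  note i2 = integrable_past_future[OF r \<zeta>(1) int\<zeta> m2 integrable_centred_mass_mult[OF fm(2) B(1)]]
  note e2 = expectation_past_future[OF r \<zeta>(1) int\<zeta> m2 integrable_centred_mass_mult[OF fm(2) B(1)]]
  let ?S = "\<lambda>\<omega>. \<zeta> \<omega> * centred_mass A1 \<omega> * centred_mass B \<omega> + \<zeta> \<omega> * (centred_mass A2 \<omega> * centred_mass B \<omega>)"
  have ae: "AE \<omega> in M. \<zeta> \<omega> * (centred_mass A \<omega> * centred_mass B \<omega>) = ?S \<omega>"
    using AE_centred_mass_Un[OF fm A_eq(2)] unfolding A_eq by eventually_elim (simp add: algebra_simps)
  have meas: "(\<lambda>\<omega>. \<zeta> \<omega> * (centred_mass A \<omega> * centred_mass B \<omega>)) \<in> borel_measurable M"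
    using \<zeta>M A B by (intro borel_measurable_times centred_mass_measurable) auto
  have intS: "integrable M ?S" using i1 i2 by simp
  then show "integrable M (\<lambda>\<omega>. \<zeta> \<omega> * (centred_mass A \<omega> * centred_mass B \<omega>))"
    using integrable_cong_AE[OF meas _ ae] by auto
  have "expectation (\<lambda>\<omega>. \<zeta> \<omega> * (centred_mass A \<omega> * centred_mass B \<omega>)) = expectation ?S"
    using intS by (intro integral_cong_AE[OF meas _ ae]) auto
  also have "\<dots> = expectation \<zeta> * measure \<Lambda> (A2 \<inter> B)"
    using i1 i2 by (simp add: e1 e2 expectation_centred_mass[OF B(1)] covariance_centred_mass[OF fm(2) B(1)])
  also have "A2 \<inter> B = A \<inter> B" using B(2) Asp by (auto simp: A2_def)
  finally show "expectation (\<lambda>\<omega>. \<zeta> \<omega> * (centred_mass A \<omega> * centred_mass B \<omega>)) = expectation \<zeta> * measure \<Lambda> (A \<inter> B)" .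
qed

end

section \<open>The isometry for elementary integrals\<close>

context poisson_random_measure
begin

abbreviation "MP \<equiv> M \<Otimes>\<^sub>M \<Lambda>"

sublocale MP: pair_sigma_finite M \<Lambda>
proof -
  interpret sigma_finite_measure \<Lambda> by (rule sigma_finite_\<Lambda>)
  show "pair_sigma_finite M \<Lambda>" ..
qed

text \<open>
  One entry of an elementary integrand, restricted to the time window \<open>(u, v]\<close>: first its integral,
  then the entry itself as a function on the product space.
\<close>

definition entry_inc :: "real \<Rightarrow> real \<Rightarrow> real \<times> real \<times> 'z set \<times> ('w \<Rightarrow> 'h::real_normed_vector) \<Rightarrow> 'w \<Rightarrow> 'h" where
  "entry_inc u v p \<omega> = (case p of (a, b, B, \<xi>) \<Rightarrow> centred_mass (B \<times> ({a<..b} \<inter> {u<..v})) \<omega> *\<^sub>R \<xi> \<omega>)"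

definition entry_val :: "real \<Rightarrow> real \<Rightarrow> real \<times> real \<times> 'z set \<times> ('w \<Rightarrow> 'h::real_normed_vector)
    \<Rightarrow> 'w \<times> ('z \<times> real) \<Rightarrow> 'h" where
  "entry_val u v p x = (case p of (a, b, B, \<xi>) \<Rightarrow>
     (indicator (B \<times> ({a<..b} \<inter> {u<..v})) (snd x) :: real) *\<^sub>R \<xi> (fst x))"

lemma
  fixes g :: "'w \<Rightarrow> real" and h :: "'z \<times> real \<Rightarrow> real"
  assumes g: "integrable M g" and h: "integrable \<Lambda> h"
  shows integrable_MP_times: "integrable MP (\<lambda>x. g (fst x) * h (snd x))"
    and integral_MP_times: "(\<integral>x. g (fst x) * h (snd x) \<partial>MP) = (\<integral>\<omega>. g \<omega> \<partial>M) * (\<integral>y. h y \<partial>\<Lambda>)"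
proof -
  have [measurable]: "g \<in> borel_measurable M" "h \<in> borel_measurable \<Lambda>" using g h by auto
  have "integrable MP (\<lambda>(\<omega>, y). g \<omega> * h y)"
    using g h by (intro MP.Fubini_integrable) (auto simp: abs_mult)
  then show int: "integrable MP (\<lambda>x. g (fst x) * h (snd x))" by (simp add: case_prod_beta')
  show "(\<integral>x. g (fst x) * h (snd x) \<partial>MP) = (\<integral>\<omega>. g \<omega> \<partial>M) * (\<integral>y. h y \<partial>\<Lambda>)"
    using MP.integral_fst'[OF int] by simp
qed

text \<open>
  The inner product of the two coefficients is known at the later of the two starting times, which
  makes it an admissible weight.
\<close>

lemma
  fixes \<xi> \<eta> :: "'w \<Rightarrow> 'h::{real_inner, second_countable_topology}"
  assumes p: "elementary_predictable M F \<nu> [(a, b, B, \<xi>)]"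
    and q: "elementary_predictable M F \<nu> [(c, d, C, \<eta>)]" and uv: "0 \<le> u" "u \<le> v" and ac: "a \<le> c"
  shows integrable_entry_inc_inner_ordered: "integrable M (\<lambda>\<omega>. entry_inc u v (a, b, B, \<xi>) \<omega> \<bullet> entry_inc u v (c, d, C, \<eta>) \<omega>)"
    and integrable_entry_val_inner_ordered: "integrable MP (\<lambda>x. entry_val u v (a, b, B, \<xi>) x \<bullet> entry_val u v (c, d, C, \<eta>) x)"
    and isometry_inner_ordered: "(\<integral>\<omega>. entry_inc u v (a, b, B, \<xi>) \<omega> \<bullet> entry_inc u v (c, d, C, \<eta>) \<omega> \<partial>M)
       = (\<integral>x. entry_val u v (a, b, B, \<xi>) x \<bullet> entry_val u v (c, d, C, \<eta>) x \<partial>MP)"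
proof -
  define X where "X = B \<times> ({a<..b} \<inter> {u<..v})"
  define Y where "Y = C \<times> ({c<..d} \<inter> {u<..v})"
  define \<zeta> where "\<zeta> \<omega> = \<xi> \<omega> \<bullet> \<eta> \<omega>" for \<omega>
  have 0: "0 \<le> a" "0 \<le> c" using p q by (auto simp: elementary_predictable_def)
  have X: "X \<in> fmeasurable \<Lambda>" unfolding X_def using p uv
    by (intro box_fmeasurable[where T=v]) (auto simp: elementary_predictable_def fmeasurable_def)
  have Y: "Y \<in> fmeasurable \<Lambda>" unfolding Y_def using q uv
    by (intro box_fmeasurable[where T=v]) (auto simp: elementary_predictable_def fmeasurable_def)
  have Yc: "Y \<subseteq> UNIV \<times> {c<..}" by (auto simp: Y_def)
  have \<zeta>: "\<zeta> \<in> borel_measurable (F c)"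
  proof -
    have "\<xi> \<in> borel_measurable (F c)" using p ac
      by (auto simp: elementary_predictable_def intro: measurable_F_mono)
    moreover have "\<eta> \<in> borel_measurable (F c)" using q by (auto simp: elementary_predictable_def)
    ultimately show ?thesis unfolding \<zeta>_def by (rule borel_measurable_inner)
  qed
  obtain K1 K2 where K: "\<And>\<omega>. \<omega> \<in> space M \<Longrightarrow> norm (\<xi> \<omega>) \<le> K1" "\<And>\<omega>. \<omega> \<in> space M \<Longrightarrow> norm (\<eta> \<omega>) \<le> K2"
    using p q by (fastforce simp: elementary_predictable_def bounded_iff)
  have \<zeta>K: "\<bar>\<zeta> \<omega>\<bar> \<le> K1 * K2" if "\<omega> \<in> space M" for \<omega>
  proof -
    have "\<bar>\<zeta> \<omega>\<bar> \<le> norm (\<xi> \<omega>) * norm (\<eta> \<omega>)" unfolding \<zeta>_def by (rule Cauchy_Schwarz_ineq2)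
    also have "\<dots> \<le> K1 * K2"
      using K[OF that] by (intro mult_mono) (auto intro: order_trans[OF norm_ge_zero])
    finally show ?thesis .
  qed
  have int\<zeta>: "integrable M \<zeta>"
    using \<zeta>K measurable_F_M[OF \<zeta>] by (intro integrable_const_bound[where B="K1 * K2"]) auto
  have eq1: "(\<lambda>\<omega>. entry_inc u v (a, b, B, \<xi>) \<omega> \<bullet> entry_inc u v (c, d, C, \<eta>) \<omega>) = (\<lambda>\<omega>. \<zeta> \<omega> * (centred_mass X \<omega> * centred_mass Y \<omega>))"
    by (auto simp: entry_inc_def \<zeta>_def X_def Y_def)
  have eq2: "(\<lambda>x. entry_val u v (a, b, B, \<xi>) x \<bullet> entry_val u v (c, d, C, \<eta>) x)
      = (\<lambda>x. \<zeta> (fst x) * indicator (X \<inter> Y) (snd x))"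
    by (rule ext) (simp add: entry_val_def \<zeta>_def X_def[symmetric] Y_def[symmetric] indicator_inter_arith
        del: Int_greaterThanAtMost)
  have XY: "X \<inter> Y \<in> fmeasurable \<Lambda>" using X Y by auto
  have XYs: "X \<inter> Y \<inter> space \<Lambda> = X \<inter> Y"
    using XY sets.sets_into_space[of "X \<inter> Y" \<Lambda>] by (auto simp only: fmeasurable_def)
  have intXY: "integrable \<Lambda> (indicator (X \<inter> Y) :: _ \<Rightarrow> real)"
    using XY by (auto simp: fmeasurable_def)
  show "integrable M (\<lambda>\<omega>. entry_inc u v (a, b, B, \<xi>) \<omega> \<bullet> entry_inc u v (c, d, C, \<eta>) \<omega>)"
    unfolding eq1 by (rule integrable_weighted_centred_mass[OF 0(2) \<zeta> \<zeta>K X Y Yc])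
  show "integrable MP (\<lambda>x. entry_val u v (a, b, B, \<xi>) x \<bullet> entry_val u v (c, d, C, \<eta>) x)"
    unfolding eq2 by (rule integrable_MP_times[OF int\<zeta> intXY])
  show "(\<integral>\<omega>. entry_inc u v (a, b, B, \<xi>) \<omega> \<bullet> entry_inc u v (c, d, C, \<eta>) \<omega> \<partial>M)
       = (\<integral>x. entry_val u v (a, b, B, \<xi>) x \<bullet> entry_val u v (c, d, C, \<eta>) x \<partial>MP)"
    unfolding eq1 eq2 integral_MP_times[OF int\<zeta> intXY] Bochner_Integration.integral_indicator XYs
    by (rule expectation_weighted_centred_mass[OF 0(2) \<zeta> \<zeta>K X Y Yc])
qed

lemma
  fixes p q :: "real \<times> real \<times> 'z set \<times> ('w \<Rightarrow> 'h::{real_inner, second_countable_topology})"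
  assumes p: "elementary_predictable M F \<nu> [p]" and q: "elementary_predictable M F \<nu> [q]"
    and uv: "0 \<le> u" "u \<le> v"
  shows integrable_entry_inc_inner: "integrable M (\<lambda>\<omega>. entry_inc u v p \<omega> \<bullet> entry_inc u v q \<omega>)" (is ?A)
    and integrable_entry_val_inner: "integrable MP (\<lambda>x. entry_val u v p x \<bullet> entry_val u v q x)" (is ?B)
    and isometry_inner: "(\<integral>\<omega>. entry_inc u v p \<omega> \<bullet> entry_inc u v q \<omega> \<partial>M) = (\<integral>x. entry_val u v p x \<bullet> entry_val u v q x \<partial>MP)" (is ?C)
proof -
  obtain a b B \<xi> where pe: "p = (a, b, B, \<xi>)" by (cases p)
  obtain c d C \<eta> where qe: "q = (c, d, C, \<eta>)" by (cases q)
  have "?A \<and> ?B \<and> ?C"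
  proof (cases "a \<le> c")
    case True
    note * = p[unfolded pe] q[unfolded qe] uv True
    show ?thesis unfolding pe qe
      using integrable_entry_inc_inner_ordered[OF *] integrable_entry_val_inner_ordered[OF *] isometry_inner_ordered[OF *]
      by blast
  next
    case False
    then have "c \<le> a" by simp
    note * = q[unfolded qe] p[unfolded pe] uv this
    show ?thesis unfolding pe qe
      unfolding inner_commute[of "entry_inc u v (a, b, B, \<xi>) _"] inner_commute[of "entry_val u v (a, b, B, \<xi>) _"]
      using integrable_entry_inc_inner_ordered[OF *] integrable_entry_val_inner_ordered[OF *] isometry_inner_ordered[OF *]
      by blast
  qed
  then show ?A ?B ?C by auto
qed

lemma elementary_predictable_Cons:
  "elementary_predictable M F \<nu> (p # e) \<longleftrightarrow> elementary_predictable M F \<nu> [p] \<and> elementary_predictable M F \<nu> e"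
  by (auto simp: elementary_predictable_def)

text \<open>
  Both sides are bilinear, so it suffices to compare single entries.
\<close>

lemma isometry_sum_aux:
  fixes e :: "('w, 'z, 'h::{real_inner, second_countable_topology}) elementary"
  assumes e: "elementary_predictable M F \<nu> e" and q: "elementary_predictable M F \<nu> [q]"
    and uv: "0 \<le> u" "u \<le> v"
  shows "integrable M (\<lambda>\<omega>. (\<Sum>p\<leftarrow>e. entry_inc u v p \<omega>) \<bullet> entry_inc u v q \<omega>) \<and>
    integrable MP (\<lambda>x. (\<Sum>p\<leftarrow>e. entry_val u v p x) \<bullet> entry_val u v q x) \<and>
    (\<integral>\<omega>. (\<Sum>p\<leftarrow>e. entry_inc u v p \<omega>) \<bullet> entry_inc u v q \<omega> \<partial>M) = (\<integral>x. (\<Sum>p\<leftarrow>e. entry_val u v p x) \<bullet> entry_val u v q x \<partial>MP)"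
  using e
proof (induction e)
  case (Cons p e)
  then have p: "elementary_predictable M F \<nu> [p]" and e: "elementary_predictable M F \<nu> e"
    by (auto simp: elementary_predictable_Cons[of p e])
  show ?case using Cons.IH[OF e] integrable_entry_inc_inner[OF p q uv] integrable_entry_val_inner[OF p q uv]
    isometry_inner[OF p q uv] by (simp add: inner_add_left)
qed simp

lemma isometry_sum:
  fixes e e' :: "('w, 'z, 'h::{real_inner, second_countable_topology}) elementary"
  assumes e: "elementary_predictable M F \<nu> e" and e': "elementary_predictable M F \<nu> e'"
    and uv: "0 \<le> u" "u \<le> v"
  shows "integrable M (\<lambda>\<omega>. (\<Sum>p\<leftarrow>e. entry_inc u v p \<omega>) \<bullet> (\<Sum>q\<leftarrow>e'. entry_inc u v q \<omega>)) \<and>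
    integrable MP (\<lambda>x. (\<Sum>p\<leftarrow>e. entry_val u v p x) \<bullet> (\<Sum>q\<leftarrow>e'. entry_val u v q x)) \<and>
    (\<integral>\<omega>. (\<Sum>p\<leftarrow>e. entry_inc u v p \<omega>) \<bullet> (\<Sum>q\<leftarrow>e'. entry_inc u v q \<omega>) \<partial>M)
      = (\<integral>x. (\<Sum>p\<leftarrow>e. entry_val u v p x) \<bullet> (\<Sum>q\<leftarrow>e'. entry_val u v q x) \<partial>MP)"
  using e'
proof (induction e')
  case (Cons q e')
  then have q: "elementary_predictable M F \<nu> [q]" and e': "elementary_predictable M F \<nu> e'"
    by (auto simp: elementary_predictable_Cons[of q e'])
  show ?case using Cons.IH[OF e'] isometry_sum_aux[OF e q uv] by (simp add: inner_add_right)
qed simp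

lemma sum_list_entry_val:
  "0 \<le> u \<Longrightarrow> (\<Sum>p\<leftarrow>e. entry_val u v p (\<omega>, z, s)) = indicator {u<..v} s *\<^sub>R elementary_integrand e s \<omega> z"
  unfolding elementary_integrand_def
  by (induction e) (auto simp: entry_val_def indicator_def scaleR_add_right)

text \<open>
  The two factors of the intensity in the definition are joined into the measure of one box.
\<close>

lemma elementary_integral_eq:
  assumes "elementary_predictable M F \<nu> e" "0 \<le> t"
  shows "elementary_integral \<nu> N e t \<omega> = (\<Sum>(a, b, B, \<xi>)\<leftarrow>e. centred_mass (B \<times> ({a<..b} \<inter> {..t})) \<omega> *\<^sub>R \<xi> \<omega>)"
  using assms(1)
proof (induction e)
  case (Cons p e)
  then have p: "elementary_predictable M F \<nu> [p]" and e: "elementary_predictable M F \<nu> e"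
    by (auto simp: elementary_predictable_Cons[of p e])
  obtain a b B \<xi> where pe: "p = (a, b, B, \<xi>)" by (cases p)
  have p': "0 \<le> a" "a \<le> b" "B \<in> sets \<nu>" using p by (auto simp: pe elementary_predictable_def)
  have I: "{a<..b} \<inter> {..t} = {min a t<..min b t}" by (auto simp: min_def)
  have "measure \<Lambda> (B \<times> ({a<..b} \<inter> {..t})) = measure \<nu> B * (min b t - min a t)"
    using p' assms(2) unfolding I measure_def
    by (subst emeasure_box) (auto simp: enn2real_mult)
  then have "centred_mass (B \<times> ({a<..b} \<inter> {..t})) \<omega> =
      measure (N \<omega>) (B \<times> {min a t<..min b t}) - measure \<nu> B * (min b t - min a t)"
    by (simp add: centred_mass_def mass_def I)
  then show ?case using Cons.IH[OF e] by (simp add: pe elementary_integral_def)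
qed (simp add: elementary_integral_def)

lemma elementary_increment_pathwise:
  assumes e: "elementary_predictable M F \<nu> e" and uv: "0 \<le> u" "u \<le> v" "v \<le> T" and \<omega>: "\<omega> \<in> space M"
    and fin: "\<forall>(a, b, B, \<xi>)\<in>set e. emeasure (N \<omega>) (B \<times> {0<..T}) < \<infinity>"
  shows "elementary_integral \<nu> N e v \<omega> - elementary_integral \<nu> N e u \<omega>
    = (\<Sum>p\<leftarrow>e. entry_inc u v p \<omega>)"
  using e fin
proof (induction e)
  case Nil then show ?case by (simp add: elementary_integral_def)
next
  case (Cons p e)
  then have p: "elementary_predictable M F \<nu> [p]" and e: "elementary_predictable M F \<nu> e"
    by (auto simp: elementary_predictable_Cons[of p e])
  obtain a b B \<xi> where pe: "p = (a, b, B, \<xi>)" by (cases p)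
  have p': "0 \<le> a" "a \<le> b" "B \<in> fmeasurable \<nu>" using p by (auto simp: pe elementary_predictable_def fmeasurable_def)
  have fB: "emeasure (N \<omega>) (B \<times> {0<..T}) < \<infinity>" using Cons.prems(2) by (simp add: pe)
  let ?U = "B \<times> ({a<..b} \<inter> {..u})" and ?W = "B \<times> ({a<..b} \<inter> {u<..v})" and ?V = "B \<times> ({a<..b} \<inter> {..v})"
  have I: "?U \<union> ?W = ?V" using uv by auto
  have fm: "?U \<in> fmeasurable \<Lambda>" "?W \<in> fmeasurable \<Lambda>" "?V \<in> fmeasurable \<Lambda>"
    using p' by (auto intro!: box_fmeasurable[where T=b])
  have "emeasure (N \<omega>) ?V \<le> emeasure (N \<omega>) (B \<times> {0<..T})"
    using p' uv sets_N[OF \<omega>] by (intro emeasure_mono) (auto intro!: box_sets simp: fmeasurable_def)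
  then have "emeasure (N \<omega>) (?U \<union> ?W) \<noteq> \<infinity>" unfolding I using fB by (auto simp: top_unique)
  then have "mass (?U \<union> ?W) \<omega> = mass ?U \<omega> + mass ?W \<omega>"
    using fm \<omega> by (intro mass_Un) (auto simp: fmeasurable_def)
  moreover have "measure \<Lambda> (?U \<union> ?W) = measure \<Lambda> ?U + measure \<Lambda> ?W"
    using fm by (intro measure_Union) (auto simp: fmeasurable_def)
  ultimately have "centred_mass ?V \<omega> = centred_mass ?U \<omega> + centred_mass ?W \<omega>" unfolding I centred_mass_def by linarith
  moreover have "\<forall>(a, b, B, \<xi>)\<in>set e. emeasure (N \<omega>) (B \<times> {0<..T}) < \<infinity>" using Cons.prems(2) by simp
  note Cons.IH[OF e this]
  moreover have v: "0 \<le> v" using uv by simp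
  ultimately show ?case
    using elementary_integral_eq[OF Cons.prems(1) uv(1), of \<omega>] elementary_integral_eq[OF Cons.prems(1) v, of \<omega>]
      elementary_integral_eq[OF e uv(1), of \<omega>] elementary_integral_eq[OF e v, of \<omega>]
    by (simp add: pe entry_inc_def algebra_simps scaleR_add_left)
qed

lemma AE_elementary_increment:
  assumes e: "elementary_predictable M F \<nu> e" and uv: "0 \<le> u" "u \<le> v"
  shows "AE \<omega> in M. elementary_integral \<nu> N e v \<omega> - elementary_integral \<nu> N e u \<omega> = (\<Sum>p\<leftarrow>e. entry_inc u v p \<omega>)"
proof -
  have "AE \<omega> in M. \<forall>(a, b, B, \<xi>)\<in>set e. emeasure (N \<omega>) (B \<times> {0<..v}) < \<infinity>"
  proof (subst AE_finite_all; (intro ballI)?)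
    fix p assume p: "p \<in> set e"
    obtain a b B \<xi> where pe: "p = (a, b, B, \<xi>)" by (cases p)
    have "case (a, b, B, \<xi>) of (a, b, B, \<xi>) \<Rightarrow> B \<in> sets \<nu> \<and> emeasure \<nu> B < \<infinity>"
      using e p unfolding elementary_predictable_def pe by fast
    then have "B \<times> {0<..v} \<in> fmeasurable \<Lambda>" by (intro box_fmeasurable[where T=v]) (auto simp: fmeasurable_def)
    from AE_emeasure_N_nat[OF this]
    show "AE \<omega> in M. case p of (a, b, B, \<xi>) \<Rightarrow> emeasure (N \<omega>) (B \<times> {0<..v}) < \<infinity>"
      unfolding pe by eventually_elim (auto simp: of_nat_less_top)
  qed simp
  then show ?thesis using AE_space
    by eventually_elim (rule elementary_increment_pathwise[OF e uv order_refl])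
qed

text \<open>
  The Ito isometry. The entries may overlap in time and in the marks: expanded as a bilinear form, the
  square involves only pairs of entries, and no common refinement of them is formed.
\<close>

lemma isometry:
  fixes e :: "('w, 'z, 'h::{real_inner, second_countable_topology}) elementary"
  assumes e: "elementary_predictable M F \<nu> e" and uv: "0 \<le> u" "u \<le> v"
  shows "(\<integral>\<^sup>+\<omega>. ennreal ((norm (elementary_integral \<nu> N e v \<omega> - elementary_integral \<nu> N e u \<omega>))\<^sup>2) \<partial>M)
    = (\<integral>\<^sup>+(\<omega>, z, s). indicator {u<..v} s * ennreal ((norm (elementary_integrand e s \<omega> z))\<^sup>2) \<partial>MP)"
proof -
  have "(\<integral>\<^sup>+\<omega>. ennreal ((norm (elementary_integral \<nu> N e v \<omega> - elementary_integral \<nu> N e u \<omega>))\<^sup>2) \<partial>M)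
    = (\<integral>\<^sup>+\<omega>. ennreal ((\<Sum>p\<leftarrow>e. entry_inc u v p \<omega>) \<bullet> (\<Sum>p\<leftarrow>e. entry_inc u v p \<omega>)) \<partial>M)"
    using AE_elementary_increment[OF e uv]
    by (intro nn_integral_cong_AE) (auto simp: power2_norm_eq_inner)
  also have "\<dots> = ennreal (\<integral>\<omega>. (\<Sum>p\<leftarrow>e. entry_inc u v p \<omega>) \<bullet> (\<Sum>p\<leftarrow>e. entry_inc u v p \<omega>) \<partial>M)"
    using isometry_sum[OF e e uv] by (intro nn_integral_eq_integral) auto
  also have "\<dots> = ennreal (\<integral>x. (\<Sum>p\<leftarrow>e. entry_val u v p x) \<bullet> (\<Sum>p\<leftarrow>e. entry_val u v p x) \<partial>MP)"
    using isometry_sum[OF e e uv] by simp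
  also have "\<dots> = (\<integral>\<^sup>+x. ennreal ((\<Sum>p\<leftarrow>e. entry_val u v p x) \<bullet> (\<Sum>p\<leftarrow>e. entry_val u v p x)) \<partial>MP)"
    using isometry_sum[OF e e uv] by (intro nn_integral_eq_integral[symmetric]) auto
  also have "\<dots> = (\<integral>\<^sup>+(\<omega>, z, s). indicator {u<..v} s * ennreal ((norm (elementary_integrand e s \<omega> z))\<^sup>2) \<partial>MP)"
    using uv by (intro nn_integral_cong)
      (auto simp: sum_list_entry_val power2_norm_eq_inner indicator_def split: prod.split)
  finally show ?thesis .
qed

end

section \<open>The compensation formula\<close>

lemma (in complete_measure) measurable_AE_cong:
  assumes g: "g \<in> measurable M K" and ae: "AE x in M. f x = g x"
    and sp: "\<And>x. x \<in> space M \<Longrightarrow> f x \<in> space K"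
  shows "f \<in> measurable M K"
proof (rule measurableI)
  fix S assume S: "S \<in> sets K"
  show "f -` S \<inter> space M \<in> sets M"
  proof (rule in_sets_AE)
    show "AE x in M. (x \<in> g -` S \<inter> space M) = (x \<in> f -` S \<inter> space M)"
      using ae by eventually_elim auto
  qed (use g S in auto)
qed (use sp in auto)

text \<open>
  The uniqueness theorem for finite measures, applied to the mean of a kernel. Measurability in the
  parameter, without which the mean is not additive, is carried along in the induction.
\<close>

lemma
  fixes M :: "'w measure" and \<kappa> :: "'w \<Rightarrow> 'x measure"
  assumes E: "Int_stable E" "E \<subseteq> Pow \<Omega>"
    and sets: "\<And>\<omega>. sets (\<kappa> \<omega>) = sigma_sets \<Omega> E" "sets Q = sigma_sets \<Omega> E"
    and fin: "\<And>\<omega>. emeasure (\<kappa> \<omega>) \<Omega> < \<infinity>" "emeasure Q \<Omega> < \<infinity>"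
    and meas: "\<And>A. A \<in> insert \<Omega> E \<Longrightarrow> (\<lambda>\<omega>. emeasure (\<kappa> \<omega>) A) \<in> borel_measurable M"
    and eq: "\<And>A. A \<in> insert \<Omega> E \<Longrightarrow> (\<integral>\<^sup>+\<omega>. emeasure (\<kappa> \<omega>) A \<partial>M) = emeasure Q A"
    and g: "g \<in> borel_measurable Q"
  shows kernel_measurable: "(\<lambda>\<omega>. \<integral>\<^sup>+x. g x \<partial>\<kappa> \<omega>) \<in> borel_measurable M" (is ?A)
    and kernel_integral: "(\<integral>\<^sup>+\<omega>. (\<integral>\<^sup>+x. g x \<partial>\<kappa> \<omega>) \<partial>M) = (\<integral>\<^sup>+x. g x \<partial>Q)" (is ?B)
proof -
  interpret S: sigma_algebra \<Omega> "sigma_sets \<Omega> E" using E(2) by (rule sigma_algebra_sigma_sets)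
  have setsP: "(\<lambda>\<omega>. emeasure (\<kappa> \<omega>) A) \<in> borel_measurable M \<and> (\<integral>\<^sup>+\<omega>. emeasure (\<kappa> \<omega>) A \<partial>M) = emeasure Q A"
    if "A \<in> sigma_sets \<Omega> E" for A
    using E that
  proof (induct rule: sigma_sets_induct_disjoint)
    case (basic A)
    then show ?case using meas eq by auto
  next
    case (compl A)
    have diff: "emeasure (\<kappa> \<omega>) (\<Omega> - A) = emeasure (\<kappa> \<omega>) \<Omega> - emeasure (\<kappa> \<omega>) A" for \<omega>
    proof (rule emeasure_Diff)
      have "emeasure (\<kappa> \<omega>) A \<le> emeasure (\<kappa> \<omega>) \<Omega>"
        using compl(1) S.sets_into_space[OF compl(1)] by (intro emeasure_mono) (auto simp: sets)
      then show "emeasure (\<kappa> \<omega>) A \<noteq> \<infinity>" using fin(1)[of \<omega>] by (auto simp: top_unique)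
    qed (use compl(1) S.sets_into_space[OF compl(1)] sets in auto)
    have Ale: "emeasure Q A \<le> emeasure Q \<Omega>"
      using compl(1) S.sets_into_space[OF compl(1)] by (intro emeasure_mono) (auto simp: sets)
    then have Qfin: "emeasure Q A \<noteq> \<infinity>" using fin(2) by (auto simp: top_unique)
    have diffQ: "emeasure Q (\<Omega> - A) = emeasure Q \<Omega> - emeasure Q A"
      using compl(1) S.sets_into_space[OF compl(1)] sets Qfin by (intro emeasure_Diff) auto
    have m: "(\<lambda>\<omega>. emeasure (\<kappa> \<omega>) \<Omega>) \<in> borel_measurable M" "(\<lambda>\<omega>. emeasure (\<kappa> \<omega>) A) \<in> borel_measurable M"
      using meas compl by auto
    have "(\<integral>\<^sup>+\<omega>. emeasure (\<kappa> \<omega>) \<Omega> - emeasure (\<kappa> \<omega>) A \<partial>M)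
        = (\<integral>\<^sup>+\<omega>. emeasure (\<kappa> \<omega>) \<Omega> \<partial>M) - (\<integral>\<^sup>+\<omega>. emeasure (\<kappa> \<omega>) A \<partial>M)"
    proof (rule nn_integral_diff[OF m])
      show "(\<integral>\<^sup>+\<omega>. emeasure (\<kappa> \<omega>) A \<partial>M) \<noteq> \<infinity>" using compl Qfin by simp
      show "AE \<omega> in M. emeasure (\<kappa> \<omega>) A \<le> emeasure (\<kappa> \<omega>) \<Omega>"
        using compl(1) S.sets_into_space[OF compl(1)] by (intro AE_I2 emeasure_mono) (auto simp: sets)
    qed
    then show ?case using m compl eq[of \<Omega>] by (auto simp: diff diffQ)
  next
    case (union A)
    have "emeasure (\<kappa> \<omega>) (\<Union>i. A i) = (\<Sum>i. emeasure (\<kappa> \<omega>) (A i))" for \<omega>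
      using union by (intro suminf_emeasure[symmetric]) (auto simp: sets)
    moreover have "emeasure Q (\<Union>i. A i) = (\<Sum>i. emeasure Q (A i))"
      using union by (intro suminf_emeasure[symmetric]) (auto simp: sets)
    ultimately show ?case using union(3)
      by (simp add: nn_integral_suminf borel_measurable_suminf_order)
  qed simp
  have m\<kappa>: "f \<in> borel_measurable Q \<Longrightarrow> f \<in> borel_measurable (\<kappa> \<omega>)" for f :: "'x \<Rightarrow> ennreal" and \<omega>
  proof -
    have "borel_measurable (\<kappa> \<omega>) = (borel_measurable Q :: ('x \<Rightarrow> ennreal) set)"
      by (intro measurable_cong_sets) (simp_all add: sets)
    then show "f \<in> borel_measurable Q \<Longrightarrow> f \<in> borel_measurable (\<kappa> \<omega>)" by simp
  qed
  have sp: "space (\<kappa> \<omega>) = space Q" for \<omega> using sets by (intro sets_eq_imp_space_eq) simp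
  have "?A \<and> ?B" using g
  proof (induct rule: borel_measurable_induct)
    case (cong f g)
    have "(\<integral>\<^sup>+x. f x \<partial>\<kappa> \<omega>) = (\<integral>\<^sup>+x. g x \<partial>\<kappa> \<omega>)" for \<omega>
      using cong(3) by (intro nn_integral_cong) (simp add: sp)
    moreover have "(\<integral>\<^sup>+x. f x \<partial>Q) = (\<integral>\<^sup>+x. g x \<partial>Q)" using cong(3) by (intro nn_integral_cong) simp
    ultimately show ?case using cong(4) by simp
  next
    case (set A)
    then show ?case using setsP[of A] by (simp add: sets nn_integral_indicator)
  next
    case (mult u c)
    then show ?case by (simp add: nn_integral_cmult m\<kappa> borel_measurable_times_ennreal)
  next
    case (add u v)
    then have [measurable]: "(\<lambda>\<omega>. integral\<^sup>N (\<kappa> \<omega>) u) \<in> borel_measurable M"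
      "(\<lambda>\<omega>. integral\<^sup>N (\<kappa> \<omega>) v) \<in> borel_measurable M" by auto
    show ?case using add by (simp add: nn_integral_add m\<kappa>)
  next
    case (seq U)
    have s: "(\<integral>\<^sup>+x. (SUP i. U i) x \<partial>\<kappa> \<omega>) = (SUP i. \<integral>\<^sup>+x. U i x \<partial>\<kappa> \<omega>)" for \<omega>
      using seq by (simp add: nn_integral_monotone_convergence_SUP m\<kappa> image_comp)
    have sQ: "(\<integral>\<^sup>+x. (SUP i. U i) x \<partial>Q) = (SUP i. \<integral>\<^sup>+x. U i x \<partial>Q)"
      using seq by (simp add: nn_integral_monotone_convergence_SUP image_comp)
    have inc: "incseq (\<lambda>i \<omega>. \<integral>\<^sup>+x. U i x \<partial>\<kappa> \<omega>)"
      using seq by (auto simp: incseq_def le_fun_def intro!: nn_integral_mono)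
    have "(\<integral>\<^sup>+\<omega>. (SUP i. \<integral>\<^sup>+x. U i x \<partial>\<kappa> \<omega>) \<partial>M) = (SUP i. \<integral>\<^sup>+\<omega>. (\<integral>\<^sup>+x. U i x \<partial>\<kappa> \<omega>) \<partial>M)"
      using seq inc by (intro nn_integral_monotone_convergence_SUP) auto
    moreover have [measurable]: "\<And>i. (\<lambda>\<omega>. integral\<^sup>N (\<kappa> \<omega>) (U i)) \<in> borel_measurable M"
      using seq by auto
    ultimately show ?case using seq unfolding s sQ by simp
  qed
  then show ?A ?B by auto
qed

context poisson_random_measure
begin

abbreviation "pred_marks \<equiv> predictable M F \<Otimes>\<^sub>M \<nu>"

definition pred_rects :: "(real \<times> 'w) set set" where
  "pred_rects = {{0} \<times> A | A. A \<in> sets (F 0)} \<union>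
      {{s<..t} \<times> A | s t A. 0 \<le> s \<and> s \<le> t \<and> A \<in> sets (F s)}"

lemma F_subset: "A \<in> sets (F s) \<Longrightarrow> A \<subseteq> space M"
  using sets.sets_into_space[of A "F s"] space_F[of s] by auto

lemma space_F_sets: "space M \<in> sets (F s)"
  using sets.top[of "F s"] space_F[of s] by simp

lemma pred_rects_Pow: "pred_rects \<subseteq> Pow ({0..} \<times> space M)"
  by (auto simp: pred_rects_def dest: F_subset)

lemma predictable_eq: "predictable M F = sigma ({0..} \<times> space M) pred_rects"
  by (simp add: predictable_def pred_rects_def)

lemma space_predictable: "space (predictable M F) = {0..} \<times> space M"
  unfolding predictable_eq using pred_rects_Pow by (rule space_measure_of)

lemma sets_predictable: "sets (predictable M F) = sigma_sets ({0..} \<times> space M) pred_rects"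
  unfolding predictable_eq using pred_rects_Pow by (rule sets_measure_of)

lemma pred_rects_cases:
  assumes "P \<in> pred_rects"
  obtains (start) A where "P = {0} \<times> A" "A \<in> sets (F 0)"
    | (later) s t A where "P = {s<..t} \<times> A" "0 \<le> s" "s \<le> t" "A \<in> sets (F s)"
  using assms by (auto simp: pred_rects_def)

lemma pred_rects_start: "A \<in> sets (F 0) \<Longrightarrow> {0} \<times> A \<in> pred_rects"
  by (auto simp: pred_rects_def)

lemma pred_rects_later: "0 \<le> s \<Longrightarrow> s \<le> t \<Longrightarrow> A \<in> sets (F s) \<Longrightarrow> {s<..t} \<times> A \<in> pred_rects"
  unfolding pred_rects_def by blast

lemma Int_stable_pred_rects: "Int_stable pred_rects"
proof (rule Int_stableI)
  fix P R assume P: "P \<in> pred_rects" and R: "R \<in> pred_rects"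
  have empty: "{} \<in> pred_rects" using pred_rects_start[of "{}"] by simp
  show "P \<inter> R \<in> pred_rects" using P
  proof (cases rule: pred_rects_cases)
    case P: (start A)
    show ?thesis using R
    proof (cases rule: pred_rects_cases)
      case (start B)
      then show ?thesis using P pred_rects_start[of "A \<inter> B"] by (simp add: Times_Int_Times)
    next
      case (later s t B)
      then show ?thesis using P empty by (simp add: Times_Int_Times)
    qed
  next
    case P: (later s t A)
    show ?thesis using R
    proof (cases rule: pred_rects_cases)
      case (start B)
      then show ?thesis using P empty by (simp add: Times_Int_Times)
    next
      case R: (later s' t' B)
      define a where "a = max s s'"
      define b where "b = max a (min t t')"
      have "P \<inter> R = {a<..b} \<times> (A \<inter> B)" using P R by (auto simp: a_def b_def)
      moreover have "A \<inter> B \<in> sets (F a)"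
        using P R sets_F_mono[of s a] sets_F_mono[of s' a] by (auto simp: a_def)
      moreover have "0 \<le> a" "a \<le> b" using P R by (auto simp: a_def b_def)
      ultimately show ?thesis by (simp add: pred_rects_later)
    qed
  qed
qed

definition mark_rects :: "((real \<times> 'w) \<times> 'z) set set" where
  "mark_rects = {P \<times> B | P B. P \<in> pred_rects \<and> B \<in> sets \<nu>}"

text \<open>
  Products of generators suffice because countably many of them cover the space.
\<close>

lemma sets_pred_marks: "sets pred_marks = sigma_sets (({0..} \<times> space M) \<times> space \<nu>) mark_rects"
proof -
  have "sets pred_marks = sets (sigma ({0..} \<times> space M) pred_rects \<Otimes>\<^sub>M sigma (space \<nu>) (sets \<nu>))"
    unfolding predictable_eq by (intro sets_pair_measure_cong) (auto simp: sets.sets_measure_of_eq)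
  also have "sigma ({0..} \<times> space M) pred_rects \<Otimes>\<^sub>M sigma (space \<nu>) (sets \<nu>)
      = sigma (({0..} \<times> space M) \<times> space \<nu>) {a \<times> b | a b. a \<in> pred_rects \<and> b \<in> sets \<nu>}"
  proof (rule sigma_prod)
    let ?E = "insert ({0} \<times> space M) (range (\<lambda>n::nat. {0<..real n} \<times> space M))"
    have "?E \<subseteq> pred_rects" using space_F_sets by (auto intro!: pred_rects_start pred_rects_later)
    moreover have "{0..} \<times> space M = \<Union>?E"
      using real_arch_simple by (fastforce simp: less_le)
    ultimately show "\<exists>E\<subseteq>pred_rects. countable E \<and> {0..} \<times> space M = \<Union>E"
      by (intro exI[of _ ?E]) auto
    show "\<exists>E\<subseteq>sets \<nu>. countable E \<and> space \<nu> = \<Union>E" by (intro exI[of _ "{space \<nu>}"]) auto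
  qed (use pred_rects_Pow sets.space_closed[of \<nu>] in auto)
  also have "sets \<dots> = sigma_sets (({0..} \<times> space M) \<times> space \<nu>) mark_rects"
    unfolding mark_rects_def using pred_rects_Pow sets.space_closed[of \<nu>]
    by (intro sets_measure_of) blast
  finally show ?thesis .
qed

lemma Int_stable_mark_rects: "Int_stable mark_rects"
proof (rule Int_stableI)
  fix X Y assume "X \<in> mark_rects" "Y \<in> mark_rects"
  then obtain P B R C where "X = P \<times> B" "Y = R \<times> C" "P \<in> pred_rects" "R \<in> pred_rects"
    "B \<in> sets \<nu>" "C \<in> sets \<nu>" by (auto simp: mark_rects_def)
  moreover have "P \<times> B \<inter> R \<times> C = (P \<inter> R) \<times> (B \<inter> C)" by auto
  ultimately show "X \<inter> Y \<in> mark_rects"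
    using Int_stable_pred_rects[unfolded Int_stable_def] unfolding mark_rects_def by blast
qed

text \<open>
  Predictable sets are jointly measurable; time and mark only have to change places.
\<close>

lemma reorder_measurable: "(\<lambda>(\<omega>, z, s). ((s, \<omega>), z)) \<in> measurable MP pred_marks"
proof -
  have "(\<lambda>x. (snd (snd x), fst x)) \<in> measurable MP (predictable M F)"
    unfolding predictable_eq
  proof (rule measurable_measure_of)
    show "(\<lambda>x. (snd (snd x), fst x)) \<in> space MP \<rightarrow> {0..} \<times> space M"
      by (auto simp: space_pair_measure space_mark_time)
    fix P assume P: "P \<in> pred_rects"
    have "\<exists>I A. P = I \<times> A \<and> I \<in> sets borel \<and> I \<subseteq> {0..} \<and> A \<in> sets M"
      using P
    proof (cases rule: pred_rects_cases)
      case (start A)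
      then show ?thesis using sub_events[of 0] by (intro exI[of _ "{0}"] exI[of _ A]) auto
    next
      case (later s t A)
      then show ?thesis using sub_events[of s] by (intro exI[of _ "{s<..t}"] exI[of _ A]) auto
    qed
    then obtain I A where I: "P = I \<times> A" "I \<in> sets borel" "I \<subseteq> {0..}" "A \<in> sets M" by blast
    have "(\<lambda>x. (snd (snd x), fst x)) -` P \<inter> space MP = A \<times> (space \<nu> \<times> I)"
      using I sets.sets_into_space[OF I(4)] by (auto simp: space_pair_measure space_mark_time)
    then show "(\<lambda>x. (snd (snd x), fst x)) -` P \<inter> space MP \<in> sets MP"
      using I box_sets[of "space \<nu>" I] by auto
  qed (use pred_rects_Pow in auto)
  moreover have "(\<lambda>x. fst (snd x)) \<in> measurable MP \<nu>"
    unfolding mark_time_def by measurable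
  ultimately show ?thesis
    by (auto simp: case_prod_beta' intro!: measurable_Pair)
qed

lemma reorder_measurable_fixed:
  assumes "\<omega> \<in> space M"
  shows "(\<lambda>(z, s). ((s, \<omega>), z)) \<in> measurable \<Lambda> pred_marks"
  using measurable_compose[OF measurable_Pair1'[OF assms] reorder_measurable] by (simp add: case_prod_beta')

lemma sets_sub_F: "A \<in> sets (F s) \<Longrightarrow> A \<in> sets M" using sub_events by auto

text \<open>
  The compensation formula for a single rectangle.
\<close>

lemma expectation_past_indicator_mass:
  assumes "0 \<le> s" "A \<in> sets (F s)" "D \<in> fmeasurable \<Lambda>" "D \<subseteq> UNIV \<times> {s<..}"
  shows "(\<integral>\<^sup>+\<omega>. indicator A \<omega> * emeasure (N \<omega>) D \<partial>M) = emeasure M A * emeasure \<Lambda> D"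
proof -
  have AM: "A \<in> sets M" using assms sets_sub_F by auto
  have iA: "integrable M (indicator A :: _ \<Rightarrow> real)" using AM by (simp add: emeasure_eq_measure)
  have m: "(indicator A :: _ \<Rightarrow> real) \<in> borel_measurable (F s)" using assms by simp
  have cf: "centred_mass D \<in> borel_measurable (future s)" using assms by (intro centred_mass_future) auto
  note i = integrable_past_future[OF assms(1) m iA cf integrable_centred_mass[OF assms(3)]]
  note e = expectation_past_future[OF assms(1) m iA cf integrable_centred_mass[OF assms(3)]]
  have eq: "(\<lambda>\<omega>. indicator A \<omega> * mass D \<omega>) = (\<lambda>\<omega>. indicator A \<omega> * centred_mass D \<omega> + indicator A \<omega> * measure \<Lambda> D)"
    by (rule ext) (simp add: centred_mass_def algebra_simps)
  have intc: "integrable M (\<lambda>\<omega>. indicator A \<omega> * mass D \<omega>)" unfolding eq using i iA by simp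
  have "(\<integral>\<^sup>+\<omega>. indicator A \<omega> * emeasure (N \<omega>) D \<partial>M) = (\<integral>\<^sup>+\<omega>. ennreal (indicator A \<omega> * mass D \<omega>) \<partial>M)"
    using AE_emeasure_N_nat[OF assms(3)]
    by (intro nn_integral_cong_AE)
       (auto simp: mass_def measure_def indicator_def enn2real_of_nat ennreal_of_nat_eq_real_of_nat)
  also have "\<dots> = ennreal (expectation (\<lambda>\<omega>. indicator A \<omega> * mass D \<omega>))"
    using intc by (intro nn_integral_eq_integral) (auto simp: mass_def)
  also have "expectation (\<lambda>\<omega>. indicator A \<omega> * mass D \<omega>) = prob A * measure \<Lambda> D"
    unfolding eq using i iA e AM expectation_centred_mass[OF assms(3)] by simp
  also have "ennreal \<dots> = emeasure M A * emeasure \<Lambda> D"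
    unfolding emeasure_eq_measure2[OF assms(3)] emeasure_eq_measure by (rule ennreal_mult) auto
  finally show ?thesis .
qed

text \<open>
  The compensation formula. On rectangles it is the independence of past and future; the rest is
  uniqueness of measures. The box of finite intensity makes the random measure a finite kernel almost surely.
\<close>

theorem
  assumes G: "G \<in> fmeasurable \<nu>" and g: "g \<in> borel_measurable pred_marks"
  shows compensation_measurable:
      "(\<lambda>\<omega>. \<integral>\<^sup>+p. indicator (G \<times> {0<..T}) p * g ((snd p, \<omega>), fst p) \<partial>N \<omega>) \<in> borel_measurable M" (is ?A)
    and compensation:
      "(\<integral>\<^sup>+\<omega>. (\<integral>\<^sup>+p. indicator (G \<times> {0<..T}) p * g ((snd p, \<omega>), fst p) \<partial>N \<omega>) \<partial>M)
        = (\<integral>\<^sup>+(\<omega>, z, s). indicator (G \<times> {0<..T}) (z, s) * g ((s, \<omega>), z) \<partial>MP)" (is ?B)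
proof -
  define C where "C = G \<times> {0<..T}"
  have C: "C \<in> fmeasurable \<Lambda>" unfolding C_def using G by (intro box_fmeasurable[where T=T]) auto
  then have Cs: "C \<in> sets \<Lambda>" by (auto simp: fmeasurable_def)
  define ok where "ok \<omega> \<longleftrightarrow> \<omega> \<in> space M \<and> emeasure (N \<omega>) C < \<infinity>" for \<omega>
  have [measurable]: "(\<lambda>\<omega>. emeasure (N \<omega>) A) \<in> borel_measurable M" if "A \<in> sets \<Lambda>" for A
    using that by (rule measurable_N)
  have ok_sets: "{\<omega> \<in> space M. ok \<omega>} \<in> sets M" using Cs unfolding ok_def by measurable
  have AE_ok: "AE \<omega> in M. ok \<omega>"
    using AE_emeasure_N_nat[OF C] AE_space by eventually_elim (auto simp: ok_def of_nat_less_top)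
  let ?\<phi> = "\<lambda>\<omega> (z, s). ((s :: real, \<omega> :: 'w), z :: 'z)"
  define \<kappa> where "\<kappa> \<omega> = (if ok \<omega> then distr (density (N \<omega>) (indicator C)) pred_marks (?\<phi> \<omega>)
    else null_measure pred_marks)" for \<omega>
  define Q where "Q = distr (density MP (\<lambda>x. indicator C (snd x))) pred_marks (\<lambda>(\<omega>, z, s). ((s, \<omega>), z))"
  let ?\<Omega> = "({0..} \<times> space M) \<times> space \<nu>"
  have sp: "space pred_marks = ?\<Omega>" by (simp add: space_pair_measure space_predictable)
  have \<phi>N: "?\<phi> \<omega> \<in> measurable (N \<omega>) pred_marks" if "\<omega> \<in> space M" for \<omega>
    using reorder_measurable_fixed[OF that] measurable_cong_sets[OF sets_N[OF that] refl] by auto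
  have CM: "(\<lambda>x. indicator C (snd x) :: ennreal) \<in> borel_measurable MP" using Cs by measurable
  have sN: "\<omega> \<in> space M \<Longrightarrow> C \<in> sets (N \<omega>)" for \<omega> using Cs sets_N by auto
  have \<kappa>int: "(\<integral>\<^sup>+x. f x \<partial>\<kappa> \<omega>) = (\<integral>\<^sup>+p. indicator C p * f ((snd p, \<omega>), fst p) \<partial>N \<omega>)"
    if "ok \<omega>" "f \<in> borel_measurable pred_marks" for \<omega> f
  proof -
    have w: "\<omega> \<in> space M" using that by (simp add: ok_def)
    have m: "(\<lambda>x. f (?\<phi> \<omega> x)) \<in> borel_measurable (N \<omega>)"
      using measurable_compose[OF \<phi>N[OF w] that(2)] by simp
    have "(\<integral>\<^sup>+x. f x \<partial>\<kappa> \<omega>) = (\<integral>\<^sup>+x. f (?\<phi> \<omega> x) \<partial>density (N \<omega>) (indicator C))"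
      unfolding \<kappa>_def using that \<phi>N[OF w] by (simp add: nn_integral_distr)
    also have "\<dots> = (\<integral>\<^sup>+p. indicator C p * f (?\<phi> \<omega> p) \<partial>N \<omega>)"
      using m sN[OF w] by (intro nn_integral_density) auto
    finally show ?thesis by (simp add: case_prod_beta')
  qed
  have Qint: "(\<integral>\<^sup>+x. f x \<partial>Q) = (\<integral>\<^sup>+(\<omega>, z, s). indicator C (z, s) * f ((s, \<omega>), z) \<partial>MP)"
    if "f \<in> borel_measurable pred_marks" for f
  proof -
    have "(\<integral>\<^sup>+x. f x \<partial>Q) = (\<integral>\<^sup>+x. f ((\<lambda>(\<omega>, z, s). ((s, \<omega>), z)) x) \<partial>density MP (\<lambda>x. indicator C (snd x)))"
      unfolding Q_def using that reorder_measurable by (intro nn_integral_distr) auto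
    also have "\<dots> = (\<integral>\<^sup>+x. indicator C (snd x) * f ((\<lambda>(\<omega>, z, s). ((s, \<omega>), z)) x) \<partial>MP)"
      using CM measurable_compose[OF reorder_measurable that] by (intro nn_integral_density) auto
    finally show ?thesis by (simp add: case_prod_beta')
  qed
  have \<kappa>sets: "sets (\<kappa> \<omega>) = sets pred_marks" for \<omega> by (simp add: \<kappa>_def)
  have Qsets: "sets Q = sets pred_marks" by (simp add: Q_def)
  \<comment> \<open>On rectangles the two sides are an expectation of a product of past and future and its
    factorization; the total masses are needed for complements.\<close>
  have \<kappa>top: "emeasure (\<kappa> \<omega>) ?\<Omega> = (if ok \<omega> then emeasure (N \<omega>) C else 0)" for \<omega>
  proof (cases "ok \<omega>")
    case True
    then have w: "\<omega> \<in> space M" by (simp add: ok_def)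
    have "emeasure (\<kappa> \<omega>) ?\<Omega> = (\<integral>\<^sup>+x. 1 \<partial>\<kappa> \<omega>)"
      using sp sets_eq_imp_space_eq[OF \<kappa>sets[of \<omega>]] by simp
    also have "\<dots> = (\<integral>\<^sup>+p. indicator C p \<partial>N \<omega>)" using True by (subst \<kappa>int) auto
    finally show ?thesis using True sN[OF w] by simp
  qed (simp add: \<kappa>_def)
  have Qtop: "emeasure Q ?\<Omega> = emeasure \<Lambda> C"
  proof -
    have "emeasure Q ?\<Omega> = (\<integral>\<^sup>+x. 1 \<partial>Q)"
      using sp sets_eq_imp_space_eq[OF Qsets] by simp
    also have "\<dots> = (\<integral>\<^sup>+x. indicator (space M \<times> C) x \<partial>MP)"
      by (subst Qint) (auto intro!: nn_integral_cong simp: indicator_def space_pair_measure split: if_splits)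
    also have "\<dots> = emeasure \<Lambda> C"
      using Cs MP.M2.emeasure_pair_measure_Times[of "space M" M C]
      by (subst nn_integral_indicator) (auto simp: emeasure_space_1)
    finally show ?thesis .
  qed
  have rect: "(\<lambda>\<omega>. emeasure (\<kappa> \<omega>) X) \<in> borel_measurable M \<and> (\<integral>\<^sup>+\<omega>. emeasure (\<kappa> \<omega>) X \<partial>M) = emeasure Q X"
    if X: "X \<in> mark_rects" for X
  proof -
    obtain P B where XB: "X = P \<times> B" "P \<in> pred_rects" "B \<in> sets \<nu>" using X by (auto simp: mark_rects_def)
    have "\<exists>I A s. P = I \<times> A \<and> 0 \<le> s \<and> A \<in> sets (F s) \<and> I \<in> sets borel \<and> I \<inter> {0<..} \<subseteq> {s<..}"
      using XB(2)
    proof (cases rule: pred_rects_cases)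
      case (start A)
      then show ?thesis by (intro exI[of _ "{0}"] exI[of _ A] exI[of _ 0]) auto
    next
      case (later s t A)
      then show ?thesis by (intro exI[of _ "{s<..t}"] exI[of _ A] exI[of _ s]) auto
    qed
    then obtain I A s where I: "P = I \<times> A" "0 \<le> s" "A \<in> sets (F s)" "I \<in> sets borel" "I \<inter> {0<..} \<subseteq> {s<..}"
      by blast
    define D where "D = (G \<inter> B) \<times> (I \<inter> {0<..T})"
    have D: "D \<in> fmeasurable \<Lambda>" unfolding D_def using G XB I
      by (intro box_fmeasurable[where T=T] fmeasurable_Int_fmeasurable) auto
    then have Ds: "D \<in> sets \<Lambda>" by (auto simp: fmeasurable_def)
    have AM: "A \<in> sets M" using I sets_sub_F by auto
    have Xs: "X \<in> sets pred_marks" using X by (auto simp: sets_pred_marks)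
    have \<kappa>X: "emeasure (\<kappa> \<omega>) X = (if ok \<omega> then indicator A \<omega> * emeasure (N \<omega>) D else 0)" for \<omega>
    proof (cases "ok \<omega>")
      case True
      then have w: "\<omega> \<in> space M" by (simp add: ok_def)
      have "emeasure (\<kappa> \<omega>) X = (\<integral>\<^sup>+x. indicator X x \<partial>\<kappa> \<omega>)" using Xs \<kappa>sets by simp
      also have "\<dots> = (\<integral>\<^sup>+p. indicator A \<omega> * indicator D p \<partial>N \<omega>)"
        using True Xs by (subst \<kappa>int) (auto simp: C_def D_def XB I indicator_def intro!: nn_integral_cong)
      also have "\<dots> = indicator A \<omega> * emeasure (N \<omega>) D"
        using sets_N[OF w] Ds by (simp add: nn_integral_cmult_indicator)
      finally show ?thesis using True by simp
    qed (simp add: \<kappa>_def)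
    have "(\<integral>\<^sup>+\<omega>. emeasure (\<kappa> \<omega>) X \<partial>M) = (\<integral>\<^sup>+\<omega>. indicator A \<omega> * emeasure (N \<omega>) D \<partial>M)"
      using AE_ok by (intro nn_integral_cong_AE) (auto simp: \<kappa>X)
    also have "\<dots> = emeasure M A * emeasure \<Lambda> D"
      using I D by (intro expectation_past_indicator_mass) (auto simp: D_def)
    also have "\<dots> = emeasure MP (A \<times> D)"
      using AM Ds by (simp add: MP.M2.emeasure_pair_measure_Times)
    also have "\<dots> = (\<integral>\<^sup>+x. indicator (A \<times> D) x \<partial>MP)"
      using AM Ds by (intro nn_integral_indicator[symmetric]) auto
    also have "\<dots> = (\<integral>\<^sup>+x. indicator X x \<partial>Q)"
      using Xs by (subst Qint) (auto simp: C_def D_def XB I indicator_def intro!: nn_integral_cong)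
    also have "\<dots> = emeasure Q X" using Xs Qsets by simp
    finally have eq: "(\<integral>\<^sup>+\<omega>. emeasure (\<kappa> \<omega>) X \<partial>M) = emeasure Q X" .
    have "(\<lambda>\<omega>. if ok \<omega> then indicator A \<omega> * emeasure (N \<omega>) D else 0) \<in> borel_measurable M"
      using ok_sets AM measurable_N[OF Ds] by (intro measurable_If) auto
    then show ?thesis using eq unfolding \<kappa>X by auto
  qed
  have top_meas: "(\<lambda>\<omega>. emeasure (\<kappa> \<omega>) ?\<Omega>) \<in> borel_measurable M"
    unfolding \<kappa>top using ok_sets measurable_N[OF Cs] by (intro measurable_If) auto
  have top_eq: "(\<integral>\<^sup>+\<omega>. emeasure (\<kappa> \<omega>) ?\<Omega> \<partial>M) = emeasure Q ?\<Omega>"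
  proof -
    have "(\<integral>\<^sup>+\<omega>. emeasure (\<kappa> \<omega>) ?\<Omega> \<partial>M) = (\<integral>\<^sup>+\<omega>. indicator (space M) \<omega> * emeasure (N \<omega>) C \<partial>M)"
      using AE_ok AE_space by (intro nn_integral_cong_AE) (auto simp: \<kappa>top)
    also have "\<dots> = emeasure M (space M) * emeasure \<Lambda> C"
      using C space_F_sets[of 0] by (intro expectation_past_indicator_mass[where s=0]) (auto simp: C_def)
    finally show ?thesis by (simp add: Qtop emeasure_space_1)
  qed
  have E: "mark_rects \<subseteq> Pow ?\<Omega>"
    using sets.space_closed[of pred_marks] unfolding sets_pred_marks sp by auto
  have fin: "\<And>\<omega>. emeasure (\<kappa> \<omega>) ?\<Omega> < \<infinity>" "emeasure Q ?\<Omega> < \<infinity>"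
    using C by (auto simp: \<kappa>top Qtop ok_def fmeasurable_def)
  have gQ: "g \<in> borel_measurable Q" using g by (simp add: Q_def)
  have m: "\<And>A. A \<in> insert ?\<Omega> mark_rects \<Longrightarrow> (\<lambda>\<omega>. emeasure (\<kappa> \<omega>) A) \<in> borel_measurable M"
    and e: "\<And>A. A \<in> insert ?\<Omega> mark_rects \<Longrightarrow> (\<integral>\<^sup>+\<omega>. emeasure (\<kappa> \<omega>) A \<partial>M) = emeasure Q A"
    using rect top_meas top_eq by blast+
  note K = Int_stable_mark_rects E \<kappa>sets[unfolded sets_pred_marks] Qsets[unfolded sets_pred_marks] fin m e gQ
  have AE_eq: "AE \<omega> in M. (\<integral>\<^sup>+p. indicator C p * g ((snd p, \<omega>), fst p) \<partial>N \<omega>) = (\<integral>\<^sup>+x. g x \<partial>\<kappa> \<omega>)"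
    using AE_ok by eventually_elim (simp add: \<kappa>int g)
  show ?A unfolding C_def[symmetric]
    using kernel_measurable[OF K] AE_eq by (rule measurable_AE_cong) (simp_all add: space_borel)
  show ?B unfolding C_def[symmetric] Qint[OF g, symmetric]
    using kernel_integral[OF K] nn_integral_cong_AE[OF AE_eq] by simp
qed

end

section \<open>Jump times\<close>

lemma grid_cover:
  fixes T t :: real
  assumes t: "0 < t" "t \<le> T"
  obtains k where "k \<le> n" "T * real k / real (Suc n) < t" "t \<le> T * real (Suc k) / real (Suc n)"
proof -
  define y where "y = t * real (Suc n) / T"
  have T: "0 < T" using t by simp
  have "0 < t * real (Suc n)" "t * real (Suc n) \<le> T * real (Suc n)"
    using t by (auto intro!: mult_right_mono simp del: of_nat_Suc)
  then have y: "0 < y" "y \<le> real (Suc n)"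
    using T by (auto simp: y_def pos_divide_le_eq mult.commute simp del: of_nat_Suc)
  define k where "k = nat (\<lceil>y\<rceil> - 1)"
  have c: "1 \<le> \<lceil>y\<rceil>" "\<lceil>y\<rceil> \<le> int (Suc n)" using y by (auto simp: ceiling_le_iff)
  then have rk: "real k = of_int \<lceil>y\<rceil> - 1" by (simp add: k_def)
  have "k \<le> n" using c by (auto simp: k_def)
  moreover have "real k < y" "y \<le> real (Suc k)" using rk by (auto simp: ceiling_correct)
  then have "T * real k / real (Suc n) < t" "t \<le> T * real (Suc k) / real (Suc n)"
    using T by (auto simp: y_def field_simps)
  ultimately show ?thesis by (rule that)
qed

context poisson_random_measure
begin

text \<open>
  Quantities of mean of order \<open>1 / n\<^sup>2\<close> in each of \<open>n\<close> grid intervals: their sum has mean of order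
  \<open>1 / n\<close>, and Markov's inequality leaves no room for it to be at least one on all grids.
\<close>

lemma AE_small_on_grid:
  fixes X :: "nat \<Rightarrow> nat \<Rightarrow> 'w \<Rightarrow> real"
  assumes int: "\<And>n k. k \<le> n \<Longrightarrow> integrable M (X n k)"
    and nonneg: "AE \<omega> in M. \<forall>n. \<forall>k\<le>n. 0 \<le> X n k \<omega>"
    and mean: "\<And>n k. k \<le> n \<Longrightarrow> expectation (X n k) = C / real (Suc n) * (1 / real (Suc n))"
  shows "AE \<omega> in M. \<exists>n. \<forall>k\<le>n. X n k \<omega> < 1"
proof -
  define W where "W n \<omega> = (\<Sum>k\<le>n. X n k \<omega>)" for n \<omega>
  have intW: "integrable M (W n)" for n unfolding W_def[abs_def] using int by auto
  then have [measurable]: "W n \<in> borel_measurable M" for n by auto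
  have EW: "expectation (W n) = C * (1 / real (Suc n))" for n
  proof -
    have "expectation (W n) = (\<Sum>k\<le>n. expectation (X n k))"
      unfolding W_def[abs_def] using int by (intro Bochner_Integration.integral_sum) auto
    also have "\<dots> = (\<Sum>k\<le>n. C / real (Suc n) * (1 / real (Suc n)))"
      using mean by (intro sum.cong) auto
    also have "\<dots> = C * (1 / real (Suc n))" by (simp del: of_nat_Suc)
    finally show ?thesis .
  qed
  let ?A = "{\<omega> \<in> space M. \<forall>n. 1 \<le> W n \<omega>}"
  have A: "?A \<in> sets M" by measurable
  have "prob ?A \<le> C * (1 / real (Suc n))" for n
  proof -
    have "AE \<omega> in M. 0 \<le> W n \<omega>"
      using nonneg by eventually_elim (auto simp: W_def intro!: sum_nonneg)
    then have "expectation (indicator ?A) \<le> expectation (W n)"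
      using intW A
      by (intro integral_mono_AE) (auto simp: indicator_def emeasure_eq_measure elim!: eventually_mono)
    then show ?thesis using A by (simp add: EW)
  qed
  moreover have "(\<lambda>n. C * (1 / real (Suc n))) \<longlonglongrightarrow> C * 0"
    using LIMSEQ_inverse_real_of_nat by (intro tendsto_mult tendsto_const) (simp add: inverse_eq_divide)
  ultimately have "prob ?A \<le> C * 0" by (intro LIMSEQ_le_const) auto
  then have "prob ?A = 0" by (simp add: antisym)
  then have "AE \<omega> in M. \<omega> \<notin> ?A" using A by (intro AE_not_in) (auto simp: null_sets_def emeasure_eq_measure)
  then show ?thesis using nonneg AE_space
  proof eventually_elim
    case (elim \<omega>)
    then obtain n where n: "W n \<omega> < 1" by (auto simp: not_le)
    have "X n k \<omega> \<le> W n \<omega>" if "k \<le> n" for k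
      unfolding W_def using that elim(2) by (intro member_le_sum[where f="\<lambda>k. X n k \<omega>"]) auto
    then show ?case using n by (auto intro!: exI[of _ n] intro: le_less_trans)
  qed
qed

text \<open>
  One null set serves all subsets of \<open>C\<close> at the same time, because the masses are monotone.
\<close>

lemma AE_finite_integer_valued:
  assumes C: "C \<in> fmeasurable \<Lambda>"
  shows "AE \<omega> in M. \<forall>A\<in>sets \<Lambda>. A \<subseteq> C \<longrightarrow> (\<exists>k::nat. emeasure (N \<omega>) A = of_nat k)"
  using AE_emeasure_N_nat[OF C] AE_space
proof eventually_elim
  case (elim \<omega>)
  show ?case
  proof safe
    fix A assume A: "A \<in> sets \<Lambda>" "A \<subseteq> C"
    have "emeasure (N \<omega>) A \<le> emeasure (N \<omega>) C"
      using A C sets_N[OF elim(2)] by (intro emeasure_mono) (auto simp: fmeasurable_def)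
    then have "emeasure (N \<omega>) A < \<infinity>" using elim by (auto simp: of_nat_less_top intro: le_less_trans)
    moreover obtain k where k: "emeasure (N \<omega>) A = ennreal_of_enat k"
      using integer_valued[OF elim(2) A(1)] by auto
    ultimately obtain m where "k = enat m" by (cases k) auto
    then show "\<exists>k::nat. emeasure (N \<omega>) A = of_nat k" using k by auto
  qed
qed

definition slab :: "real \<Rightarrow> nat \<Rightarrow> nat \<Rightarrow> real set" where
  "slab T n k = {T * real k / real (Suc n) <.. T * real (Suc k) / real (Suc n)}"

lemma slab_subset: "0 \<le> T \<Longrightarrow> k \<le> n \<Longrightarrow> slab T n k \<subseteq> {0<..T}"
proof -
  assume T: "0 \<le> T" "k \<le> n"
  have "T * real (Suc k) \<le> T * real (Suc n)" using T by (intro mult_left_mono) auto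
  then have "T * real (Suc k) / real (Suc n) \<le> T" by (simp add: divide_le_eq)
  moreover have "0 \<le> T * real k / real (Suc n)" using T by auto
  ultimately show ?thesis unfolding slab_def by (auto simp del: of_nat_Suc)
qed

lemma slab_fmeasurable:
  "G \<in> fmeasurable \<nu> \<Longrightarrow> 0 \<le> T \<Longrightarrow> k \<le> n \<Longrightarrow> G \<times> slab T n k \<in> fmeasurable \<Lambda>"
  using slab_subset[of T k n] by (intro box_fmeasurable[where T=T]) (auto simp: slab_def)

lemma measure_slab:
  assumes "G \<in> fmeasurable \<nu>" "0 \<le> T" "k \<le> n"
  shows "measure \<Lambda> (G \<times> slab T n k) = measure \<nu> G * T / real (Suc n)"
proof -
  have "slab T n k \<subseteq> {0..}" using slab_subset[of T k n] assms by auto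
  then have "emeasure \<Lambda> (G \<times> slab T n k) = emeasure \<nu> G * emeasure lborel (slab T n k)"
    using assms by (intro emeasure_box) (auto simp: slab_def fmeasurable_def)
  also have "emeasure lborel (slab T n k) = ennreal (T / real (Suc n))"
    using assms unfolding slab_def
    by (subst emeasure_lborel_Ioc) (auto simp: field_simps diff_divide_distrib[symmetric])
  finally show ?thesis using assms by (simp add: measure_def enn2real_mult)
qed

lemma
  assumes A: "A \<in> fmeasurable \<Lambda>" and B: "B \<in> fmeasurable \<Lambda>"
  shows integrable_mass_mult: "integrable M (\<lambda>\<omega>. mass A \<omega> * mass B \<omega>)"
    and expectation_mass_mult:
      "expectation (\<lambda>\<omega>. mass A \<omega> * mass B \<omega>) = measure \<Lambda> A * measure \<Lambda> B + measure \<Lambda> (A \<inter> B)"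
proof -
  have eq: "(\<lambda>\<omega>. mass A \<omega> * mass B \<omega>) = (\<lambda>\<omega>. centred_mass A \<omega> * centred_mass B \<omega> + measure \<Lambda> A * mass B \<omega>
     + measure \<Lambda> B * mass A \<omega> - measure \<Lambda> A * measure \<Lambda> B)"
    by (rule ext) (simp add: centred_mass_def algebra_simps)
  show "integrable M (\<lambda>\<omega>. mass A \<omega> * mass B \<omega>)" unfolding eq
    using integrable_centred_mass_mult[OF A B] integrable_mass[OF A] integrable_mass[OF B] by auto
  show "expectation (\<lambda>\<omega>. mass A \<omega> * mass B \<omega>) = measure \<Lambda> A * measure \<Lambda> B + measure \<Lambda> (A \<inter> B)"
    unfolding eq using integrable_centred_mass_mult[OF A B] integrable_mass[OF A] integrable_mass[OF B]
    by (simp add: covariance_centred_mass[OF A B] expectation_mass[OF A] expectation_mass[OF B] prob_space)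
qed

lemma slice_sets: "B \<in> sets \<nu> \<Longrightarrow> 0 \<le> t \<Longrightarrow> B \<times> {t} \<in> sets \<Lambda>"
  by (intro box_sets) auto

lemma slab_jump:
  assumes \<omega>: "\<omega> \<in> space M" and B: "B \<in> fmeasurable \<nu>" and t: "t \<in> slab T n k" "k \<le> n" "0 \<le> T"
    and integer: "\<forall>A\<in>sets \<Lambda>. A \<subseteq> B \<times> {0<..T} \<longrightarrow> (\<exists>k::nat. emeasure (N \<omega>) A = of_nat k)"
  obtains m :: nat where "mass (B \<times> slab T n k) \<omega> = real m" "emeasure (N \<omega>) (B \<times> {t}) \<le> of_nat m"
proof -
  have s: "B \<times> slab T n k \<in> sets \<Lambda>" using slab_fmeasurable[OF B t(3,2)] by (simp add: fmeasurable_def)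
  moreover have "B \<times> slab T n k \<subseteq> B \<times> {0<..T}" using slab_subset[OF t(3,2)] by auto
  ultimately obtain m :: nat where m: "emeasure (N \<omega>) (B \<times> slab T n k) = of_nat m" using integer by blast
  have "emeasure (N \<omega>) (B \<times> {t}) \<le> emeasure (N \<omega>) (B \<times> slab T n k)"
    using t s sets_N[OF \<omega>] by (intro emeasure_mono) auto
  then show ?thesis using m by (intro that[of m]) (simp_all add: mass_def measure_def enn2real_of_nat)
qed

text \<open>
  A common jump time would put an atom of each set into the same interval of every grid, and the
  product of the two masses has mean of order \<open>1 / n\<^sup>2\<close>.
\<close>

lemma AE_no_common_jumps:
  assumes B: "B \<in> fmeasurable \<nu>" and G: "G \<in> fmeasurable \<nu>" and disj: "B \<inter> G = {}" and T: "0 < T"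
  shows "AE \<omega> in M. \<forall>t\<in>{0<..T}. emeasure (N \<omega>) (B \<times> {t}) = 0 \<or> emeasure (N \<omega>) (G \<times> {t}) = 0"
proof -
  have BG: "B \<times> {0<..T} \<in> fmeasurable \<Lambda>" "G \<times> {0<..T} \<in> fmeasurable \<Lambda>"
    using B G by (auto intro!: box_fmeasurable[where T=T])
  have fm: "B \<times> slab T n k \<in> fmeasurable \<Lambda>" "G \<times> slab T n k \<in> fmeasurable \<Lambda>" if "k \<le> n" for n k
    using that B G T by (auto intro: slab_fmeasurable)
  have disj': "(B \<times> slab T n k) \<inter> (G \<times> slab T n k) = {}" for n k using disj by auto
  have "AE \<omega> in M. \<exists>n. \<forall>k\<le>n. mass (B \<times> slab T n k) \<omega> * mass (G \<times> slab T n k) \<omega> < 1"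
  proof (rule AE_small_on_grid)
    show "integrable M (\<lambda>\<omega>. mass (B \<times> slab T n k) \<omega> * mass (G \<times> slab T n k) \<omega>)" if "k \<le> n" for n k
      using fm[OF that] by (intro integrable_mass_mult)
    show "expectation (\<lambda>\<omega>. mass (B \<times> slab T n k) \<omega> * mass (G \<times> slab T n k) \<omega>)
        = (measure \<nu> B * T * measure \<nu> G * T) / real (Suc n) * (1 / real (Suc n))" if "k \<le> n" for n k
      using that T B G by (simp add: expectation_mass_mult[OF fm[OF that]] measure_slab disj' del: of_nat_Suc)
  qed (simp add: mass_def)
  then show ?thesis using AE_finite_integer_valued[OF BG(1)] AE_finite_integer_valued[OF BG(2)] AE_space
  proof eventually_elim
    case (elim \<omega>)
    then obtain n where n: "\<And>k. k \<le> n \<Longrightarrow> mass (B \<times> slab T n k) \<omega> * mass (G \<times> slab T n k) \<omega> < 1" by auto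
    show ?case
    proof
      fix t assume t: "t \<in> {0<..T}"
      obtain k where k: "k \<le> n" "t \<in> slab T n k"
        using grid_cover[of t T n] t unfolding slab_def by (auto simp del: of_nat_Suc)
      obtain a b :: nat where ab: "mass (B \<times> slab T n k) \<omega> = real a" "emeasure (N \<omega>) (B \<times> {t}) \<le> of_nat a"
        "mass (G \<times> slab T n k) \<omega> = real b" "emeasure (N \<omega>) (G \<times> {t}) \<le> of_nat b"
        using slab_jump[OF elim(4) B k(2,1) _ elim(2)] slab_jump[OF elim(4) G k(2,1) _ elim(3)] T by (metis less_imp_le)
      have "real (a * b) < 1" using n[OF k(1)] by (simp add: ab)
      then have "a * b < 1" by (metis of_nat_1 of_nat_less_iff)
      then have "a = 0 \<or> b = 0" by simp
      then show "emeasure (N \<omega>) (B \<times> {t}) = 0 \<or> emeasure (N \<omega>) (G \<times> {t}) = 0" using ab by auto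
    qed
  qed
qed

text \<open>
  As before, with \<open>m * m - m\<close>, which is at least one as soon as two atoms share an interval. Its mean
  is the square of the intensity.
\<close>

lemma AE_single_jumps:
  assumes G: "G \<in> fmeasurable \<nu>" and T: "0 < T"
  shows "AE \<omega> in M. \<forall>t\<in>{0<..T}. emeasure (N \<omega>) (G \<times> {t}) = 0 \<or> emeasure (N \<omega>) (G \<times> {t}) = 1"
proof -
  have GT: "G \<times> {0<..T} \<in> fmeasurable \<Lambda>" using G by (intro box_fmeasurable[where T=T]) auto
  have fm: "G \<times> slab T n k \<in> fmeasurable \<Lambda>" if "k \<le> n" for n k
    using that G T by (auto intro: slab_fmeasurable)
  let ?X = "\<lambda>n k \<omega>. mass (G \<times> slab T n k) \<omega> * mass (G \<times> slab T n k) \<omega> - mass (G \<times> slab T n k) \<omega>"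
  have "AE \<omega> in M. \<exists>n. \<forall>k\<le>n. ?X n k \<omega> < 1"
  proof (rule AE_small_on_grid)
    show "integrable M (?X n k)" if "k \<le> n" for n k
      using fm[OF that] by (auto intro!: integrable_mass_mult integrable_mass)
    show "expectation (?X n k) = (measure \<nu> G * T * measure \<nu> G * T) / real (Suc n) * (1 / real (Suc n))"
      if "k \<le> n" for n k
      using integrable_mass_mult[OF fm[OF that] fm[OF that]] integrable_mass[OF fm[OF that]]
        expectation_mass_mult[OF fm[OF that] fm[OF that]] expectation_mass[OF fm[OF that]] G T that
      by (simp add: measure_slab del: of_nat_Suc)
    show "AE \<omega> in M. \<forall>n. \<forall>k\<le>n. 0 \<le> ?X n k \<omega>"
      using AE_finite_integer_valued[OF GT]
    proof eventually_elim
      case (elim \<omega>)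
      show ?case
      proof (intro allI impI)
        fix n k :: nat assume k: "k \<le> n"
        obtain m :: nat where "emeasure (N \<omega>) (G \<times> slab T n k) = of_nat m"
          using elim fm[OF k] slab_subset[of T k n] k T by (force simp: fmeasurable_def)
        then have "mass (G \<times> slab T n k) \<omega> = real m" by (simp add: mass_def measure_def enn2real_of_nat)
        then show "0 \<le> ?X n k \<omega>" by (cases m) (simp_all add: algebra_simps)
      qed
    qed
  qed
  then show ?thesis using AE_finite_integer_valued[OF GT] AE_space
  proof eventually_elim
    case (elim \<omega>)
    then obtain n where n: "\<And>k. k \<le> n \<Longrightarrow> ?X n k \<omega> < 1" by auto
    show ?case
    proof
      fix t assume t: "t \<in> {0<..T}"
      obtain k where k: "k \<le> n" "t \<in> slab T n k"
        using grid_cover[of t T n] t unfolding slab_def by (auto simp del: of_nat_Suc)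
      obtain m :: nat where m: "mass (G \<times> slab T n k) \<omega> = real m" "emeasure (N \<omega>) (G \<times> {t}) \<le> of_nat m"
        using slab_jump[OF elim(3) G k(2,1) _ elim(2)] T by (metis less_imp_le)
      have "m < 2"
      proof (rule ccontr)
        assume "\<not> m < 2"
        then have "1 * 1 \<le> real m * (real m - 1)" by (intro mult_mono) auto
        then show False using n[OF k(1)] by (simp add: m algebra_simps)
      qed
      moreover have "G \<times> {t} \<in> sets \<Lambda>" "G \<times> {t} \<subseteq> G \<times> {0<..T}"
        using G t slice_sets[of G t] by (auto simp: fmeasurable_def)
      then obtain j :: nat where j: "emeasure (N \<omega>) (G \<times> {t}) = of_nat j" using elim(2) by blast
      ultimately have "j = 0 \<or> j = 1" using m(2) by auto
      then show "emeasure (N \<omega>) (G \<times> {t}) = 0 \<or> emeasure (N \<omega>) (G \<times> {t}) = 1" using j by auto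
    qed
  qed
qed

text \<open>
  An integer-valued measure on the line has only atoms: a point without mass has, by continuity from
  above, a neighbourhood of mass below one, that is, zero, and countably many such neighbourhoods cover the
  rest. The marks are kept in one set \<open>G\<close>, as the mark space need not be separable.
\<close>

lemma jump_time_exists:
  assumes \<omega>: "\<omega> \<in> space M" and G: "G \<in> sets \<nu>"
    and integer: "\<forall>A\<in>sets \<Lambda>. A \<subseteq> G \<times> {0<..T} \<longrightarrow> (\<exists>k::nat. emeasure (N \<omega>) A = of_nat k)"
    and S: "S \<in> sets borel" "S \<subseteq> {0<..T}" and pos: "emeasure (N \<omega>) (G \<times> S) \<noteq> 0"
  shows "\<exists>t\<in>S. emeasure (N \<omega>) (G \<times> {t}) \<noteq> 0"
proof (rule ccontr)
  assume "\<not> ?thesis"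
  then have null: "emeasure (N \<omega>) (G \<times> {t}) = 0" if "t \<in> S" for t using that by auto
  let ?B = "\<lambda>U. G \<times> ({0<..T} \<inter> U)"
  have Bs: "?B U \<in> sets (N \<omega>)" if "open U" for U
    using that G sets_N[OF \<omega>] by (auto intro!: box_sets)
  have ex: "\<exists>r>0. emeasure (N \<omega>) (?B (ball t r)) = 0" if t: "t \<in> S" for t
  proof -
    let ?A = "\<lambda>n. ?B (ball t (1 / real (Suc n)))"
    have As: "range ?A \<subseteq> sets (N \<omega>)" using Bs by blast
    have sub: "\<exists>k::nat. emeasure (N \<omega>) (?A n) = of_nat k" for n
      using integer Bs[of "ball t (1 / real (Suc n))"] sets_N[OF \<omega>] by auto
    have "decseq ?A"
      by (intro decseq_SucI Sigma_mono Int_mono order_refl subset_ball) (auto simp: field_simps)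
    then have "(\<lambda>n. emeasure (N \<omega>) (?A n)) \<longlonglongrightarrow> emeasure (N \<omega>) (\<Inter>n. ?A n)"
    proof (rule Lim_emeasure_decseq[OF As])
      show "emeasure (N \<omega>) (?A n) \<noteq> \<infinity>" for n using sub[of n] by auto
    qed
    also have "(\<Inter>n. ?A n) = G \<times> {t}"
    proof -
      have "(\<Inter>n. ball t (1 / real (Suc n))) = {t}"
      proof (intro set_eqI iffI)
        fix t' assume t': "t' \<in> (\<Inter>n. ball t (1 / real (Suc n)))"
        show "t' \<in> {t}"
        proof (rule ccontr)
          assume "t' \<notin> {t}"
          then obtain n where "inverse (real (Suc n)) < dist t t'"
            using reals_Archimedean[of "dist t t'"] by auto
          moreover have "t' \<in> ball t (1 / real (Suc n))" using t' by blast
          ultimately show False by (simp add: inverse_eq_divide)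
        qed
      next
        fix t' assume "t' \<in> {t}"
        then have "t' = t" by simp
        moreover have "t \<in> ball t (1 / real (Suc n))" for n by simp
        ultimately show "t' \<in> (\<Inter>n. ball t (1 / real (Suc n)))" by blast
      qed
      then have "{0<..T} \<inter> (\<Inter>n. ball t (1 / real (Suc n))) = {t}" using t S by blast
      moreover have "(\<Inter>n. ?A n) = G \<times> ({0<..T} \<inter> (\<Inter>n. ball t (1 / real (Suc n))))" by blast
      ultimately show ?thesis by metis
    qed
    finally have "(\<lambda>n. emeasure (N \<omega>) (?A n)) \<longlonglongrightarrow> 0" using null[OF t] by simp
    then have "eventually (\<lambda>n. emeasure (N \<omega>) (?A n) < 1) sequentially"
      by (rule order_tendstoD) simp
    then obtain n where n: "emeasure (N \<omega>) (?A n) < 1" by (auto simp: eventually_sequentially)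
    obtain k :: nat where "emeasure (N \<omega>) (?A n) = of_nat k" using sub by auto
    then have "emeasure (N \<omega>) (?A n) = 0" using n by (cases k) auto
    then show ?thesis by (intro exI[of _ "1 / real (Suc n)"]) simp
  qed
  let ?F = "{ball t r | t r. t \<in> S \<and> r > 0 \<and> emeasure (N \<omega>) (?B (ball t r)) = 0}"
  obtain F' where F': "F' \<subseteq> ?F" "countable F'" "\<Union>F' = \<Union>?F"
  proof -
    have "open U" if "U \<in> ?F" for U using that by blast
    then show ?thesis using Lindelof[of ?F] that by blast
  qed
  have "S \<subseteq> \<Union>?F"
  proof
    fix t assume t: "t \<in> S"
    then obtain r where "r > 0" "emeasure (N \<omega>) (?B (ball t r)) = 0" using ex by blast
    then have "ball t r \<in> ?F" "t \<in> ball t r" using t by auto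
    then show "t \<in> \<Union>?F" by blast
  qed
  then have "G \<times> S \<subseteq> (\<Union>U\<in>F'. ?B U)" using S(2) unfolding F'(3)[symmetric] by blast
  moreover have "(\<Union>U\<in>F'. ?B U) \<in> null_sets (N \<omega>)"
  proof (rule null_sets_UN'[OF F'(2)])
    fix U assume "U \<in> F'"
    then show "?B U \<in> null_sets (N \<omega>)" using F'(1) Bs by (auto simp: null_sets_def)
  qed
  moreover have "G \<times> S \<in> sets (N \<omega>)" using S G sets_N[OF \<omega>] by (auto intro!: box_sets)
  ultimately have "G \<times> S \<in> null_sets (N \<omega>)" by (meson null_sets_subset)
  then show False using pos by auto
qed

end

section \<open>Increments of square integrable integrals\<close>

lemma ennreal_norm_add_sq:
  fixes x y :: "'a::real_normed_vector"
  shows "ennreal ((norm (x + y))\<^sup>2) \<le> 2 * ennreal ((norm x)\<^sup>2) + 2 * ennreal ((norm y)\<^sup>2)"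
proof -
  have "(norm (x + y))\<^sup>2 \<le> (norm x + norm y)\<^sup>2" by (intro power_mono norm_triangle_ineq) auto
  also have "\<dots> \<le> 2 * (norm x)\<^sup>2 + 2 * (norm y)\<^sup>2"
    using sum_squares_bound[of "norm x" "norm y"] by (simp add: power2_sum)
  finally have "ennreal ((norm (x + y))\<^sup>2) \<le> ennreal (2 * (norm x)\<^sup>2 + 2 * (norm y)\<^sup>2)"
    by (rule ennreal_leI)
  also have "\<dots> = 2 * ennreal ((norm x)\<^sup>2) + 2 * ennreal ((norm y)\<^sup>2)"
    by (simp add: ennreal_mult)
  finally show ?thesis .
qed

lemma nn_integral_norm_add_sq:
  fixes X Y :: "'a \<Rightarrow> 'b::{real_normed_vector, second_countable_topology}"
  assumes [measurable]: "X \<in> borel_measurable M" "Y \<in> borel_measurable M"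
  shows "(\<integral>\<^sup>+x. ennreal ((norm (X x + Y x))\<^sup>2) \<partial>M)
    \<le> 2 * (\<integral>\<^sup>+x. ennreal ((norm (X x))\<^sup>2) \<partial>M) + 2 * (\<integral>\<^sup>+x. ennreal ((norm (Y x))\<^sup>2) \<partial>M)"
proof -
  have "(\<integral>\<^sup>+x. ennreal ((norm (X x + Y x))\<^sup>2) \<partial>M)
      \<le> (\<integral>\<^sup>+x. 2 * ennreal ((norm (X x))\<^sup>2) + 2 * ennreal ((norm (Y x))\<^sup>2) \<partial>M)"
    by (intro nn_integral_mono ennreal_norm_add_sq)
  also have "\<dots> = 2 * (\<integral>\<^sup>+x. ennreal ((norm (X x))\<^sup>2) \<partial>M) + 2 * (\<integral>\<^sup>+x. ennreal ((norm (Y x))\<^sup>2) \<partial>M)"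
    by (simp add: nn_integral_add nn_integral_cmult)
  finally show ?thesis .
qed

lemma tendsto_0_ennreal_bound:
  fixes f g h :: "nat \<Rightarrow> ennreal"
  assumes "\<And>n. f n \<le> a * g n + b * h n" "g \<longlonglongrightarrow> 0" "h \<longlonglongrightarrow> 0" "a < \<infinity>" "b < \<infinity>"
  shows "f \<longlonglongrightarrow> 0"
proof (rule tendsto_sandwich[of "\<lambda>_. 0" f _ "\<lambda>n. a * g n + b * h n"])
  have "(\<lambda>n. a * g n + b * h n) \<longlonglongrightarrow> a * 0 + b * 0"
    using assms by (intro tendsto_add ennreal_tendsto_cmult) auto
  then show "(\<lambda>n. a * g n + b * h n) \<longlonglongrightarrow> 0" by simp
qed (use assms in auto)

context poisson_random_measure
begin

text \<open>
  The right-hand side of the isometry for a difference of integrands.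
\<close>

definition sq_dist :: "real \<Rightarrow> real \<Rightarrow> (real \<Rightarrow> 'w \<Rightarrow> 'z \<Rightarrow> 'h::real_normed_vector)
    \<Rightarrow> (real \<Rightarrow> 'w \<Rightarrow> 'z \<Rightarrow> 'h) \<Rightarrow> ennreal" where
  "sq_dist u v f g = (\<integral>\<^sup>+(\<omega>, z, s). indicator {u<..v} s * ennreal ((norm (f s \<omega> z - g s \<omega> z))\<^sup>2) \<partial>MP)"

lemma time_measurable_MP: "(\<lambda>x. snd (snd x)) \<in> borel_measurable MP"
proof -
  have "(\<lambda>x. x) \<in> measurable (restrict_space lborel {0::real..}) borel"
    by (simp add: measurable_restrict_space1)
  then show ?thesis unfolding mark_time_def
    by (rule measurable_compose[rotated]) measurable
qed

lemma predictable_integrand_MP: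
  "predictable_integrand M F \<nu> f \<Longrightarrow> (\<lambda>(\<omega>, z, s). f s \<omega> z) \<in> borel_measurable MP"
  unfolding predictable_integrand_def
  using measurable_compose[OF reorder_measurable, of "\<lambda>((s, \<omega>), z). f s \<omega> z" borel]
  by (simp add: case_prod_beta')

lemma predictable_integrand_diff:
  fixes f g :: "real \<Rightarrow> 'w \<Rightarrow> 'z \<Rightarrow> 'h::{real_normed_vector, second_countable_topology}"
  shows "predictable_integrand M F \<nu> f \<Longrightarrow> predictable_integrand M F \<nu> g \<Longrightarrow>
    predictable_integrand M F \<nu> (\<lambda>s \<omega> z. f s \<omega> z - g s \<omega> z)"
  unfolding predictable_integrand_def by (simp add: case_prod_beta')

lemma predictable_integrand_entry:
  fixes \<xi> :: "'w \<Rightarrow> 'h::{real_normed_vector, second_countable_topology}"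
  assumes ab: "0 \<le> a" "a \<le> b" and B: "B \<in> sets \<nu>" and \<xi>: "\<xi> \<in> borel_measurable (F a)"
  shows "predictable_integrand M F \<nu> (\<lambda>s \<omega> z. (indicator {a<..b} s * indicator B z) *\<^sub>R \<xi> \<omega>)"
proof -
  have 1: "(\<lambda>p. indicator {a<..b} (fst p) *\<^sub>R \<xi> (snd p)) \<in> borel_measurable (predictable M F)"
  proof (rule measurableI)
    fix S :: "'h set" assume S: "S \<in> sets borel"
    let ?f = "\<lambda>p. indicator {a<..b} (fst p) *\<^sub>R \<xi> (snd p)"
    have rect: "{a<..b} \<times> A \<in> sets (predictable M F)" if "A \<in> sets (F a)" for A
      using pred_rects_later[OF ab that] by (auto simp: sets_predictable)
    have A: "\<xi> -` S \<inter> space M \<in> sets (F a)"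
      using measurable_sets[OF \<xi> S] space_F by simp
    have eq: "?f -` S \<inter> space (predictable M F) =
        {a<..b} \<times> (\<xi> -` S \<inter> space M) \<union> (if 0 \<in> S then space (predictable M F) - {a<..b} \<times> space M else {})"
      using ab by (auto simp: space_predictable indicator_def of_bool_def split: if_splits)
    show "?f -` S \<inter> space (predictable M F) \<in> sets (predictable M F)"
      unfolding eq using rect[OF A] rect[OF space_F_sets] by auto
  qed auto
  have "(\<lambda>x. indicator B (snd x) *\<^sub>R (indicator {a<..b} (fst (fst x)) *\<^sub>R \<xi> (snd (fst x)))) \<in> borel_measurable pred_marks"
    using B by (intro borel_measurable_scaleR[OF _ measurable_compose[OF measurable_fst 1]]) simp
  then show ?thesis unfolding predictable_integrand_def by (simp add: case_prod_beta' mult.commute)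
qed

lemma predictable_integrand_elementary:
  fixes e :: "('w, 'z, 'h::{real_normed_vector, second_countable_topology}) elementary"
  assumes "elementary_predictable M F \<nu> e"
  shows "predictable_integrand M F \<nu> (elementary_integrand e)"
  using assms
proof (induction e)
  case Nil
  then show ?case by (simp add: predictable_integrand_def elementary_integrand_def case_prod_beta')
next
  case (Cons p e)
  then have p: "elementary_predictable M F \<nu> [p]" and e: "elementary_predictable M F \<nu> e"
    by (auto simp: elementary_predictable_Cons[of p e])
  obtain a b B \<xi> where pe: "p = (a, b, B, \<xi>)" by (cases p)
  have "predictable_integrand M F \<nu> (\<lambda>s \<omega> z. (indicator {a<..b} s * indicator B z) *\<^sub>R \<xi> \<omega>)"
    using p by (intro predictable_integrand_entry) (auto simp: pe elementary_predictable_def)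
  then show ?case using Cons.IH[OF e] unfolding predictable_integrand_def
    by (simp add: elementary_integrand_def pe case_prod_beta')
qed

lemma elementary_integral_measurable:
  fixes e :: "('w, 'z, 'h::{real_normed_vector, second_countable_topology}) elementary"
  assumes "elementary_predictable M F \<nu> e" "0 \<le> t"
  shows "elementary_integral \<nu> N e t \<in> borel_measurable M"
  using assms(1)
proof (induction e)
  case Nil
  then show ?case by (simp add: elementary_integral_def[abs_def])
next
  case (Cons p e)
  then have p: "elementary_predictable M F \<nu> [p]" and e: "elementary_predictable M F \<nu> e"
    by (auto simp: elementary_predictable_Cons[of p e])
  obtain a b B \<xi> where pe: "p = (a, b, B, \<xi>)" by (cases p)
  have m: "\<xi> \<in> borel_measurable M" "centred_mass (B \<times> ({a<..b} \<inter> {..t})) \<in> borel_measurable M"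
    using p by (auto simp: pe elementary_predictable_def intro!: measurable_F_M centred_mass_measurable box_sets)
  have "elementary_integral \<nu> N (p # e) t = (\<lambda>\<omega>. centred_mass (B \<times> ({a<..b} \<inter> {..t})) \<omega> *\<^sub>R \<xi> \<omega> + elementary_integral \<nu> N e t \<omega>)"
    using elementary_integral_eq[OF Cons.prems assms(2)] elementary_integral_eq[OF e assms(2)] by (auto simp: pe)
  then show ?case using Cons.IH[OF e] m by simp
qed

text \<open>
  The iterated integral of the definition, as one integral over the product space.
\<close>

lemma square_norm_eq:
  fixes f :: "real \<Rightarrow> 'w \<Rightarrow> 'z \<Rightarrow> 'h::{real_normed_vector, second_countable_topology}"
  assumes f: "predictable_integrand M F \<nu> f"
  shows "square_norm M \<nu> t f = (\<integral>\<^sup>+(\<omega>, z, s). indicator {..t} s * ennreal ((norm (f s \<omega> z))\<^sup>2) \<partial>MP)"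
proof -
  interpret T: sigma_finite_measure "restrict_space lborel {0::real..}" by (rule sigma_finite_time)
  interpret P: pair_sigma_finite \<nu> "restrict_space lborel {0::real..}" ..
  let ?h = "\<lambda>(\<omega>, z, s). indicator {..t} s * ennreal ((norm (f s \<omega> z))\<^sup>2)"
  have [measurable]: "(\<lambda>x. f (snd (snd x)) (fst x) (fst (snd x))) \<in> borel_measurable MP"
    using predictable_integrand_MP[OF f] by (simp add: case_prod_beta')
  have [measurable]: "(\<lambda>x. indicator {..t} (snd (snd x)) :: ennreal) \<in> borel_measurable MP"
    using measurable_compose[OF time_measurable_MP borel_measurable_indicator[of "{..t}" borel]] by simp
  have h: "?h \<in> borel_measurable MP" by (simp add: case_prod_beta')
  have "(\<integral>\<^sup>+x. ?h x \<partial>MP) = (\<integral>\<^sup>+\<omega>. (\<integral>\<^sup>+y. ?h (\<omega>, y) \<partial>\<Lambda>) \<partial>M)"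
    using MP.M2.nn_integral_fst[OF h] by simp
  also have "\<dots> = square_norm M \<nu> t f" unfolding square_norm_def
  proof (rule nn_integral_cong)
    fix \<omega> assume w: "\<omega> \<in> space M"
    have m: "(\<lambda>y. ?h (\<omega>, y)) \<in> borel_measurable (\<nu> \<Otimes>\<^sub>M restrict_space lborel {0..})"
      using measurable_compose[OF measurable_Pair1'[OF w] h] unfolding mark_time_def by simp
    have "(\<integral>\<^sup>+y. ?h (\<omega>, y) \<partial>\<Lambda>) = (\<integral>\<^sup>+s. (\<integral>\<^sup>+z. ?h (\<omega>, z, s) \<partial>\<nu>) \<partial>restrict_space lborel {0..})"
      unfolding mark_time_def using P.nn_integral_snd[OF m] by simp
    also have "\<dots> = (\<integral>\<^sup>+s. (\<integral>\<^sup>+z. ?h (\<omega>, z, s) \<partial>\<nu>) * indicator {0..} s \<partial>lborel)"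
      by (rule nn_integral_restrict_space) auto
    also have "\<dots> = (\<integral>\<^sup>+s\<in>{0..t}. (\<integral>\<^sup>+z. ennreal ((norm (f s \<omega> z))\<^sup>2) \<partial>\<nu>) \<partial>lborel)"
      by (intro nn_integral_cong) (auto simp: indicator_def)
    finally show "(\<integral>\<^sup>+y. ?h (\<omega>, y) \<partial>\<Lambda>) = (\<integral>\<^sup>+s\<in>{0..t}. (\<integral>\<^sup>+z. ennreal ((norm (f s \<omega> z))\<^sup>2) \<partial>\<nu>) \<partial>lborel)" .
  qed
  finally show ?thesis by simp
qed

lemma sq_dist_le_square_norm:
  fixes f g :: "real \<Rightarrow> 'w \<Rightarrow> 'z \<Rightarrow> 'h::{real_normed_vector, second_countable_topology}"
  assumes "predictable_integrand M F \<nu> f" "predictable_integrand M F \<nu> g" "v \<le> t"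
  shows "sq_dist u v f g \<le> square_norm M \<nu> t (\<lambda>s \<omega> z. f s \<omega> z - g s \<omega> z)"
  unfolding sq_dist_def square_norm_eq[OF predictable_integrand_diff[OF assms(1,2)]]
  using assms(3) by (intro nn_integral_mono) (auto simp: indicator_def split: prod.split)

lemma sq_dist_commute: "sq_dist u v f g = sq_dist u v g f"
  by (simp add: sq_dist_def norm_minus_commute)

lemma sq_dist_measurable:
  fixes f g :: "real \<Rightarrow> 'w \<Rightarrow> 'z \<Rightarrow> 'h::{real_normed_vector, second_countable_topology}"
  assumes "predictable_integrand M F \<nu> f" "predictable_integrand M F \<nu> g"
  shows "(\<lambda>(\<omega>, z, s). indicator {u<..v} s * ennreal ((norm (f s \<omega> z - g s \<omega> z))\<^sup>2)) \<in> borel_measurable MP"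
proof -
  have [measurable]: "(\<lambda>x. f (snd (snd x)) (fst x) (fst (snd x)) - g (snd (snd x)) (fst x) (fst (snd x))) \<in> borel_measurable MP"
    using predictable_integrand_MP[OF predictable_integrand_diff[OF assms]] by (simp add: case_prod_beta')
  have [measurable]: "(\<lambda>x. indicator {u<..v} (snd (snd x)) :: ennreal) \<in> borel_measurable MP"
    using measurable_compose[OF time_measurable_MP borel_measurable_indicator[of "{u<..v}" borel]] by simp
  show ?thesis by (simp add: case_prod_beta')
qed

lemma sq_dist_triangle:
  fixes f g h :: "real \<Rightarrow> 'w \<Rightarrow> 'z \<Rightarrow> 'h::{real_normed_vector, second_countable_topology}"
  assumes "predictable_integrand M F \<nu> f" "predictable_integrand M F \<nu> g" "predictable_integrand M F \<nu> h"
  shows "sq_dist u v f h \<le> 2 * sq_dist u v f g + 2 * sq_dist u v g h"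
proof -
  note m = sq_dist_measurable[OF assms(1,2), of u v] sq_dist_measurable[OF assms(2,3), of u v]
  have "sq_dist u v f h \<le> (\<integral>\<^sup>+x. 2 * (\<lambda>(\<omega>, z, s). indicator {u<..v} s * ennreal ((norm (f s \<omega> z - g s \<omega> z))\<^sup>2)) x
     + 2 * (\<lambda>(\<omega>, z, s). indicator {u<..v} s * ennreal ((norm (g s \<omega> z - h s \<omega> z))\<^sup>2)) x \<partial>MP)"
    unfolding sq_dist_def
  proof (rule nn_integral_mono)
    fix x :: "'w \<times> 'z \<times> real"
    obtain \<omega> z s where x: "x = (\<omega>, z, s)" by (cases x)
    have "ennreal ((norm (f s \<omega> z - h s \<omega> z))\<^sup>2)
        \<le> 2 * ennreal ((norm (f s \<omega> z - g s \<omega> z))\<^sup>2) + 2 * ennreal ((norm (g s \<omega> z - h s \<omega> z))\<^sup>2)"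
      using ennreal_norm_add_sq[of "f s \<omega> z - g s \<omega> z" "g s \<omega> z - h s \<omega> z"] by simp
    then show "(case x of (\<omega>, z, s) \<Rightarrow> indicator {u<..v} s * ennreal ((norm (f s \<omega> z - h s \<omega> z))\<^sup>2))
      \<le> 2 * (case x of (\<omega>, z, s) \<Rightarrow> indicator {u<..v} s * ennreal ((norm (f s \<omega> z - g s \<omega> z))\<^sup>2))
      + 2 * (case x of (\<omega>, z, s) \<Rightarrow> indicator {u<..v} s * ennreal ((norm (g s \<omega> z - h s \<omega> z))\<^sup>2))"
      by (auto simp: x indicator_def)
  qed
  also have "\<dots> = 2 * sq_dist u v f g + 2 * sq_dist u v g h"
    unfolding sq_dist_def using m
    by (subst nn_integral_add) (auto simp: nn_integral_cmult intro!: borel_measurable_times_ennreal)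
  finally show ?thesis .
qed

definition neg_entries :: "('w, 'z, 'h::real_normed_vector) elementary \<Rightarrow> ('w, 'z, 'h) elementary" where
  "neg_entries e = map (\<lambda>(a, b, B, \<xi>). (a, b, B, \<lambda>\<omega>. - \<xi> \<omega>)) e"

lemma elementary_predictable_neg:
  fixes e :: "('w, 'z, 'h::{real_normed_vector, second_countable_topology}) elementary"
  shows "elementary_predictable M F \<nu> e \<Longrightarrow> elementary_predictable M F \<nu> (neg_entries e)"
  unfolding elementary_predictable_def
proof (intro ballI)
  fix q
  assume e: "\<forall>(a, b, B, \<xi>)\<in>set e. 0 \<le> a \<and> a \<le> b \<and> B \<in> sets \<nu> \<and> emeasure \<nu> B < \<infinity> \<and>
      \<xi> \<in> borel_measurable (F a) \<and> bounded (\<xi> ` space M)"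
    and "q \<in> set (neg_entries e)"
  then obtain a b B \<xi> where q: "q = (a, b, B, \<lambda>\<omega>. - \<xi> \<omega>)" "(a, b, B, \<xi>) \<in> set e"
    by (auto simp: neg_entries_def)
  have x: "0 \<le> a \<and> a \<le> b \<and> B \<in> sets \<nu> \<and> emeasure \<nu> B < \<infinity> \<and>
      \<xi> \<in> borel_measurable (F a) \<and> bounded (\<xi> ` space M)" using e q(2) by blast
  then have "bounded ((\<lambda>\<omega>. - \<xi> \<omega>) ` space M)" by (simp add: bounded_iff)
  then show "case q of (a, b, B, \<xi>) \<Rightarrow> 0 \<le> a \<and> a \<le> b \<and> B \<in> sets \<nu> \<and> emeasure \<nu> B < \<infinity> \<and>
      \<xi> \<in> borel_measurable (F a) \<and> bounded (\<xi> ` space M)" using x q(1) by simp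
qed

lemma elementary_predictable_append:
  "elementary_predictable M F \<nu> (e @ e') \<longleftrightarrow> elementary_predictable M F \<nu> e \<and> elementary_predictable M F \<nu> e'"
  unfolding elementary_predictable_def by (simp only: set_append ball_Un)

lemma elementary_integrand_append_neg:
  "elementary_integrand (e @ neg_entries e') s \<omega> z = elementary_integrand e s \<omega> z - elementary_integrand e' s \<omega> z"
proof -
  have "elementary_integrand (neg_entries e') s \<omega> z = - elementary_integrand e' s \<omega> z"
    by (induction e') (auto simp: elementary_integrand_def neg_entries_def)
  then show ?thesis by (simp add: elementary_integrand_def)
qed

lemma elementary_integral_append_neg:
  "elementary_integral \<nu> N (e @ neg_entries e') t \<omega> = elementary_integral \<nu> N e t \<omega> - elementary_integral \<nu> N e' t \<omega>"
proof -
  have "elementary_integral \<nu> N (neg_entries e') t \<omega> = - elementary_integral \<nu> N e' t \<omega>"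
    by (induction e') (auto simp: elementary_integral_def neg_entries_def)
  then show ?thesis by (simp add: elementary_integral_def)
qed

lemma isometry_sq_dist:
  fixes e e' :: "('w, 'z, 'h::{real_inner, second_countable_topology}) elementary"
  assumes e: "elementary_predictable M F \<nu> e" "elementary_predictable M F \<nu> e'" and uv: "0 \<le> u" "u \<le> v"
  shows "(\<integral>\<^sup>+\<omega>. ennreal ((norm ((elementary_integral \<nu> N e v \<omega> - elementary_integral \<nu> N e' v \<omega>)
      - (elementary_integral \<nu> N e u \<omega> - elementary_integral \<nu> N e' u \<omega>)))\<^sup>2) \<partial>M)
    = sq_dist u v (elementary_integrand e) (elementary_integrand e')"
proof -
  have "elementary_predictable M F \<nu> (e @ neg_entries e')"
    using e by (simp add: elementary_predictable_append elementary_predictable_neg)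
  from isometry[OF this uv] show ?thesis
    by (simp add: elementary_integral_append_neg elementary_integrand_append_neg sq_dist_def)
qed

lemma elementary_integral_0: "elementary_predictable M F \<nu> e \<Longrightarrow> elementary_integral \<nu> N e 0 \<omega> = 0"
proof (induction e)
  case (Cons p e)
  then have p: "elementary_predictable M F \<nu> [p]" and e: "elementary_predictable M F \<nu> e"
    by (auto simp: elementary_predictable_Cons[of p e])
  obtain a b B \<xi> where pe: "p = (a, b, B, \<xi>)" by (cases p)
  have "min a 0 = 0" "min b 0 = 0" using p by (auto simp: pe elementary_predictable_def)
  then show ?case using Cons.IH[OF e] by (simp add: elementary_integral_def pe)
qed (simp add: elementary_integral_def)

text \<open>
  The isometry passes to the limit, up to a constant from the inequality between the square of a sum
  and the sum of squares.
\<close>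

lemma L2_integral_increment:
  fixes f :: "real \<Rightarrow> 'w \<Rightarrow> 'z \<Rightarrow> 'h::{real_inner, second_countable_topology}"
  assumes I: "compensated_integral_L2 M F \<nu> N f I" and e: "elementary_predictable M F \<nu> e"
    and uv: "0 \<le> u" "u \<le> v"
  shows "(\<integral>\<^sup>+\<omega>. ennreal ((norm ((I v \<omega> - elementary_integral \<nu> N e v \<omega>) - (I u \<omega> - elementary_integral \<nu> N e u \<omega>)))\<^sup>2) \<partial>M)
    \<le> 4 * sq_dist u v f (elementary_integrand e)"
proof -
  let ?E = "elementary_integral \<nu> N" and ?J = "elementary_integrand"
  have f: "predictable_integrand M F \<nu> f" using I by (simp add: compensated_integral_L2_def)
  have Im: "I t \<in> borel_measurable M" if "0 \<le> t" for t
    using I that by (intro measurable_F_M[of _ t]) (simp add: compensated_integral_L2_def cadlag_adapted_def)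
  have approx: "\<exists>e :: nat \<Rightarrow> ('w, 'z, 'h) elementary. (\<forall>k. elementary_predictable M F \<nu> (e k)) \<and>
      (\<lambda>k. sq_dist 0 t f (?J (e k))) \<longlonglongrightarrow> 0 \<and> (\<lambda>k. sq_dist u t f (?J (e k))) \<longlonglongrightarrow> 0 \<and>
      (\<lambda>k. \<integral>\<^sup>+\<omega>. ennreal ((norm (I t \<omega> - ?E (e k) t \<omega>))\<^sup>2) \<partial>M) \<longlonglongrightarrow> 0" if t0: "0 \<le> t" for t u
  proof -
    obtain e :: "nat \<Rightarrow> ('w, 'z, 'h) elementary" where e: "\<And>k. elementary_predictable M F \<nu> (e k)"
      "(\<lambda>k. square_norm M \<nu> t (\<lambda>s \<omega> z. f s \<omega> z - ?J (e k) s \<omega> z)) \<longlonglongrightarrow> 0"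
      "(\<lambda>k. \<integral>\<^sup>+\<omega>. ennreal ((norm (I t \<omega> - ?E (e k) t \<omega>))\<^sup>2) \<partial>M) \<longlonglongrightarrow> 0"
    proof -
      have "\<exists>e :: nat \<Rightarrow> ('w, 'z, 'h) elementary.
        (\<forall>k. elementary_predictable M F \<nu> (e k)) \<and>
        (\<lambda>k. square_norm M \<nu> t (\<lambda>s \<omega> z. f s \<omega> z - ?J (e k) s \<omega> z)) \<longlonglongrightarrow> 0 \<and>
        (\<lambda>k. \<integral>\<^sup>+\<omega>. ennreal ((norm (I t \<omega> - ?E (e k) t \<omega>))\<^sup>2) \<partial>M) \<longlonglongrightarrow> 0"
        using I t0 by (simp add: compensated_integral_L2_def)
      then show ?thesis using that by (elim exE conjE) auto
    qed
    have "(\<lambda>k. sq_dist u t f (?J (e k))) \<longlonglongrightarrow> 0" for u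
      by (rule tendsto_sandwich[OF _ _ tendsto_const e(2)])
         (intro always_eventually allI zero_le sq_dist_le_square_norm[OF f predictable_integrand_elementary[OF e(1)]] order_refl)+
    then show ?thesis using e by (intro exI[of _ e]) simp
  qed
  obtain a where a: "\<And>k. elementary_predictable M F \<nu> (a k)" "(\<lambda>k. sq_dist 0 v f (?J (a k))) \<longlonglongrightarrow> 0"
      "(\<lambda>k. sq_dist u v f (?J (a k))) \<longlonglongrightarrow> 0"
      "(\<lambda>k. \<integral>\<^sup>+\<omega>. ennreal ((norm (I v \<omega> - ?E (a k) v \<omega>))\<^sup>2) \<partial>M) \<longlonglongrightarrow> 0"
    using approx[of v u] uv by auto
  obtain b where b: "\<And>k. elementary_predictable M F \<nu> (b k)" "(\<lambda>k. sq_dist 0 u f (?J (b k))) \<longlonglongrightarrow> 0"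
      "(\<lambda>k. \<integral>\<^sup>+\<omega>. ennreal ((norm (I u \<omega> - ?E (b k) u \<omega>))\<^sup>2) \<partial>M) \<longlonglongrightarrow> 0"
    using approx[of u 0] uv by auto
  have v: "0 \<le> v" using uv by simp
  note [measurable] = Im[OF uv(1)] Im[OF v] elementary_integral_measurable[OF e uv(1)] elementary_integral_measurable[OF e v]
    elementary_integral_measurable[OF a(1) uv(1)] elementary_integral_measurable[OF a(1) v]
    elementary_integral_measurable[OF b(1) uv(1)]
  note J = predictable_integrand_elementary[OF a(1)] predictable_integrand_elementary[OF b(1)]
    predictable_integrand_elementary[OF e]
  \<comment> \<open>The integral at each time comes with its own approximations; by the isometry those for the
    later time also converge at the earlier one.\<close>
  have ab: "(\<integral>\<^sup>+\<omega>. ennreal ((norm (?E (b k) u \<omega> - ?E (a k) u \<omega>))\<^sup>2) \<partial>M)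
      \<le> 2 * sq_dist 0 u f (?J (b k)) + 2 * sq_dist 0 v f (?J (a k))" for k
  proof -
    have "(\<integral>\<^sup>+\<omega>. ennreal ((norm (?E (b k) u \<omega> - ?E (a k) u \<omega>))\<^sup>2) \<partial>M) = sq_dist 0 u (?J (b k)) (?J (a k))"
      using isometry_sq_dist[OF b(1) a(1) order_refl uv(1), of k k] elementary_integral_0[OF a(1)] elementary_integral_0[OF b(1)]
      by simp
    also have "\<dots> \<le> 2 * sq_dist 0 u (?J (b k)) f + 2 * sq_dist 0 u f (?J (a k))"
      by (rule sq_dist_triangle[OF J(2) f J(1)])
    also have "sq_dist 0 u f (?J (a k)) \<le> sq_dist 0 v f (?J (a k))"
      unfolding sq_dist_def using uv by (intro nn_integral_mono) (auto simp: indicator_def split: prod.split)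
    finally show ?thesis by (simp add: sq_dist_commute[of _ _ _ f] mult_left_mono add_left_mono)
  qed
  have au: "(\<lambda>k. \<integral>\<^sup>+\<omega>. ennreal ((norm (I u \<omega> - ?E (a k) u \<omega>))\<^sup>2) \<partial>M) \<longlonglongrightarrow> 0"
  proof (rule tendsto_0_ennreal_bound)
    show "(\<integral>\<^sup>+\<omega>. ennreal ((norm (I u \<omega> - ?E (a k) u \<omega>))\<^sup>2) \<partial>M)
      \<le> 2 * (\<integral>\<^sup>+\<omega>. ennreal ((norm (I u \<omega> - ?E (b k) u \<omega>))\<^sup>2) \<partial>M)
        + 2 * (\<integral>\<^sup>+\<omega>. ennreal ((norm (?E (b k) u \<omega> - ?E (a k) u \<omega>))\<^sup>2) \<partial>M)" for k
      using nn_integral_norm_add_sq[of "\<lambda>\<omega>. I u \<omega> - ?E (b k) u \<omega>" M "\<lambda>\<omega>. ?E (b k) u \<omega> - ?E (a k) u \<omega>"]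
      by simp
    show "(\<lambda>k. \<integral>\<^sup>+\<omega>. ennreal ((norm (?E (b k) u \<omega> - ?E (a k) u \<omega>))\<^sup>2) \<partial>M) \<longlonglongrightarrow> 0"
      by (rule tendsto_0_ennreal_bound[OF ab b(2) a(2)]) auto
  qed (use b in auto)
  define X where "X k \<omega> = (I v \<omega> - ?E (a k) v \<omega>) - (I u \<omega> - ?E (a k) u \<omega>)" for k \<omega>
  define Y where "Y k \<omega> = (?E (a k) v \<omega> - ?E e v \<omega>) - (?E (a k) u \<omega> - ?E e u \<omega>)" for k \<omega>
  have [measurable]: "X k \<in> borel_measurable M" "Y k \<in> borel_measurable M" for k
    unfolding X_def[abs_def] Y_def[abs_def] by measurable
  have X0: "(\<lambda>k. \<integral>\<^sup>+\<omega>. ennreal ((norm (X k \<omega>))\<^sup>2) \<partial>M) \<longlonglongrightarrow> 0"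
  proof (rule tendsto_0_ennreal_bound[OF _ a(4) au])
    show "(\<integral>\<^sup>+\<omega>. ennreal ((norm (X k \<omega>))\<^sup>2) \<partial>M)
      \<le> 2 * (\<integral>\<^sup>+\<omega>. ennreal ((norm (I v \<omega> - ?E (a k) v \<omega>))\<^sup>2) \<partial>M)
        + 2 * (\<integral>\<^sup>+\<omega>. ennreal ((norm (I u \<omega> - ?E (a k) u \<omega>))\<^sup>2) \<partial>M)" for k
    proof -
      let ?B = "\<lambda>\<omega>. ?E (a k) u \<omega> - I u \<omega>"
      have "norm (?B \<omega>) = norm (I u \<omega> - ?E (a k) u \<omega>)" for \<omega> by (rule norm_minus_commute)
      moreover have "X k \<omega> = (I v \<omega> - ?E (a k) v \<omega>) + ?B \<omega>" for \<omega> by (simp add: X_def)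
      ultimately show ?thesis
        using nn_integral_norm_add_sq[of "\<lambda>\<omega>. I v \<omega> - ?E (a k) v \<omega>" M ?B] by simp
    qed
  qed auto
  have Yle: "(\<integral>\<^sup>+\<omega>. ennreal ((norm (Y k \<omega>))\<^sup>2) \<partial>M) \<le> 2 * sq_dist u v f (?J (a k)) + 2 * sq_dist u v f (?J e)" for k
    using isometry_sq_dist[OF a(1) e uv, of k] sq_dist_triangle[OF J(1) f J(3), of u v k]
    by (simp add: Y_def sq_dist_commute[of _ _ _ f])
  let ?L = "\<integral>\<^sup>+\<omega>. ennreal ((norm ((I v \<omega> - ?E e v \<omega>) - (I u \<omega> - ?E e u \<omega>)))\<^sup>2) \<partial>M"
  have "?L \<le> 2 * (\<integral>\<^sup>+\<omega>. ennreal ((norm (X k \<omega>))\<^sup>2) \<partial>M) + 2 * (2 * sq_dist u v f (?J (a k)) + 2 * sq_dist u v f (?J e))" for k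
  proof -
    have "?L = (\<integral>\<^sup>+\<omega>. ennreal ((norm (X k \<omega> + Y k \<omega>))\<^sup>2) \<partial>M)"
      by (simp add: X_def Y_def algebra_simps)
    also have "\<dots> \<le> 2 * (\<integral>\<^sup>+\<omega>. ennreal ((norm (X k \<omega>))\<^sup>2) \<partial>M) + 2 * (\<integral>\<^sup>+\<omega>. ennreal ((norm (Y k \<omega>))\<^sup>2) \<partial>M)"
      by (rule nn_integral_norm_add_sq) auto
    finally show ?thesis using Yle[of k] by (meson add_left_mono mult_left_mono order_trans zero_le)
  qed
  moreover have "(\<lambda>k. 2 * (\<integral>\<^sup>+\<omega>. ennreal ((norm (X k \<omega>))\<^sup>2) \<partial>M) + 2 * (2 * sq_dist u v f (?J (a k)) + 2 * sq_dist u v f (?J e)))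
      \<longlonglongrightarrow> 2 * 0 + 2 * (2 * 0 + 2 * sq_dist u v f (?J e))"
    using X0 a(3) by (intro tendsto_add ennreal_tendsto_cmult tendsto_const) auto
  ultimately have "?L \<le> 2 * 0 + 2 * (2 * 0 + 2 * sq_dist u v f (?J e))"
    by (intro LIMSEQ_le_const) auto
  then show ?thesis by (simp add: mult.assoc[symmetric])
qed

end

section \<open>Jumps of the compensated integral\<close>

lemma tendsto_right_seq:
  fixes f :: "real \<Rightarrow> 'a::topological_space"
  assumes f: "(f \<longlongrightarrow> f t) (at_right t)" and v: "v \<longlonglongrightarrow> t" "\<And>n. t \<le> v n"
  shows "(\<lambda>n. f (v n)) \<longlonglongrightarrow> f t"
proof (rule topological_tendstoI)
  fix S assume S: "open S" "f t \<in> S"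
  then have "eventually (\<lambda>r. f r \<in> S) (at_right t)" using f by (auto simp: tendsto_def)
  then obtain b where b: "t < b" "\<And>r. t < r \<Longrightarrow> r < b \<Longrightarrow> f r \<in> S"
    by (auto simp: eventually_at_right_field)
  have "eventually (\<lambda>n. v n < b) sequentially" using v(1) b(1) by (rule order_tendstoD)
  then show "eventually (\<lambda>n. f (v n) \<in> S) sequentially"
  proof eventually_elim
    case (elim n)
    then show ?case using v(2)[of n] b(2)[of "v n"] S(2) by (cases "v n = t") auto
  qed
qed

lemma tendsto_left_seq:
  fixes f :: "real \<Rightarrow> 'a::topological_space"
  assumes f: "(f \<longlongrightarrow> l) (at_left t)" and u: "u \<longlonglongrightarrow> t" "\<And>n. u n < t"
  shows "(\<lambda>n. f (u n)) \<longlonglongrightarrow> l"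
proof -
  have "filterlim u (at_left t) sequentially"
    using u by (auto simp: filterlim_at intro!: always_eventually less_imp_neq)
  then show ?thesis by (rule filterlim_compose[OF f])
qed

lemma grid_seq:
  fixes T t :: real
  assumes t: "0 < t" "t \<le> T"
  obtains k where "\<And>n. k n \<le> n"
    "\<And>n. T * real (k n) / real (Suc n) < t" "\<And>n. t \<le> T * real (Suc (k n)) / real (Suc n)"
    "(\<lambda>n. T * real (k n) / real (Suc n)) \<longlonglongrightarrow> t" "(\<lambda>n. T * real (Suc (k n)) / real (Suc n)) \<longlonglongrightarrow> t"
proof -
  have "\<exists>k. k \<le> n \<and> T * real k / real (Suc n) < t \<and> t \<le> T * real (Suc k) / real (Suc n)" for n
    using grid_cover[OF t, of n] by blast
  then obtain k where k: "\<And>n. k n \<le> n" "\<And>n. T * real (k n) / real (Suc n) < t"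
    "\<And>n. t \<le> T * real (Suc (k n)) / real (Suc n)" by metis
  have step: "T * real (Suc (k n)) / real (Suc n) = T * real (k n) / real (Suc n) + T * (1 / real (Suc n))" for n
    by (simp add: add_divide_distrib distrib_left)
  have z: "(\<lambda>n. T * (1 / real (Suc n))) \<longlonglongrightarrow> 0"
    using tendsto_mult[OF tendsto_const LIMSEQ_inverse_real_of_nat, of T] by (simp add: inverse_eq_divide)
  have a: "(\<lambda>n. T * real (k n) / real (Suc n)) \<longlonglongrightarrow> t"
  proof (rule tendsto_sandwich)
    show "\<forall>\<^sub>F n in sequentially. t - T * (1 / real (Suc n)) \<le> T * real (k n) / real (Suc n)"
      using k(3) unfolding step by (auto intro!: always_eventually simp: diff_le_eq)
    show "\<forall>\<^sub>F n in sequentially. T * real (k n) / real (Suc n) \<le> t"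
      using k(2) by (auto intro!: always_eventually less_imp_le)
    show "(\<lambda>n. t - T * (1 / real (Suc n))) \<longlonglongrightarrow> t" using tendsto_diff[OF tendsto_const z, of t] by simp
  qed simp
  have "(\<lambda>n. T * real (Suc (k n)) / real (Suc n)) \<longlonglongrightarrow> t"
    unfolding step using tendsto_add[OF a z] by simp
  then show ?thesis using k a that by blast
qed

context poisson_random_measure
begin

text \<open>
  Intervals that shrink to \<open>t\<close> contain \<open>t\<close>, which keeps the atom in the limit.
\<close>

lemma measure_shrink:
  assumes \<mu>: "sets \<mu> = sets \<Lambda>" and B: "B \<in> sets \<nu>" and fin: "emeasure \<mu> (B \<times> {0<..T}) < \<infinity>"
    and uv: "\<And>n. 0 \<le> u n" "\<And>n. u n < t" "\<And>n. t \<le> v n" "\<And>n. v n \<le> T"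
    and lim: "u \<longlonglongrightarrow> t" "v \<longlonglongrightarrow> t"
  shows "(\<lambda>n. measure \<mu> (B \<times> ({a<..b} \<inter> {u n<..v n}))) \<longlonglongrightarrow> measure \<mu> (B \<times> ({a<..b} \<inter> {t}))"
proof -
  let ?A = "\<lambda>n. B \<times> ({a<..b} \<inter> {u n<..v n})" and ?L = "B \<times> ({a<..b} \<inter> {t})"
  have t: "0 < t" using uv(1,2)[of 0] by simp
  have As: "?A n \<in> sets \<mu>" for n
  proof -
    have "{a<..b} \<inter> {u n<..v n} \<subseteq> {0..}" using uv(1)[of n] by auto
    then show ?thesis unfolding \<mu> using B by (intro box_sets) auto
  qed
  have Ls: "?L \<in> sets \<mu>" unfolding \<mu> using B t by (intro box_sets) auto
  have Ts: "B \<times> {0<..T} \<in> sets \<mu>" unfolding \<mu> using B by (intro box_sets) auto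
  have "(\<lambda>n. integral\<^sup>L \<mu> (indicator (?A n) :: _ \<Rightarrow> real)) \<longlonglongrightarrow> integral\<^sup>L \<mu> (indicator ?L)"
  proof (rule integral_dominated_convergence)
    show "integrable \<mu> (indicator (B \<times> {0<..T}) :: _ \<Rightarrow> real)" using Ts fin by simp
    show "AE x in \<mu>. (\<lambda>n. indicator (?A n) x :: real) \<longlonglongrightarrow> indicator ?L x"
    proof (intro AE_I2)
      fix x :: "'z \<times> real"
      obtain z s where x: "x = (z, s)" by (cases x)
      have "eventually (\<lambda>n. (indicator (?A n) x :: real) = indicator ?L x) sequentially"
      proof (cases s t rule: linorder_cases)
        case less
        then have "eventually (\<lambda>n. s < u n) sequentially" using lim(1) by (intro order_tendstoD)
        then show ?thesis by eventually_elim (use less in \<open>auto simp: x indicator_def\<close>)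
      next
        case equal
        then show ?thesis using uv by (auto simp: x indicator_def)
      next
        case greater
        then have "eventually (\<lambda>n. v n < s) sequentially" using lim(2) by (intro order_tendstoD)
        then show ?thesis by eventually_elim (use greater in \<open>auto simp: x indicator_def\<close>)
      qed
      then show "(\<lambda>n. indicator (?A n) x :: real) \<longlonglongrightarrow> indicator ?L x" by (rule tendsto_eventually)
    qed
    show "AE x in \<mu>. norm (indicator (?A n) x :: real) \<le> indicator (B \<times> {0<..T}) x" for n
      using uv(1,4)[of n] by (intro AE_I2) (auto simp: indicator_def)
  qed (use As Ls in auto)
  moreover have "?A n \<inter> space \<mu> = ?A n" "?L \<inter> space \<mu> = ?L" for n
    using sets.sets_into_space[OF As] sets.sets_into_space[OF Ls] by blast+
  ultimately show ?thesis by simp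
qed

text \<open>
  Across shrinking intervals the compensator vanishes and only the atoms at \<open>t\<close> survive.
\<close>

lemma elementary_jump:
  fixes e :: "('w, 'z, 'h::{real_normed_vector, banach, second_countable_topology}) elementary"
  assumes e: "elementary_predictable M F \<nu> e" and \<omega>: "\<omega> \<in> space M"
    and fin: "\<forall>(a, b, B, \<xi>)\<in>set e. emeasure (N \<omega>) (B \<times> {0<..T}) < \<infinity>"
    and uv: "\<And>n. 0 \<le> u n" "\<And>n. u n < t" "\<And>n. t \<le> v n" "\<And>n. v n \<le> T"
    and lim: "u \<longlonglongrightarrow> t" "v \<longlonglongrightarrow> t"
  shows "(\<lambda>n. elementary_integral \<nu> N e (v n) \<omega> - elementary_integral \<nu> N e (u n) \<omega>)
    \<longlonglongrightarrow> (\<Sum>(a, b, B, \<xi>)\<leftarrow>e. mass (B \<times> ({a<..b} \<inter> {t})) \<omega> *\<^sub>R \<xi> \<omega>)"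
proof -
  have u_le_v: "u n \<le> v n" for n using uv(2,3)[of n] by simp
  have t: "0 < t" using uv(1,2)[of 0] by simp
  have "(\<lambda>n. \<Sum>(a, b, B, \<xi>)\<leftarrow>e. centred_mass (B \<times> ({a<..b} \<inter> {u n<..v n})) \<omega> *\<^sub>R \<xi> \<omega>)
    \<longlonglongrightarrow> (\<Sum>(a, b, B, \<xi>)\<leftarrow>e. mass (B \<times> ({a<..b} \<inter> {t})) \<omega> *\<^sub>R \<xi> \<omega>)"
    using e fin
  proof (induction e)
    case (Cons p e)
    then have p: "elementary_predictable M F \<nu> [p]" and e: "elementary_predictable M F \<nu> e"
      by (auto simp: elementary_predictable_Cons[of p e])
    obtain a b B \<xi> where pe: "p = (a, b, B, \<xi>)" by (cases p)
    have B: "B \<in> fmeasurable \<nu>" "B \<in> sets \<nu>" using p by (auto simp: pe elementary_predictable_def fmeasurable_def)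
    have BT: "emeasure \<Lambda> (B \<times> {0<..T}) < \<infinity>"
    proof -
      have "B \<times> {0<..T} \<in> fmeasurable \<Lambda>" using B by (intro box_fmeasurable[where T=T]) auto
      then show ?thesis by (simp add: fmeasurable_def)
    qed
    have fB: "emeasure (N \<omega>) (B \<times> {0<..T}) < \<infinity>" using Cons.prems(2) by (simp add: pe)
    have "emeasure lborel ({a<..b} \<inter> {t}) = 0" by (cases "t \<in> {a<..b}") auto
    moreover have "emeasure \<Lambda> (B \<times> ({a<..b} \<inter> {t})) = emeasure \<nu> B * emeasure lborel ({a<..b} \<inter> {t})"
      using B t by (intro emeasure_box) auto
    ultimately have "measure \<Lambda> (B \<times> ({a<..b} \<inter> {t})) = 0" by (simp add: measure_def)
    then have "(\<lambda>n. centred_mass (B \<times> ({a<..b} \<inter> {u n<..v n})) \<omega>) \<longlonglongrightarrow> mass (B \<times> ({a<..b} \<inter> {t})) \<omega>"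
      using tendsto_diff[OF measure_shrink[OF sets_N[OF \<omega>] B(2) fB uv lim, of a b]
        measure_shrink[OF refl B(2) BT uv lim, of a b]]
      by (simp add: centred_mass_def mass_def)
    moreover have "\<forall>(a, b, B, \<xi>)\<in>set e. emeasure (N \<omega>) (B \<times> {0<..T}) < \<infinity>" using Cons.prems(2) by simp
    note Cons.IH[OF e this]
    ultimately show ?case by (auto simp: pe intro!: tendsto_add tendsto_scaleR)
  qed simp
  then show ?thesis using elementary_increment_pathwise[OF e uv(1) u_le_v uv(4) \<omega> fin]
    by (simp add: entry_inc_def[abs_def])
qed

text \<open>
  At a jump time of \<open>G\<close> the marks outside \<open>G\<close> do not jump, so each set of marks may be replaced by
  its part in \<open>G\<close>.
\<close>

lemma elementary_jump_eq_integral: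
  fixes e :: "('w, 'z, 'h::{real_normed_vector, banach, second_countable_topology}) elementary"
  assumes e: "elementary_predictable M F \<nu> e" and \<omega>: "\<omega> \<in> space M" and t: "0 \<le> t"
    and G: "G \<in> sets \<nu>" "emeasure (N \<omega>) (G \<times> {t}) < \<infinity>"
    and off: "\<forall>(a, b, B, \<xi>)\<in>set e. emeasure (N \<omega>) ((B - G) \<times> {t}) = 0"
  shows "set_integrable (N \<omega>) (G \<times> {t}) (\<lambda>p. elementary_integrand e (snd p) \<omega> (fst p)) \<and>
    (LINT p:G \<times> {t}|N \<omega>. elementary_integrand e (snd p) \<omega> (fst p))
      = (\<Sum>(a, b, B, \<xi>)\<leftarrow>e. mass (B \<times> ({a<..b} \<inter> {t})) \<omega> *\<^sub>R \<xi> \<omega>)"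
  using e off
proof (induction e)
  case Nil
  then show ?case by (simp add: elementary_integrand_def set_integrable_def set_lebesgue_integral_def)
next
  case (Cons p e)
  then have p: "elementary_predictable M F \<nu> [p]" and e: "elementary_predictable M F \<nu> e"
    by (auto simp: elementary_predictable_Cons[of p e])
  obtain a b B \<xi> where pe: "p = (a, b, B, \<xi>)" by (cases p)
  have B: "B \<in> sets \<nu>" using p by (auto simp: pe elementary_predictable_def)
  have slices: "(B \<inter> G) \<times> {t} \<in> sets (N \<omega>)" "G \<times> {t} \<in> sets (N \<omega>)" "(B - G) \<times> {t} \<in> sets (N \<omega>)"
    using B G t sets_N[OF \<omega>] by (auto intro!: slice_sets)
  have "emeasure (N \<omega>) ((B \<inter> G) \<times> {t}) \<le> emeasure (N \<omega>) (G \<times> {t})"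
    using slices by (intro emeasure_mono) auto
  then have fin: "emeasure (N \<omega>) ((B \<inter> G) \<times> {t}) < \<infinity>" using G(2) by (auto intro: le_less_trans)
  have "emeasure (N \<omega>) (((B \<inter> G) \<times> {t}) \<union> ((B - G) \<times> {t})) = emeasure (N \<omega>) ((B \<inter> G) \<times> {t})"
    using slices Cons.prems(2) by (intro emeasure_Un_null_set) (auto simp: pe null_sets_def)
  moreover have "((B \<inter> G) \<times> {t}) \<union> ((B - G) \<times> {t}) = B \<times> {t}" by auto
  ultimately have cB: "mass (B \<times> {t}) \<omega> = measure (N \<omega>) ((B \<inter> G) \<times> {t})" by (simp add: mass_def measure_def)
  let ?i = "\<lambda>p. indicator (G \<times> {t}) p *\<^sub>R ((indicator {a<..b} (snd p) * indicator B (fst p)) *\<^sub>R \<xi> \<omega>)"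
  have eq: "?i = (\<lambda>p. indicator ((B \<inter> G) \<times> {t}) p *\<^sub>R (indicator {a<..b} t *\<^sub>R \<xi> \<omega>))"
    by (auto simp: indicator_def)
  have int: "integrable (N \<omega>) ?i" unfolding eq using slices fin by (intro integrable_scaleR_left) auto
  have "integral\<^sup>L (N \<omega>) ?i = measure (N \<omega>) ((B \<inter> G) \<times> {t}) *\<^sub>R (indicator {a<..b} t *\<^sub>R \<xi> \<omega>)"
  proof -
    have "(B \<inter> G) \<times> {t} \<inter> space (N \<omega>) = (B \<inter> G) \<times> {t}" using sets.sets_into_space[OF slices(1)] by auto
    then show ?thesis unfolding eq using slices fin by (subst integral_scaleR_left) auto
  qed
  also have "\<dots> = mass (B \<times> ({a<..b} \<inter> {t})) \<omega> *\<^sub>R \<xi> \<omega>"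
    using cB by (auto simp: indicator_def mass_def)
  finally have val: "integral\<^sup>L (N \<omega>) ?i = mass (B \<times> ({a<..b} \<inter> {t})) \<omega> *\<^sub>R \<xi> \<omega>" .
  have off': "\<forall>(a, b, B, \<xi>)\<in>set e. emeasure (N \<omega>) ((B - G) \<times> {t}) = 0" using Cons.prems(2) by simp
  have split: "(\<lambda>q. indicator (G \<times> {t}) q *\<^sub>R elementary_integrand (p # e) (snd q) \<omega> (fst q))
      = (\<lambda>q. ?i q + indicator (G \<times> {t}) q *\<^sub>R elementary_integrand e (snd q) \<omega> (fst q))"
    by (auto simp: elementary_integrand_def pe scaleR_add_right)
  show ?case
    using Cons.IH[OF e off'] int val unfolding set_integrable_def set_lebesgue_integral_def split
    by (simp add: pe)
qed

lemma sq_dist_split: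
  fixes f g :: "real \<Rightarrow> 'w \<Rightarrow> 'z \<Rightarrow> 'h::{real_normed_vector, second_countable_topology}"
  assumes fg: "predictable_integrand M F \<nu> f" "predictable_integrand M F \<nu> g" and "u \<le> v" "v \<le> w"
  shows "sq_dist u w f g = sq_dist u v f g + sq_dist v w f g"
proof -
  have "sq_dist u w f g = (\<integral>\<^sup>+x. (\<lambda>(\<omega>, z, s). indicator {u<..v} s * ennreal ((norm (f s \<omega> z - g s \<omega> z))\<^sup>2)) x
     + (\<lambda>(\<omega>, z, s). indicator {v<..w} s * ennreal ((norm (f s \<omega> z - g s \<omega> z))\<^sup>2)) x \<partial>MP)"
    unfolding sq_dist_def using assms(3,4) by (intro nn_integral_cong) (auto simp: indicator_def)
  also have "\<dots> = sq_dist u v f g + sq_dist v w f g"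
    unfolding sq_dist_def by (intro nn_integral_add sq_dist_measurable fg)
  finally show ?thesis .
qed

lemma sum_sq_dist:
  fixes f g :: "real \<Rightarrow> 'w \<Rightarrow> 'z \<Rightarrow> 'h::{real_normed_vector, second_countable_topology}"
  assumes fg: "predictable_integrand M F \<nu> f" "predictable_integrand M F \<nu> g" and r: "incseq r"
  shows "(\<Sum>j<n. sq_dist (r j) (r (Suc j)) f g) = sq_dist (r 0) (r n) f g"
proof (induction n)
  case 0
  have "(\<integral>\<^sup>+(x::'w \<times> 'z \<times> real). 0 \<partial>MP) = 0" by simp
  moreover have "(\<lambda>(\<omega>, z, s). 0) = (\<lambda>x::'w \<times> 'z \<times> real. 0::ennreal)" by auto
  ultimately show ?case by (simp add: sq_dist_def)
next
  case (Suc n)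
  then show ?case using sq_dist_split[OF fg, of "r 0" "r n" "r (Suc n)"] r by (simp add: incseq_def)
qed

text \<open>
  The jumps of an integral that is only known as a limit in mean square at each fixed time. Let
  \<open>e k\<close> approximate \<open>f\<close> and let \<open>D k\<close> be the difference of the two integrals. The square of any jump of
  \<open>D k\<close> is at most \<open>Q k\<close>, the lower limit of the sums of squared increments along grids, and by
  the isometry the mean of \<open>Q k\<close> is bounded by a multiple of the squared distance of \<open>f\<close> and \<open>e k\<close>. The error that the integrands make
  at the atoms is bounded by \<open>R k\<close>, the integral of the squared difference against the random measure, whose
  mean is at most that distance by the compensation formula. Both bounds hold for all jump times at once and
  become arbitrarily small along the sequence; for \<open>e k\<close> the jumps are explicit.
\<close>

lemma L2_integral_jump:
  fixes f :: "real \<Rightarrow> 'w \<Rightarrow> 'z \<Rightarrow> 'h::{real_inner, banach, second_countable_topology}"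
  assumes I: "compensated_integral_L2 M F \<nu> N f I" and G: "G \<in> fmeasurable \<nu>" and T: "0 < T"
  shows "AE \<omega> in M. \<forall>t\<in>{0<..T}. \<forall>l. ((\<lambda>r. I r \<omega>) \<longlongrightarrow> l) (at_left t) \<longrightarrow> emeasure (N \<omega>) (G \<times> {t}) = 1 \<longrightarrow>
    set_integrable (N \<omega>) (G \<times> {t}) (\<lambda>p. f (snd p) \<omega> (fst p)) \<and>
    I t \<omega> - l = (LINT p:G \<times> {t}|N \<omega>. f (snd p) \<omega> (fst p))"
proof -
  let ?E = "elementary_integral \<nu> N" and ?J = "elementary_integrand"
  have f: "predictable_integrand M F \<nu> f" and cI: "cadlag_adapted M F I"
    using I by (simp_all add: compensated_integral_L2_def)
  have Im: "I t \<in> borel_measurable M" if "0 \<le> t" for t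
    using I that by (intro measurable_F_M[of _ t]) (simp add: compensated_integral_L2_def cadlag_adapted_def)
  obtain e :: "nat \<Rightarrow> ('w, 'z, 'h) elementary" where e: "\<And>k. elementary_predictable M F \<nu> (e k)"
    "(\<lambda>k. square_norm M \<nu> T (\<lambda>s \<omega> z. f s \<omega> z - ?J (e k) s \<omega> z)) \<longlonglongrightarrow> 0"
  proof -
    have "\<exists>e :: nat \<Rightarrow> ('w, 'z, 'h) elementary.
      (\<forall>k. elementary_predictable M F \<nu> (e k)) \<and>
      (\<lambda>k. square_norm M \<nu> T (\<lambda>s \<omega> z. f s \<omega> z - ?J (e k) s \<omega> z)) \<longlonglongrightarrow> 0 \<and>
      (\<lambda>k. \<integral>\<^sup>+\<omega>. ennreal ((norm (I T \<omega> - ?E (e k) T \<omega>))\<^sup>2) \<partial>M) \<longlonglongrightarrow> 0"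
      using I T by (simp add: compensated_integral_L2_def)
    then show ?thesis using that by (elim exE conjE) auto
  qed
  note J = predictable_integrand_elementary[OF e(1)]
  have sq_dist0: "(\<lambda>k. sq_dist 0 T f (?J (e k))) \<longlonglongrightarrow> 0"
    by (rule tendsto_sandwich[OF _ _ tendsto_const e(2)])
       (intro always_eventually allI zero_le sq_dist_le_square_norm[OF f J] order_refl)+
  define r where "r n j = T * real j / real (Suc n)" for n j :: nat
  have r_inc: "incseq (r n)" for n
    using T by (auto simp: incseq_def r_def intro!: divide_right_mono mult_left_mono simp del: of_nat_Suc)
  have r0: "0 \<le> r n j" for n j using T by (simp add: r_def)
  have rT: "r n 0 = 0" "r n (Suc n) = T" for n by (simp_all add: r_def del: of_nat_Suc)
  define D where "D k t \<omega> = I t \<omega> - ?E (e k) t \<omega>" for k t \<omega>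
  have Dm: "D k t \<in> borel_measurable M" if "0 \<le> t" for k t
    unfolding D_def[abs_def] using Im[OF that] elementary_integral_measurable[OF e(1) that] by simp
  define V where "V k n \<omega> = (\<Sum>j<Suc n. ennreal ((norm (D k (r n (Suc j)) \<omega> - D k (r n j) \<omega>))\<^sup>2))" for k n \<omega>
  have Vterm: "(\<lambda>\<omega>. ennreal ((norm (D k (r n (Suc j)) \<omega> - D k (r n j) \<omega>))\<^sup>2)) \<in> borel_measurable M" for k n j
    using Dm[OF r0, of k n j] Dm[OF r0, of k n "Suc j"] by measurable
  have Vm [measurable]: "V k n \<in> borel_measurable M" for k n
    unfolding V_def[abs_def] by (intro borel_measurable_sum Vterm)
  have EV: "(\<integral>\<^sup>+\<omega>. V k n \<omega> \<partial>M) \<le> 4 * sq_dist 0 T f (?J (e k))" for k n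
  proof -
    have "(\<integral>\<^sup>+\<omega>. V k n \<omega> \<partial>M) = (\<Sum>j<Suc n. \<integral>\<^sup>+\<omega>. ennreal ((norm (D k (r n (Suc j)) \<omega> - D k (r n j) \<omega>))\<^sup>2) \<partial>M)"
      unfolding V_def by (intro nn_integral_sum Vterm)
    also have "\<dots> \<le> (\<Sum>j<Suc n. 4 * sq_dist (r n j) (r n (Suc j)) f (?J (e k)))"
      unfolding D_def using r_inc r0 by (intro sum_mono L2_integral_increment[OF I e(1)]) (auto simp: incseq_def)
    also have "\<dots> = 4 * sq_dist 0 T f (?J (e k))"
      using sum_sq_dist[OF f J[of k] r_inc[of n], of "Suc n"] by (simp only: sum_distrib_left[symmetric] rT)
    finally show ?thesis .
  qed
  define Q where "Q k \<omega> = liminf (\<lambda>n. V k n \<omega>)" for k \<omega>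
  have Qm [measurable]: "Q k \<in> borel_measurable M" for k unfolding Q_def[abs_def] by measurable
  have EQ: "(\<integral>\<^sup>+\<omega>. Q k \<omega> \<partial>M) \<le> 4 * sq_dist 0 T f (?J (e k))" for k
  proof -
    have "(\<integral>\<^sup>+\<omega>. Q k \<omega> \<partial>M) \<le> liminf (\<lambda>n. \<integral>\<^sup>+\<omega>. V k n \<omega> \<partial>M)"
      unfolding Q_def by (intro nn_integral_liminf Vm)
    also have "\<dots> \<le> 4 * sq_dist 0 T f (?J (e k))"
      using EV by (intro Liminf_le) auto
    finally show ?thesis .
  qed
  define g where "g k = (\<lambda>((s, \<omega>), z). ennreal ((norm (f s \<omega> z - ?J (e k) s \<omega> z))\<^sup>2))" for k
  have gm: "g k \<in> borel_measurable pred_marks" for k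
    using predictable_integrand_diff[OF f J, of k] unfolding g_def predictable_integrand_def
    by (simp add: case_prod_beta')
  define R where "R k \<omega> = (\<integral>\<^sup>+p. indicator (G \<times> {0<..T}) p * g k ((snd p, \<omega>), fst p) \<partial>N \<omega>)" for k \<omega>
  have Rm [measurable]: "R k \<in> borel_measurable M" for k
    unfolding R_def[abs_def] by (rule compensation_measurable[OF G gm])
  have ER: "(\<integral>\<^sup>+\<omega>. R k \<omega> \<partial>M) \<le> sq_dist 0 T f (?J (e k))" for k
    unfolding R_def compensation[OF G gm] sq_dist_def
    by (intro nn_integral_mono) (auto simp: g_def indicator_def)
  have "(\<lambda>k. \<integral>\<^sup>+\<omega>. Q k \<omega> + R k \<omega> \<partial>M) \<longlonglongrightarrow> 0"
  proof (rule tendsto_0_ennreal_bound[OF _ sq_dist0 sq_dist0])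
    show "(\<integral>\<^sup>+\<omega>. Q k \<omega> + R k \<omega> \<partial>M) \<le> 4 * sq_dist 0 T f (?J (e k)) + 1 * sq_dist 0 T f (?J (e k))" for k
      using EQ[of k] ER[of k] by (simp add: nn_integral_add add_mono)
  qed auto
  then have lim0: "liminf (\<lambda>k. \<integral>\<^sup>+\<omega>. Q k \<omega> + R k \<omega> \<partial>M) = 0" by (intro lim_imp_Liminf) auto
  have "(\<integral>\<^sup>+\<omega>. liminf (\<lambda>k. Q k \<omega> + R k \<omega>) \<partial>M) \<le> 0"
    unfolding lim0[symmetric] by (intro nn_integral_liminf) measurable
  then have "(\<integral>\<^sup>+\<omega>. liminf (\<lambda>k. Q k \<omega> + R k \<omega>) \<partial>M) = 0" by simp
  then have S0: "AE \<omega> in M. liminf (\<lambda>k. Q k \<omega> + R k \<omega>) = 0" by (subst (asm) nn_integral_0_iff_AE) measurable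
  have AE_e: "AE \<omega> in M. \<forall>k. \<forall>(a, b, B, \<xi>)\<in>set (e k). emeasure (N \<omega>) (B \<times> {0<..T}) < \<infinity> \<and>
      (\<forall>t\<in>{0<..T}. emeasure (N \<omega>) ((B - G) \<times> {t}) = 0 \<or> emeasure (N \<omega>) (G \<times> {t}) = 0)"
    unfolding AE_all_countable
  proof (intro allI, subst AE_finite_all)
    fix k
    show "\<forall>p\<in>set (e k). AE \<omega> in M. case p of (a, b, B, \<xi>) \<Rightarrow> emeasure (N \<omega>) (B \<times> {0<..T}) < \<infinity> \<and>
      (\<forall>t\<in>{0<..T}. emeasure (N \<omega>) ((B - G) \<times> {t}) = 0 \<or> emeasure (N \<omega>) (G \<times> {t}) = 0)"
    proof
      fix p assume p: "p \<in> set (e k)"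
      obtain a b B \<xi> where pe: "p = (a, b, B, \<xi>)" by (cases p)
      have "case (a, b, B, \<xi>) of (a, b, B, \<xi>) \<Rightarrow> B \<in> sets \<nu> \<and> emeasure \<nu> B < \<infinity>"
        using e(1)[of k] p unfolding elementary_predictable_def pe by fast
      then have B: "B \<in> fmeasurable \<nu>" by (auto simp: fmeasurable_def)
      have BT: "B \<times> {0<..T} \<in> fmeasurable \<Lambda>" using B by (intro box_fmeasurable[where T=T]) auto
      have BG: "B - G \<in> fmeasurable \<nu>" using B G by (intro fmeasurable.Diff) auto
      have "AE \<omega> in M. emeasure (N \<omega>) (B \<times> {0<..T}) < \<infinity>"
        using AE_emeasure_N_nat[OF BT] by eventually_elim (auto simp: of_nat_less_top)
      moreover have "AE \<omega> in M. \<forall>t\<in>{0<..T}. emeasure (N \<omega>) ((B - G) \<times> {t}) = 0 \<or> emeasure (N \<omega>) (G \<times> {t}) = 0"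
        using AE_no_common_jumps[OF BG G _ T] by auto
      ultimately show "AE \<omega> in M. case p of (a, b, B, \<xi>) \<Rightarrow> emeasure (N \<omega>) (B \<times> {0<..T}) < \<infinity> \<and>
        (\<forall>t\<in>{0<..T}. emeasure (N \<omega>) ((B - G) \<times> {t}) = 0 \<or> emeasure (N \<omega>) (G \<times> {t}) = 0)"
        unfolding pe by eventually_elim simp
    qed
  qed simp
  show ?thesis using S0 AE_e AE_space
  proof eventually_elim
    case (elim \<omega>)
    show ?case
    proof (intro ballI allI impI)
      fix t l assume t: "t \<in> {0<..T}" and l: "((\<lambda>r. I r \<omega>) \<longlongrightarrow> l) (at_left t)"
        and jump: "emeasure (N \<omega>) (G \<times> {t}) = 1"
      let ?S = "G \<times> {t}"
      let ?f = "\<lambda>p. f (snd p) \<omega> (fst p)" and ?j = "\<lambda>k p. ?J (e k) (snd p) \<omega> (fst p)"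
      have Gs: "G \<in> sets \<nu>" using G by (simp add: fmeasurable_def)
      have S: "?S \<in> sets (N \<omega>)" using slice_sets[OF Gs, of t] t sets_N[OF elim(3)] by auto
      have right: "((\<lambda>r. I r \<omega>) \<longlongrightarrow> I t \<omega>) (at_right t)"
        using cI elim(3) t by (auto simp: cadlag_adapted_def cadlag_def)
      have fin: "\<forall>(a, b, B, \<xi>)\<in>set (e k). emeasure (N \<omega>) (B \<times> {0<..T}) < \<infinity>" for k
        using elim(2) by auto
      have off: "\<forall>(a, b, B, \<xi>)\<in>set (e k). emeasure (N \<omega>) ((B - G) \<times> {t}) = 0" for k
        using elim(2) t jump by fastforce
      have jint: "set_integrable (N \<omega>) ?S (?j k)" and
        jval: "(LINT p:?S|N \<omega>. ?j k p) = (\<Sum>(a, b, B, \<xi>)\<leftarrow>e k. mass (B \<times> ({a<..b} \<inter> {t})) \<omega> *\<^sub>R \<xi> \<omega>)" for k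
        using elementary_jump_eq_integral[OF e(1) elim(3) _ Gs _ off, of k] t jump by auto
      \<comment> \<open>The increment over the grid interval around \<open>t\<close> is one of the terms of \<open>V\<close>.\<close>
      obtain i where i: "\<And>n. i n \<le> n" "\<And>n. r n (i n) < t" "\<And>n. t \<le> r n (Suc (i n))"
          "(\<lambda>n. r n (i n)) \<longlonglongrightarrow> t" "(\<lambda>n. r n (Suc (i n))) \<longlonglongrightarrow> t"
        using grid_seq[of t T] t unfolding r_def by auto
      have rleT: "r n (Suc (i n)) \<le> T" for n
        using incseqD[OF r_inc[of n], of "Suc (i n)" "Suc n"] i(1)[of n] rT(2)[of n] by simp
      have Qle: "ennreal ((norm ((I t \<omega> - l) - (LINT p:?S|N \<omega>. ?j k p)))\<^sup>2) \<le> Q k \<omega>" for k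
      proof -
        have "(\<lambda>n. D k (r n (Suc (i n))) \<omega> - D k (r n (i n)) \<omega>) \<longlonglongrightarrow> (I t \<omega> - l) - (LINT p:?S|N \<omega>. ?j k p)"
        proof -
          have "(\<lambda>n. (I (r n (Suc (i n))) \<omega> - I (r n (i n)) \<omega>)
              - (?E (e k) (r n (Suc (i n))) \<omega> - ?E (e k) (r n (i n)) \<omega>)) \<longlonglongrightarrow> (I t \<omega> - l) - (LINT p:?S|N \<omega>. ?j k p)"
            unfolding jval using tendsto_right_seq[OF right i(5,3)] tendsto_left_seq[OF l i(4,2)]
              elementary_jump[OF e(1) elim(3) fin r0 i(2,3) rleT i(4,5)]
            by (intro tendsto_diff) auto
          then show ?thesis by (simp add: D_def algebra_simps)
        qed
        then have "(\<lambda>n. ennreal ((norm (D k (r n (Suc (i n))) \<omega> - D k (r n (i n)) \<omega>))\<^sup>2))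
            \<longlonglongrightarrow> ennreal ((norm ((I t \<omega> - l) - (LINT p:?S|N \<omega>. ?j k p)))\<^sup>2)"
          by (intro tendsto_ennrealI tendsto_power tendsto_norm)
        then have "ennreal ((norm ((I t \<omega> - l) - (LINT p:?S|N \<omega>. ?j k p)))\<^sup>2)
            = liminf (\<lambda>n. ennreal ((norm (D k (r n (Suc (i n))) \<omega> - D k (r n (i n)) \<omega>))\<^sup>2))"
          by (intro lim_imp_Liminf[symmetric]) auto
        also have "\<dots> \<le> Q k \<omega>" unfolding Q_def
        proof (intro Liminf_mono always_eventually allI)
          fix n
          show "ennreal ((norm (D k (r n (Suc (i n))) \<omega> - D k (r n (i n)) \<omega>))\<^sup>2) \<le> V k n \<omega>"
            unfolding V_def using i(1)[of n]
            by (intro member_le_sum[where f="\<lambda>j. ennreal ((norm (D k (r n (Suc j)) \<omega> - D k (r n j) \<omega>))\<^sup>2)"]) auto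
        qed
        finally show ?thesis .
      qed
      \<comment> \<open>The slice \<open>?S\<close> has mass one, so that the Cauchy-Schwarz inequality bounds the integral of
        the difference over it by \<open>R\<close>.\<close>
      have fm: "?f \<in> borel_measurable (N \<omega>)" and jm: "?j k \<in> borel_measurable (N \<omega>)" for k
      proof -
        have *: "(\<lambda>p. h (snd p) \<omega> (fst p)) \<in> borel_measurable (N \<omega>)"
          if "predictable_integrand M F \<nu> h" for h :: "real \<Rightarrow> 'w \<Rightarrow> 'z \<Rightarrow> 'h"
        proof -
          have "(\<lambda>p. h (snd p) \<omega> (fst p)) \<in> borel_measurable \<Lambda>"
            using measurable_compose[OF reorder_measurable_fixed[OF elim(3)] that[unfolded predictable_integrand_def]]
            by (simp add: case_prod_beta')
          moreover have "borel_measurable (N \<omega>) = (borel_measurable \<Lambda> :: (_ \<Rightarrow> 'h) set)"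
            by (intro measurable_cong_sets sets_N[OF elim(3)] refl)
          ultimately show ?thesis by simp
        qed
        show "?f \<in> borel_measurable (N \<omega>)" "?j k \<in> borel_measurable (N \<omega>)" using *[OF f] *[OF J] by auto
      qed
      have Rle: "set_integrable (N \<omega>) ?S ?f \<and>
          ennreal ((norm ((LINT p:?S|N \<omega>. ?f p) - (LINT p:?S|N \<omega>. ?j k p)))\<^sup>2) \<le> R k \<omega>"
        if fin: "R k \<omega> < \<infinity>" for k
      proof -
        define d where "d p = indicator ?S p *\<^sub>R (?f p - ?j k p)" for p
        have dm: "d \<in> borel_measurable (N \<omega>)" unfolding d_def[abs_def] using fm jm[of k] S by auto
        then have dn: "(\<lambda>p. ennreal (norm (d p))) \<in> borel_measurable (N \<omega>)" by simp
        have CS: "(\<integral>\<^sup>+p. ennreal (norm (d p)) \<partial>N \<omega>)\<^sup>2 \<le> R k \<omega>"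
        proof -
          have "(\<integral>\<^sup>+p. ennreal (norm (d p)) \<partial>N \<omega>) = (\<integral>\<^sup>+p. ennreal (norm (d p)) * indicator ?S p \<partial>N \<omega>)"
            by (intro nn_integral_cong) (auto simp: indicator_def d_def)
          then have "(\<integral>\<^sup>+p. ennreal (norm (d p)) \<partial>N \<omega>)\<^sup>2
              \<le> (\<integral>\<^sup>+p. (ennreal (norm (d p)))\<^sup>2 \<partial>N \<omega>) * (\<integral>\<^sup>+p. (indicator ?S p)\<^sup>2 \<partial>N \<omega>)"
            using Cauchy_Schwarz_nn_integral[OF dn borel_measurable_indicator[OF S]] by simp
          also have "(\<integral>\<^sup>+p. (indicator ?S p)\<^sup>2 \<partial>N \<omega>) = (\<integral>\<^sup>+p. indicator ?S p \<partial>N \<omega>)"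
            by (intro nn_integral_cong) (auto simp: indicator_def)
          also have "\<dots> = 1" using S jump by simp
          also have "(\<integral>\<^sup>+p. (ennreal (norm (d p)))\<^sup>2 \<partial>N \<omega>) \<le> R k \<omega>"
            unfolding R_def using t by (intro nn_integral_mono) (auto simp: g_def d_def indicator_def ennreal_power)
          finally show ?thesis by simp
        qed
        have dfin: "(\<integral>\<^sup>+p. ennreal (norm (d p)) \<partial>N \<omega>) < \<infinity>"
        proof (rule ccontr)
          assume "\<not> ?thesis"
          then have "(\<integral>\<^sup>+p. ennreal (norm (d p)) \<partial>N \<omega>) = \<infinity>" by (simp add: less_top[symmetric])
          then show False using CS fin by (simp add: power2_eq_square ennreal_top_mult top_unique)
        qed
        have dint: "integrable (N \<omega>) d" using dm dfin by (intro integrableI_bounded) auto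
        have "?f = (\<lambda>p. ?j k p + (?f p - ?j k p))" by auto
        then have fint: "set_integrable (N \<omega>) ?S ?f"
          using jint[of k] dint set_integral_add(1)[of "N \<omega>" ?S "?j k" "\<lambda>p. ?f p - ?j k p"]
          by (simp add: set_integrable_def d_def[abs_def])
        have "(LINT p:?S|N \<omega>. ?f p) - (LINT p:?S|N \<omega>. ?j k p) = integral\<^sup>L (N \<omega>) d"
          using set_integral_diff(2)[OF fint jint[of k]] by (simp add: set_lebesgue_integral_def d_def[abs_def])
        then have "ennreal (norm ((LINT p:?S|N \<omega>. ?f p) - (LINT p:?S|N \<omega>. ?j k p))) \<le> (\<integral>\<^sup>+p. ennreal (norm (d p)) \<partial>N \<omega>)"
          using integral_norm_bound_ennreal[OF dint] by simp
        then have "(ennreal (norm ((LINT p:?S|N \<omega>. ?f p) - (LINT p:?S|N \<omega>. ?j k p))))\<^sup>2 \<le> R k \<omega>"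
          using CS by (meson order_trans power_mono zero_le)
        then show ?thesis using fint by (simp add: ennreal_power)
      qed
      let ?x = "(I t \<omega> - l) - (LINT p:?S|N \<omega>. ?f p)"
      have bound: "ennreal ((norm ?x)\<^sup>2) \<le> 2 * (Q k \<omega> + R k \<omega>)" for k
      proof (cases "R k \<omega> < \<infinity>")
        case True
        have "ennreal ((norm ?x)\<^sup>2) \<le> 2 * ennreal ((norm ((I t \<omega> - l) - (LINT p:?S|N \<omega>. ?j k p)))\<^sup>2)
            + 2 * ennreal ((norm ((LINT p:?S|N \<omega>. ?j k p) - (LINT p:?S|N \<omega>. ?f p)))\<^sup>2)"
          using ennreal_norm_add_sq[of "(I t \<omega> - l) - (LINT p:?S|N \<omega>. ?j k p)"
              "(LINT p:?S|N \<omega>. ?j k p) - (LINT p:?S|N \<omega>. ?f p)"] by simp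
        also have "\<dots> \<le> 2 * Q k \<omega> + 2 * R k \<omega>"
          using Qle[of k] Rle[OF True] by (intro add_mono mult_left_mono) (auto simp: norm_minus_commute)
        finally show ?thesis by (simp add: distrib_left)
      next
        case False
        then have "R k \<omega> = \<infinity>" by (simp add: less_top[symmetric])
        then show ?thesis by (simp add: ennreal_mult_top)
      qed
      have small: "\<exists>k. Q k \<omega> + R k \<omega> < c" if "0 < c" for c
      proof (rule ccontr)
        assume "\<not> ?thesis"
        then have "c \<le> liminf (\<lambda>k. Q k \<omega> + R k \<omega>)"
          by (intro Liminf_bounded always_eventually) (auto simp: not_less)
        then show False using elim(1) that by simp
      qed
      have "ennreal ((norm ?x)\<^sup>2) \<le> 0"
      proof (rule ccontr)
        assume "\<not> ?thesis"
        then have pos: "0 < ennreal ((norm ?x)\<^sup>2 / 2)" by (simp add: not_le)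
        obtain k where "Q k \<omega> + R k \<omega> < ennreal ((norm ?x)\<^sup>2 / 2)" using small[OF pos] by auto
        then have "2 * (Q k \<omega> + R k \<omega>) < 2 * ennreal ((norm ?x)\<^sup>2 / 2)"
          by (intro ennreal_mult_strict_left_mono) auto
        also have "\<dots> = ennreal ((norm ?x)\<^sup>2)" by (simp add: ennreal_mult[symmetric] flip: ennreal_numeral)
        finally show False using bound[of k] by simp
      qed
      then have "?x = 0" by simp
      moreover obtain k where "Q k \<omega> + R k \<omega> < 1" using small[of 1] by auto
      then have "R k \<omega> < \<infinity>" by (auto simp: less_top[symmetric])
      then have "set_integrable (N \<omega>) ?S ?f" using Rle[of k] by simp
      ultimately show "set_integrable (N \<omega>) ?S ?f \<and> I t \<omega> - l = (LINT p:?S|N \<omega>. ?f p)" by simp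
    qed
  qed
qed

end

section \<open>Jumps of a solution\<close>

text \<open>
  After division by a bound of the functional only real functions are compared. This matters because
  differences of measurable functions into a space that is not second countable need not be measurable.
\<close>

lemma has_bochner_integral_in_functional:
  fixes L :: "'b::real_normed_vector \<Rightarrow> real"
  assumes f: "has_bochner_integral_in M f I" and L: "bounded_linear L"
  shows "has_bochner_integral M (\<lambda>x. L (f x)) (L I)"
proof -
  interpret L: bounded_linear L by fact
  have [measurable]: "L \<in> borel_measurable borel"
    by (intro borel_measurable_continuous_onI L.continuous_on continuous_on_id)
  obtain s where fm [measurable]: "f \<in> borel_measurable M"
    and s: "\<And>i. Bochner_Integration.simple_bochner_integrable M (s i)"
      "(\<lambda>i. \<integral>\<^sup>+x. ennreal (norm (f x - s i x)) \<partial>M) \<longlonglongrightarrow> 0"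
      "(\<lambda>i. Bochner_Integration.simple_bochner_integral M (s i)) \<longlonglongrightarrow> I"
    using f by (auto simp: has_bochner_integral_in_def)
  have Ls: "Bochner_Integration.simple_bochner_integrable M (\<lambda>x. L (s i x))" for i
    using simple_bochner_integrable_compose2[of "\<lambda>y _. L y" M "s i" "s i"] s(1) L.zero by simp
  obtain K where K: "K > 0" "\<And>y. norm (L y) \<le> norm y * K" using L.pos_bounded by auto
  show ?thesis
  proof (rule has_bochner_integral.intros)
    show "(\<lambda>x. L (f x)) \<in> borel_measurable M" by measurable
    show "(\<lambda>i. \<integral>\<^sup>+x. ennreal (norm (L (f x) - L (s i x))) \<partial>M) \<longlonglongrightarrow> 0"
    proof (rule tendsto_0_ennreal_bound[OF _ s(2) tendsto_const])
      fix i
      have [measurable]: "(\<lambda>x. L (s i x)) \<in> borel_measurable M"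
        using Ls[of i] by (auto intro: borel_measurable_simple_function elim: simple_bochner_integrable.cases)
      have "(\<integral>\<^sup>+x. ennreal (norm (L (f x) - L (s i x))) \<partial>M)
          = (\<integral>\<^sup>+x. ennreal K * ennreal (norm (L (f x) - L (s i x)) / K) \<partial>M)"
        using K by (intro nn_integral_cong) (simp flip: ennreal_mult)
      also have "\<dots> = ennreal K * (\<integral>\<^sup>+x. ennreal (norm (L (f x) - L (s i x)) / K) \<partial>M)"
        by (intro nn_integral_cmult) measurable
      also have "\<dots> \<le> ennreal K * (\<integral>\<^sup>+x. ennreal (norm (f x - s i x)) \<partial>M)"
        using K by (intro mult_left_mono nn_integral_mono ennreal_leI) (auto simp: L.diff[symmetric] pos_divide_le_eq)
      finally show "(\<integral>\<^sup>+x. ennreal (norm (L (f x) - L (s i x))) \<partial>M)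
          \<le> ennreal K * (\<integral>\<^sup>+x. ennreal (norm (f x - s i x)) \<partial>M) + 0 * 0" by simp
    qed auto
    show "(\<lambda>i. Bochner_Integration.simple_bochner_integral M (\<lambda>x. L (s i x))) \<longlonglongrightarrow> L I"
      using L.tendsto[OF s(3)] by (simp add: simple_bochner_integral_linear[OF L.linear_axioms s(1)])
  qed (rule Ls)
qed

lemma integral_tendsto_left:
  fixes \<phi> :: "real \<Rightarrow> real"
  assumes A: "has_bochner_integral (restrict_space lborel {0..t}) \<phi> A"
    and a: "\<And>n. has_bochner_integral (restrict_space lborel {0..r n}) \<phi> (a n)"
    and r: "r \<longlonglongrightarrow> t" "\<And>n. r n < t"
  shows "a \<longlonglongrightarrow> A"
proof -
  have A': "has_bochner_integral lborel (\<lambda>s. indicator {0..t} s * \<phi> s) A"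
    using A by (subst (asm) has_bochner_integral_restrict_space) auto
  have a': "has_bochner_integral lborel (\<lambda>s. indicator {0..r n} s * \<phi> s) (a n)" for n
    using a[of n] by (subst (asm) has_bochner_integral_restrict_space) auto
  have "(\<lambda>n. integral\<^sup>L lborel (\<lambda>s. indicator {0..r n} s * \<phi> s)) \<longlonglongrightarrow> integral\<^sup>L lborel (\<lambda>s. indicator {0..t} s * \<phi> s)"
  proof (rule integral_dominated_convergence)
    show "integrable lborel (\<lambda>s. norm (indicator {0..t} s * \<phi> s))"
      using A' by (auto simp: has_bochner_integral_iff)
    show "AE s in lborel. (\<lambda>n. indicator {0..r n} s * \<phi> s) \<longlonglongrightarrow> indicator {0..t} s * \<phi> s"
      using AE_lborel_singleton[of t]
    proof eventually_elim
      case (elim s)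
      have "eventually (\<lambda>n. (indicator {0..r n} s :: real) = indicator {0..t} s) sequentially"
      proof (cases "s < t")
        case True
        then have "eventually (\<lambda>n. s < r n) sequentially" using r(1) by (intro order_tendstoD)
        then show ?thesis by eventually_elim (use True in \<open>auto simp: indicator_def\<close>)
      next
        case False
        then have "\<not> s \<le> t" "\<not> s \<le> r n" for n using elim r(2)[of n] by auto
        then show ?thesis by (simp add: indicator_def)
      qed
      then show ?case by (intro tendsto_mult tendsto_const tendsto_eventually)
    qed
    show "AE s in lborel. norm (indicator {0..r n} s * \<phi> s) \<le> norm (indicator {0..t} s * \<phi> s)" for n
      using r(2)[of n] by (intro AE_I2) (auto simp: indicator_def)
    show "(\<lambda>s. indicator {0..t} s * \<phi> s) \<in> borel_measurable lborel"
      "(\<lambda>s. indicator {0..r n} s * \<phi> s) \<in> borel_measurable lborel" for n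
      using A' a'[of n] by (auto simp only: has_bochner_integral_iff intro!: borel_measurable_integrable)
  qed
  then show ?thesis using A' a' by (simp add: has_bochner_integral_iff)
qed

lemma left_lim_eq:
  fixes f :: "real \<Rightarrow> 'a::t2_space"
  shows "0 < t \<Longrightarrow> (f \<longlongrightarrow> l) (at_left t) \<Longrightarrow> left_lim f t = l"
  unfolding left_lim_def by (simp add: tendsto_Lim)

lemma cadlag_left_lim:
  fixes f :: "real \<Rightarrow> 'a::t2_space"
  assumes "cadlag f" "0 < t"
  shows "(f \<longlongrightarrow> left_lim f t) (at_left t)"
proof -
  obtain l where "(f \<longlongrightarrow> l) (at_left t)" using assms by (auto simp: cadlag_def)
  then show ?thesis using left_lim_eq[OF assms(2), of f l] by simp
qed

text \<open>
  A left limit is the limit along grid points strictly before the given time.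
\<close>

lemma left_lim_measurable:
  fixes f :: "real \<Rightarrow> 'a::metric_space"
  assumes f: "cadlag f"
  shows "left_lim f \<in> borel_measurable borel"
proof (rule borel_measurable_LIMSEQ_metric)
  define u where "u n s = (of_int \<lceil>s * real (Suc n)\<rceil> - 1) / real (Suc n)" for n and s :: real
  let ?g = "\<lambda>n s. if s \<le> 0 then f 0 else f (u n s)"
  show "?g n \<in> borel_measurable borel" for n
  proof (rule measurable_If)
    have "(\<lambda>s::real. \<lceil>s * real (Suc n)\<rceil>) \<in> measurable borel (count_space UNIV)" by measurable
    then show "(\<lambda>s. f (u n s)) \<in> borel_measurable borel"
      unfolding u_def by (rule measurable_compose) simp
  qed auto
  show "(\<lambda>n. ?g n s) \<longlonglongrightarrow> left_lim f s" if "s \<in> space borel" for s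
  proof (cases "s \<le> 0")
    case True then show ?thesis by (simp add: left_lim_def)
  next
    case False
    have lt: "u n s < s" for n
    proof -
      have "of_int \<lceil>s * real (Suc n)\<rceil> - 1 < s * real (Suc n)" by linarith
      then show ?thesis by (simp add: u_def pos_divide_less_eq del: of_nat_Suc)
    qed
    have ge: "s - 1 / real (Suc n) \<le> u n s" for n
    proof -
      have "s * real (Suc n) - 1 \<le> of_int \<lceil>s * real (Suc n)\<rceil> - 1" by linarith
      then have "(s * real (Suc n) - 1) / real (Suc n) \<le> u n s"
        unfolding u_def by (rule divide_right_mono) simp
      then show ?thesis by (simp add: diff_divide_distrib del: of_nat_Suc)
    qed
    have ul: "(\<lambda>n. u n s) \<longlonglongrightarrow> s"
    proof (rule tendsto_sandwich)
      show "(\<lambda>n. s - 1 / real (Suc n)) \<longlonglongrightarrow> s"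
        using tendsto_diff[OF tendsto_const LIMSEQ_inverse_real_of_nat, of s] by (simp add: inverse_eq_divide)
      show "\<forall>\<^sub>F n in sequentially. s - 1 / real (Suc n) \<le> u n s" using ge by (intro always_eventually allI)
      show "\<forall>\<^sub>F n in sequentially. u n s \<le> s" using less_imp_le[OF lt] by (intro always_eventually allI)
    qed simp
    have "0 < s" using False by simp
    then have "(\<lambda>n. f (u n s)) \<longlonglongrightarrow> left_lim f s"
      by (rule tendsto_left_seq[OF cadlag_left_lim[OF f] ul lt])
    then show ?thesis using False by simp
  qed
qed

context poisson_random_measure
begin

text \<open>
  Up to time \<open>T\<close> the localizing times no longer matter once they exceed \<open>T\<close>.
\<close>

lemma compensated_integral_jump:
  fixes f :: "real \<Rightarrow> 'w \<Rightarrow> 'z \<Rightarrow> 'h::{real_inner, banach, second_countable_topology}"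
  assumes I: "compensated_integral M F \<nu> N f I" and G: "G \<in> fmeasurable \<nu>" and T: "0 < T"
  shows "AE \<omega> in M. \<forall>t\<in>{0<..T}. \<forall>l. ((\<lambda>r. I r \<omega>) \<longlongrightarrow> l) (at_left t) \<longrightarrow> emeasure (N \<omega>) (G \<times> {t}) = 1 \<longrightarrow>
    set_integrable (N \<omega>) (G \<times> {t}) (\<lambda>p. f (snd p) \<omega> (fst p)) \<and>
    I t \<omega> - l = (LINT p:G \<times> {t}|N \<omega>. f (snd p) \<omega> (fst p))"
proof -
  obtain \<tau> :: "nat \<Rightarrow> 'w \<Rightarrow> real" where
    \<tau>: "AE \<omega> in M. incseq (\<lambda>k. \<tau> k \<omega>) \<and> filterlim (\<lambda>k. \<tau> k \<omega>) at_top sequentially"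
    and L2: "\<And>k. compensated_integral_L2 M F \<nu> N
               (\<lambda>s \<omega> z. indicator {..\<tau> k \<omega>} s *\<^sub>R f s \<omega> z) (\<lambda>t \<omega>. I (min t (\<tau> k \<omega>)) \<omega>)"
    using I unfolding compensated_integral_def by (elim conjE exE) simp
  have "AE \<omega> in M. \<forall>k. \<forall>t\<in>{0<..T}. \<forall>l. ((\<lambda>r. I (min r (\<tau> k \<omega>)) \<omega>) \<longlongrightarrow> l) (at_left t) \<longrightarrow> emeasure (N \<omega>) (G \<times> {t}) = 1 \<longrightarrow>
    set_integrable (N \<omega>) (G \<times> {t}) (\<lambda>p. indicator {..\<tau> k \<omega>} (snd p) *\<^sub>R f (snd p) \<omega> (fst p)) \<and>
    I (min t (\<tau> k \<omega>)) \<omega> - l = (LINT p:G \<times> {t}|N \<omega>. indicator {..\<tau> k \<omega>} (snd p) *\<^sub>R f (snd p) \<omega> (fst p))"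
    unfolding AE_all_countable using L2_integral_jump[OF L2 G T] by simp
  then show ?thesis using \<tau> AE_space
  proof eventually_elim
    case (elim \<omega>)
    have "eventually (\<lambda>k. T \<le> \<tau> k \<omega>) sequentially" using elim(2) by (auto simp: filterlim_at_top)
    then obtain k where k: "T \<le> \<tau> k \<omega>" by (auto simp: eventually_sequentially)
    show ?case
    proof (intro ballI allI impI)
      fix t l assume t: "t \<in> {0<..T}" and l: "((\<lambda>r. I r \<omega>) \<longlongrightarrow> l) (at_left t)"
        and jump: "emeasure (N \<omega>) (G \<times> {t}) = 1"
      have "eventually (\<lambda>r. r < t) (at_left t)" by (simp add: eventually_at_filter)
      then have "eventually (\<lambda>r. I (min r (\<tau> k \<omega>)) \<omega> = I r \<omega>) (at_left t)"
        by eventually_elim (use t k in \<open>simp add: min_def\<close>)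
      then have l': "((\<lambda>r. I (min r (\<tau> k \<omega>)) \<omega>) \<longlongrightarrow> l) (at_left t)"
        using l by (simp add: tendsto_cong)
      have S: "G \<times> {t} \<in> sets (N \<omega>)"
        using slice_sets[of G t] G t sets_N[OF elim(3)] by (auto simp: fmeasurable_def)
      have eq: "(\<lambda>p. indicator (G \<times> {t}) p *\<^sub>R (indicator {..\<tau> k \<omega>} (snd p) *\<^sub>R f (snd p) \<omega> (fst p)))
          = (\<lambda>p. indicator (G \<times> {t}) p *\<^sub>R f (snd p) \<omega> (fst p))"
        using t k by (auto simp: indicator_def)
      have m: "min t (\<tau> k \<omega>) = t" using t k by (simp add: min_def)
      show "set_integrable (N \<omega>) (G \<times> {t}) (\<lambda>p. f (snd p) \<omega> (fst p)) \<and>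
        I t \<omega> - l = (LINT p:G \<times> {t}|N \<omega>. f (snd p) \<omega> (fst p))"
        using elim(1)[rule_format, OF t l' jump] unfolding set_integrable_def set_lebesgue_integral_def eq m .
    qed
  qed
qed

end

context levy_spde
begin

text \<open>
  A solution jumps by the coefficient at the left limit. The jump is written as an integral over the
  atom: on a mark space that is not separable, a measure of mass one with integer values need not sit at a single
  mark. Among the terms of the equation, the drift has no jump, the integral over \<open>Zs 1\<close> is treated path by path,
  and the compensated integral by \<open>compensated_integral_jump\<close>. Testing against V loses nothing because V is dense.
\<close>

lemma solution_jump:
  assumes sol: "is_solution \<iota> M F \<nu> N Zs \<A> \<sigma> x Y" and G: "G \<in> fmeasurable \<nu>" and T: "0 < T"
  shows "AE \<omega> in M. \<forall>t\<in>{0<..T}. emeasure (N \<omega>) (G \<times> {t}) \<noteq> 0 \<longrightarrow>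
    emeasure (N \<omega>) (G \<times> {t}) = 1 \<and>
    set_integrable (N \<omega>) (G \<times> {t}) (\<lambda>p. \<sigma> (left_lim (\<lambda>r. Y r \<omega>) t) (fst p)) \<and>
    Y t \<omega> = left_lim (\<lambda>r. Y r \<omega>) t + (LINT p:G \<times> {t}|N \<omega>. \<sigma> (left_lim (\<lambda>r. Y r \<omega>) t) (fst p))"
proof -
  let ?Z = "Zs 1"
  define f where "f s \<omega> z = indicator (- ?Z) z *\<^sub>R \<sigma> (left_lim (\<lambda>r. Y r \<omega>) s) z" for s \<omega> z
  define \<kappa> where "\<kappa> \<omega> p = \<sigma> (left_lim (\<lambda>r. Y r \<omega>) (snd p)) (fst p)" for \<omega> and p :: "'z \<times> real"
  obtain J where J: "compensated_integral M F \<nu> N f J"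
    and eqn: "AE \<omega> in M. \<forall>t\<ge>0. \<exists>a.
             has_bochner_integral_in (restrict_space lborel {0..t}) (\<lambda>s. on_V \<iota> \<A> (Y s \<omega>)) a \<and>
             to_dual \<iota> (Y t \<omega>) = to_dual \<iota> x + a + to_dual \<iota> (J t \<omega>)
               + to_dual \<iota> (LINT p:?Z \<times> {0<..t}|N \<omega>. \<kappa> \<omega> p)"
    using sol unfolding is_solution_def f_def \<kappa>_def by blast
  have cY: "cadlag_adapted M F Y" using sol by (simp add: is_solution_def)
  have cJ: "cadlag_adapted M F J" using J by (simp add: compensated_integral_def)
  have fin: "AE \<omega> in M. \<forall>t\<ge>0. (\<integral>\<^sup>+p\<in>?Z \<times> {0<..t}. ennreal (norm (\<kappa> \<omega> p)) \<partial>N \<omega>) < \<infinity>"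
  proof -
    have "AE \<omega> in M. \<forall>t\<ge>0.
        (\<integral>\<^sup>+s\<in>{0..t}. ennreal (norm (on_V \<iota> \<A> (Y s \<omega>))) \<partial>lborel)
        + (\<integral>\<^sup>+s\<in>{0..t}. (\<integral>\<^sup>+z\<in>- ?Z. ennreal ((norm (\<sigma> (Y s \<omega>) z))\<^sup>2) \<partial>\<nu>) \<partial>lborel)
        + (\<integral>\<^sup>+p\<in>?Z \<times> {0<..t}. ennreal (norm (\<kappa> \<omega> p)) \<partial>N \<omega>) < \<infinity>"
      using sol unfolding is_solution_def \<kappa>_def by blast
    then show ?thesis
      by eventually_elim (auto intro: le_less_trans[OF add_increasing[OF zero_le order_refl]])
  qed
  have Z: "?Z \<in> fmeasurable \<nu>" using Zs_borel Zs_finite by (auto simp: fmeasurable_def sets_\<nu>)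
  then have Zs: "?Z \<in> sets \<nu>" by (simp add: fmeasurable_def)
  have Gs: "G \<in> sets \<nu>" using G by (simp add: fmeasurable_def)
  have ZG: "?Z - G \<in> fmeasurable \<nu>" using Z G by (intro fmeasurable.Diff) auto
  have nocommon: "AE \<omega> in M. \<forall>t\<in>{0<..T}. emeasure (N \<omega>) ((?Z - G) \<times> {t}) = 0 \<or> emeasure (N \<omega>) (G \<times> {t}) = 0"
    by (rule AE_no_common_jumps[OF ZG G _ T]) auto
  show ?thesis using eqn fin nocommon AE_single_jumps[OF G T] compensated_integral_jump[OF J G T] AE_space
  proof eventually_elim
    case (elim \<omega>)
    show ?case
    proof (intro ballI impI)
      fix t assume t: "t \<in> {0<..T}" and "emeasure (N \<omega>) (G \<times> {t}) \<noteq> 0"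
      then have jump: "emeasure (N \<omega>) (G \<times> {t}) = 1" and off: "emeasure (N \<omega>) ((?Z - G) \<times> {t}) = 0"
        using elim(3,4) by auto
      have t0: "0 < t" using t by simp
      let ?S = "G \<times> {t}"
      let ?y = "left_lim (\<lambda>r. Y r \<omega>) t" and ?j = "left_lim (\<lambda>r. J r \<omega>) t"
      have cadY: "cadlag (\<lambda>r. Y r \<omega>)" and cadJ: "cadlag (\<lambda>r. J r \<omega>)"
        using cY cJ elim(6) by (auto simp: cadlag_adapted_def)
      note Yl = cadlag_left_lim[OF cadY t0] and Jl = cadlag_left_lim[OF cadJ t0]
      have \<kappa>\<Lambda>: "\<kappa> \<omega> \<in> borel_measurable \<Lambda>"
      proof -
        have s: "snd \<in> measurable \<Lambda> (borel :: real measure)"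
        proof -
          have "(\<lambda>x. x) \<in> measurable (restrict_space lborel {0::real..}) borel"
            by (simp add: measurable_restrict_space1)
          then show ?thesis unfolding mark_time_def by (rule measurable_compose[OF measurable_snd])
        qed
        have z: "fst \<in> measurable \<Lambda> (borel :: 'z measure)"
        proof -
          have "fst \<in> measurable \<Lambda> \<nu>" unfolding mark_time_def by simp
          then show ?thesis using measurable_cong_sets[OF refl sets_\<nu>, of \<Lambda>] by auto
        qed
        have "(\<lambda>p. (left_lim (\<lambda>r. Y r \<omega>) (snd p), fst p)) \<in> measurable \<Lambda> (borel \<Otimes>\<^sub>M borel)"
          using measurable_compose[OF s left_lim_measurable[OF cadY]] z by (intro measurable_Pair) auto
        from measurable_compose[OF this \<sigma>_borel] show ?thesis unfolding \<kappa>_def[abs_def] by simp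
      qed
      have \<kappa>m: "\<kappa> \<omega> \<in> borel_measurable (N \<omega>)"
      proof -
        have "borel_measurable (N \<omega>) = (borel_measurable \<Lambda> :: (_ \<Rightarrow> 'h) set)"
          by (intro measurable_cong_sets sets_N[OF elim(6)] refl)
        then show ?thesis using \<kappa>\<Lambda> by simp
      qed
      have box: "B \<times> I \<in> sets (N \<omega>)" if "B \<in> sets \<nu>" "I \<in> sets borel" "I \<subseteq> {0..}" for B I
        using box_sets[OF that] sets_N[OF elim(6)] by simp
      have Kint: "set_integrable (N \<omega>) (?Z \<times> {0<..t}) (\<kappa> \<omega>)"
        unfolding set_integrable_def
      proof (rule integrableI_bounded)
        have "?Z \<times> {0<..t} \<in> sets (N \<omega>)" using Zs by (intro box) auto
        then show "(\<lambda>p. indicator (?Z \<times> {0<..t}) p *\<^sub>R \<kappa> \<omega> p) \<in> borel_measurable (N \<omega>)" using \<kappa>m by auto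
        have "(\<integral>\<^sup>+p. ennreal (norm (indicator (?Z \<times> {0<..t}) p *\<^sub>R \<kappa> \<omega> p)) \<partial>N \<omega>)
            = (\<integral>\<^sup>+p\<in>?Z \<times> {0<..t}. ennreal (norm (\<kappa> \<omega> p)) \<partial>N \<omega>)"
          by (intro nn_integral_cong) (auto simp: indicator_def)
        then show "(\<integral>\<^sup>+p. ennreal (norm (indicator (?Z \<times> {0<..t}) p *\<^sub>R \<kappa> \<omega> p)) \<partial>N \<omega>) < \<infinity>"
          using elim(2) t0 by auto
      qed
      have sub: "set_integrable (N \<omega>) (?Z \<times> I) (\<kappa> \<omega>)" if "I \<in> sets borel" "I \<subseteq> {0<..t}" for I
        using that Zs by (intro set_integrable_subset[OF Kint] box) auto
      have Zm: "(\<lambda>p. indicator (?Z \<times> I) p *\<^sub>R \<kappa> \<omega> p) \<in> borel_measurable (N \<omega>)"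
        if "I \<in> sets borel" "I \<subseteq> {0..}" for I
        using box[OF Zs that] \<kappa>m by simp
      have open_sub: "{0<..<t} \<subseteq> {0<..t}" by auto
      \<comment> \<open>The equation at the times \<open>r n\<close>, in the limit, is subtracted from the one at \<open>t\<close>.\<close>
      define r where "r n = t - t * (1 / real (Suc n))" for n
      have r_lt: "r n < t" for n using t0 by (simp add: r_def)
      have r0: "0 \<le> r n" for n
      proof -
        have "t * (1 / real (Suc n)) \<le> t * 1" using t0 by (intro mult_left_mono) auto
        then show ?thesis by (simp add: r_def)
      qed
      have r_lim: "r \<longlonglongrightarrow> t"
        using tendsto_diff[OF tendsto_const tendsto_mult[OF tendsto_const LIMSEQ_inverse_real_of_nat], of t t]
        unfolding r_def by (simp add: inverse_eq_divide)
      let ?K = "\<lambda>I. LINT p:?Z \<times> I|N \<omega>. \<kappa> \<omega> p"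
      have Klim: "(\<lambda>n. ?K {0<..r n}) \<longlonglongrightarrow> ?K {0<..<t}"
        unfolding set_lebesgue_integral_def
      proof (rule integral_dominated_convergence)
        show "integrable (N \<omega>) (\<lambda>p. norm (indicator (?Z \<times> {0<..t}) p *\<^sub>R \<kappa> \<omega> p))"
          using integrable_norm[OF Kint[unfolded set_integrable_def]] .
        show "AE p in N \<omega>. (\<lambda>n. indicator (?Z \<times> {0<..r n}) p *\<^sub>R \<kappa> \<omega> p) \<longlonglongrightarrow> indicator (?Z \<times> {0<..<t}) p *\<^sub>R \<kappa> \<omega> p"
        proof (intro AE_I2)
          fix p :: "'z \<times> real"
          have "eventually (\<lambda>n. (indicator (?Z \<times> {0<..r n}) p :: real) = indicator (?Z \<times> {0<..<t}) p) sequentially"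
          proof (cases "snd p < t")
            case True
            then have "eventually (\<lambda>n. snd p < r n) sequentially" using r_lim by (intro order_tendstoD)
            then show ?thesis by eventually_elim (use True in \<open>auto simp: indicator_def mem_Times_iff\<close>)
          next
            case False
            then have "\<not> snd p \<le> r n" for n using r_lt[of n] by auto
            then show ?thesis using False by (auto simp: indicator_def mem_Times_iff)
          qed
          then show "(\<lambda>n. indicator (?Z \<times> {0<..r n}) p *\<^sub>R \<kappa> \<omega> p) \<longlonglongrightarrow> indicator (?Z \<times> {0<..<t}) p *\<^sub>R \<kappa> \<omega> p"
            by (intro tendsto_scaleR tendsto_const tendsto_eventually)
        qed
        show "AE p in N \<omega>. norm (indicator (?Z \<times> {0<..r n}) p *\<^sub>R \<kappa> \<omega> p) \<le> norm (indicator (?Z \<times> {0<..t}) p *\<^sub>R \<kappa> \<omega> p)" for n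
        proof (intro AE_I2)
          fix p :: "'z \<times> real"
          show "norm (indicator (?Z \<times> {0<..r n}) p *\<^sub>R \<kappa> \<omega> p) \<le> norm (indicator (?Z \<times> {0<..t}) p *\<^sub>R \<kappa> \<omega> p)"
            using r_lt[of n] by (cases p) (auto simp: indicator_def)
        qed
        show "(\<lambda>p. indicator (?Z \<times> {0<..<t}) p *\<^sub>R \<kappa> \<omega> p) \<in> borel_measurable (N \<omega>)"
          "(\<lambda>p. indicator (?Z \<times> {0<..r n}) p *\<^sub>R \<kappa> \<omega> p) \<in> borel_measurable (N \<omega>)" for n
          by (intro Zm; auto)+
      qed
      have Ksplit: "?K {0<..t} = ?K {0<..<t} + ?K {t}"
      proof -
        have "?Z \<times> {0<..t} = (?Z \<times> {0<..<t}) \<union> (?Z \<times> {t})" using t0 by auto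
        then show ?thesis using sub[OF _ open_sub] sub[of "{t}"] t0
          by (subst set_integral_Un[symmetric]) auto
      qed
      have sS: "?S \<in> sets (N \<omega>)" "(?Z - G) \<times> {t} \<in> sets (N \<omega>)"
        using Gs Zs t0 by (auto intro!: box)
      \<comment> \<open>The marks of \<open>G\<close> in \<open>?Z\<close> enter through \<open>?K\<close>, the others through \<open>J\<close>, whose integrand
        vanishes on \<open>?Z\<close>.\<close>
      have Kt: "?K {t} = (LINT p:?S|N \<omega>. indicator ?Z (fst p) *\<^sub>R \<kappa> \<omega> p)"
        and Kti: "set_integrable (N \<omega>) ?S (\<lambda>p. indicator ?Z (fst p) *\<^sub>R \<kappa> \<omega> p)"
      proof -
        have "AE p in N \<omega>. p \<notin> (?Z - G) \<times> {t}"
          using sS off by (intro AE_not_in) (auto simp: null_sets_def)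
        then have ae: "AE p in N \<omega>. indicator (?Z \<times> {t}) p *\<^sub>R \<kappa> \<omega> p = indicator ?S p *\<^sub>R (indicator ?Z (fst p) *\<^sub>R \<kappa> \<omega> p)"
          by eventually_elim (auto simp: indicator_def)
        have m: "(\<lambda>p. indicator (?Z \<times> {t}) p *\<^sub>R \<kappa> \<omega> p) \<in> borel_measurable (N \<omega>)"
          using sub[of "{t}"] t0 by (auto simp: set_integrable_def)
        have "(?Z \<inter> G) \<times> {t} \<in> sets (N \<omega>)" using Gs Zs t0 by (intro box) auto
        then have "(\<lambda>p. indicator ((?Z \<inter> G) \<times> {t}) p *\<^sub>R \<kappa> \<omega> p) \<in> borel_measurable (N \<omega>)" using \<kappa>m by auto
        moreover have "(\<lambda>p. indicator ((?Z \<inter> G) \<times> {t}) p *\<^sub>R \<kappa> \<omega> p) = (\<lambda>p. indicator ?S p *\<^sub>R (indicator ?Z (fst p) *\<^sub>R \<kappa> \<omega> p))"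
          by (auto simp: indicator_def)
        ultimately have m': "(\<lambda>p. indicator ?S p *\<^sub>R (indicator ?Z (fst p) *\<^sub>R \<kappa> \<omega> p)) \<in> borel_measurable (N \<omega>)" by simp
        show "?K {t} = (LINT p:?S|N \<omega>. indicator ?Z (fst p) *\<^sub>R \<kappa> \<omega> p)"
          unfolding set_lebesgue_integral_def by (rule integral_cong_AE[OF m m' ae])
        show "set_integrable (N \<omega>) ?S (\<lambda>p. indicator ?Z (fst p) *\<^sub>R \<kappa> \<omega> p)"
          using integrable_cong_AE[OF m m' ae] sub[of "{t}"] t0 by (simp add: set_integrable_def)
      qed
      have Jt: "set_integrable (N \<omega>) ?S (\<lambda>p. f (snd p) \<omega> (fst p))"
        "J t \<omega> - ?j = (LINT p:?S|N \<omega>. f (snd p) \<omega> (fst p))"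
        using elim(5)[rule_format, OF t Jl jump] by auto
      have sum: "(\<lambda>p. f (snd p) \<omega> (fst p) + indicator ?Z (fst p) *\<^sub>R \<kappa> \<omega> p) = \<kappa> \<omega>"
        by (auto simp: f_def \<kappa>_def indicator_def)
      have \<kappa>S: "set_integrable (N \<omega>) ?S (\<kappa> \<omega>)"
        "(J t \<omega> - ?j) + ?K {t} = (LINT p:?S|N \<omega>. \<kappa> \<omega> p)"
        using set_integral_add[OF Jt(1) Kti] unfolding sum Jt(2) Kt by auto
      \<comment> \<open>Paired with an element of V, the drift becomes a scalar integral, continuous in its upper
        limit.\<close>
      have "(Y t \<omega> - ?y) - (J t \<omega> - ?j) - ?K {t} = 0" (is "?D = 0")
      proof -
        have zero: "?D \<bullet> \<iota> v = 0" for v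
        proof -
          obtain a where a: "\<And>s. 0 \<le> s \<Longrightarrow> has_bochner_integral_in (restrict_space lborel {0..s}) (\<lambda>s. on_V \<iota> \<A> (Y s \<omega>)) (a s)"
            "\<And>s. 0 \<le> s \<Longrightarrow> to_dual \<iota> (Y s \<omega>) = to_dual \<iota> x + a s + to_dual \<iota> (J s \<omega>) + to_dual \<iota> (?K {0<..s})"
            using elim(1) by metis
          have av: "has_bochner_integral (restrict_space lborel {0..s}) (\<lambda>s. blinfun_apply (on_V \<iota> \<A> (Y s \<omega>)) v) (blinfun_apply (a s) v)"
            if "0 \<le> s" for s
            by (rule has_bochner_integral_in_functional[OF a(1)[OF that]]) (rule blinfun.bounded_linear_left)
          have ae: "blinfun_apply (a s) v = (Y s \<omega> - x - J s \<omega> - ?K {0<..s}) \<bullet> \<iota> v" if "0 \<le> s" for s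
          proof -
            have "blinfun_apply (to_dual \<iota> h) v = h \<bullet> \<iota> v" for h
              by (simp add: to_dual_def inner_commute)
            then show ?thesis using arg_cong[OF a(2)[OF that], of "\<lambda>b. blinfun_apply b v"]
              by (simp add: blinfun.add_left inner_diff_left)
          qed
          have "(\<lambda>n. blinfun_apply (a (r n)) v) \<longlonglongrightarrow> blinfun_apply (a t) v"
            using t0 by (intro integral_tendsto_left[OF av av r_lim r_lt] r0) auto
          moreover have "(\<lambda>n. blinfun_apply (a (r n)) v) \<longlonglongrightarrow> (?y - x - ?j - ?K {0<..<t}) \<bullet> \<iota> v"
            unfolding ae[OF r0]
            by (intro tendsto_inner tendsto_diff tendsto_const Klim tendsto_left_seq[OF Yl r_lim r_lt]
                tendsto_left_seq[OF Jl r_lim r_lt])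
          ultimately have "(?y - x - ?j - ?K {0<..<t}) \<bullet> \<iota> v = (Y t \<omega> - x - J t \<omega> - ?K {0<..t}) \<bullet> \<iota> v"
            using LIMSEQ_unique ae[of t] t0 by fastforce
          then show ?thesis unfolding Ksplit by (simp add: inner_diff_left inner_add_left)
        qed
        have "closed {h. ?D \<bullet> h = 0}" by (intro closed_Collect_eq continuous_intros)
        moreover have "range (blinfun_apply \<iota>) \<subseteq> {h. ?D \<bullet> h = 0}" using zero by auto
        ultimately have "UNIV \<subseteq> {h. ?D \<bullet> h = 0}"
          using closure_minimal[of "range (blinfun_apply \<iota>)"] dense_embedding by auto
        then have "?D \<bullet> ?D = 0" by blast
        then show ?thesis by simp
      qed
      then have Yt: "Y t \<omega> = ?y + (LINT p:?S|N \<omega>. \<kappa> \<omega> p)" unfolding \<kappa>S(2)[symmetric] by (simp add: algebra_simps)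
      have eq: "(\<lambda>p. indicator ?S p *\<^sub>R \<kappa> \<omega> p) = (\<lambda>p. indicator ?S p *\<^sub>R \<sigma> ?y (fst p))"
        by (auto simp: \<kappa>_def indicator_def)
      show "emeasure (N \<omega>) (G \<times> {t}) = 1 \<and>
        set_integrable (N \<omega>) (G \<times> {t}) (\<lambda>p. \<sigma> (left_lim (\<lambda>r. Y r \<omega>) t) (fst p)) \<and>
        Y t \<omega> = left_lim (\<lambda>r. Y r \<omega>) t + (LINT p:G \<times> {t}|N \<omega>. \<sigma> (left_lim (\<lambda>r. Y r \<omega>) t) (fst p))"
        using jump \<kappa>S(1) Yt unfolding set_integrable_def set_lebesgue_integral_def eq by simp
    qed
  qed
qed

end

section \<open>From ball to ball\<close>

text \<open>
  Balls are convex, and averaging with mass one keeps the strict inequality. This is how the jump,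
  written as an integral over the atom, is located.
\<close>

lemma mean_in_ball:
  fixes h :: "'a \<Rightarrow> 'b::{banach, second_countable_topology}"
  assumes S: "S \<in> sets \<mu>" "emeasure \<mu> S = 1" and h: "set_integrable \<mu> S h"
    and ball: "\<And>p. p \<in> S \<Longrightarrow> q + h p \<in> ball c \<rho>"
  shows "q + (LINT p:S|\<mu>. h p) \<in> ball c \<rho>"
proof -
  have mS: "measure \<mu> S = 1" using S by (simp add: measure_def)
  have ci: "set_integrable \<mu> S (\<lambda>_. q - c)"
    unfolding set_integrable_def using S by (intro integrable_scaleR_left) auto
  have "(LINT p:S|\<mu>. q - c) = q - c"
    using S mS sets.sets_into_space[OF S(1)]
    unfolding set_lebesgue_integral_def by (subst integral_scaleR_left) (auto simp: Int_absorb2)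
  then have eq: "q + (LINT p:S|\<mu>. h p) - c = (LINT p:S|\<mu>. (q - c) + h p)"
    using set_integral_add(2)[OF ci h] by simp
  have gi: "set_integrable \<mu> S (\<lambda>p. (q - c) + h p)" using set_integral_add(1)[OF ci h] .
  let ?n = "\<lambda>p. indicator S p * (\<rho> - norm ((q - c) + h p))"
  have ni: "integrable \<mu> (\<lambda>p. indicator S p * norm ((q - c) + h p))"
    using integrable_norm[OF gi[unfolded set_integrable_def]] by (simp add: indicator_def cong: if_cong)
  have ri: "integrable \<mu> (\<lambda>p. indicator S p * \<rho>)" using S by (intro integrable_mult_left) auto
  have split: "?n = (\<lambda>p. indicator S p * \<rho> - indicator S p * norm ((q - c) + h p))"
    by (auto simp: algebra_simps)
  have int: "integrable \<mu> ?n" unfolding split using ni ri by auto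
  have pos: "0 < \<rho> - norm ((q - c) + h p)" if "p \<in> S" for p
    using ball[OF that] by (simp add: dist_norm norm_minus_commute algebra_simps)
  have nn: "AE p in \<mu>. 0 \<le> ?n p"
    using pos by (auto simp: indicator_def intro!: AE_I2 less_imp_le)
  have "integral\<^sup>L \<mu> ?n \<noteq> 0"
  proof
    assume "integral\<^sup>L \<mu> ?n = 0"
    then have "AE p in \<mu>. ?n p = 0" using integral_nonneg_eq_0_iff_AE[OF int nn] by simp
    then have "AE p in \<mu>. p \<notin> S" by eventually_elim (use pos in \<open>force simp: indicator_def split: if_splits\<close>)
    then have "S \<in> null_sets \<mu>" using S(1) by (simp add: AE_iff_null_sets)
    then show False using S(2) by auto
  qed
  moreover have "0 \<le> integral\<^sup>L \<mu> ?n" using nn by (rule integral_nonneg_AE)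
  ultimately have "0 < integral\<^sup>L \<mu> ?n" by simp
  also have "integral\<^sup>L \<mu> ?n = \<rho> - integral\<^sup>L \<mu> (\<lambda>p. indicator S p * norm ((q - c) + h p))"
    unfolding split using ni ri S mS sets.sets_into_space[OF S(1)] by (simp add: Int_absorb2)
  finally have "integral\<^sup>L \<mu> (\<lambda>p. indicator S p * norm ((q - c) + h p)) < \<rho>" by simp
  moreover have "norm (LINT p:S|\<mu>. (q - c) + h p) \<le> integral\<^sup>L \<mu> (\<lambda>p. indicator S p * norm ((q - c) + h p))"
    unfolding set_lebesgue_integral_def
    using integral_norm_bound[of \<mu> "\<lambda>p. indicator S p *\<^sub>R ((q - c) + h p)"] by simp
  ultimately show ?thesis unfolding eq[symmetric] by (simp add: dist_norm norm_minus_commute)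
qed

text \<open>
  Otherwise the null balls would cover the space, and by the Lindelof property countably many of them would.
\<close>

lemma (in prob_space) support_point:
  fixes Y :: "'a \<Rightarrow> 'b::{metric_space, second_countable_topology}"
  assumes Y: "Y \<in> borel_measurable M"
  shows "\<exists>h. \<forall>\<rho>>0. 0 < prob {\<omega> \<in> space M. Y \<omega> \<in> ball h \<rho>}"
proof (rule ccontr)
  assume "\<not> ?thesis"
  then have ex: "\<exists>\<rho>>0. prob {\<omega> \<in> space M. Y \<omega> \<in> ball h \<rho>} = 0" for h
    by (metis measure_nonneg order_le_less)
  let ?F = "{ball h \<rho> | h \<rho>. \<rho> > 0 \<and> prob {\<omega> \<in> space M. Y \<omega> \<in> ball h \<rho>} = 0}"
  have "\<And>U. U \<in> ?F \<Longrightarrow> open U" by blast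
  then obtain F' where F': "F' \<subseteq> ?F" "countable F'" "\<Union>F' = \<Union>?F" using Lindelof[of ?F] by blast
  have "h \<in> \<Union>?F" for h
  proof -
    obtain \<rho> where "\<rho> > 0" "prob {\<omega> \<in> space M. Y \<omega> \<in> ball h \<rho>} = 0" using ex by blast
    then have "ball h \<rho> \<in> ?F" "h \<in> ball h \<rho>" by auto
    then show ?thesis by blast
  qed
  then have cover: "\<exists>U\<in>F'. h \<in> U" for h using F'(3) by blast
  have "(\<Union>U\<in>F'. {\<omega> \<in> space M. Y \<omega> \<in> U}) \<in> null_sets M"
  proof (rule null_sets_UN'[OF F'(2)])
    fix U assume "U \<in> F'"
    then obtain h \<rho> where U: "U = ball h \<rho>" "prob {\<omega> \<in> space M. Y \<omega> \<in> ball h \<rho>} = 0" using F'(1) by blast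
    have "{\<omega> \<in> space M. Y \<omega> \<in> ball h \<rho>} \<in> sets M"
      using measurable_sets[OF Y, of "ball h \<rho>"] by (simp add: vimage_def Int_def conj_commute)
    then show "{\<omega> \<in> space M. Y \<omega> \<in> U} \<in> null_sets M" using U by (simp add: null_sets_def emeasure_eq_measure)
  qed
  moreover have "(\<Union>U\<in>F'. {\<omega> \<in> space M. Y \<omega> \<in> U}) = space M" using cover by auto
  ultimately show False using emeasure_space_1 by auto
qed

context levy_spde
begin

text \<open>
  The heart of the argument. After time \<open>s\<close> the path stays in the ball for a while. If \<open>Dw \<omega>\<close> is the set of
  times up to \<open>T\<close> until which it has stayed, the number of jumps with mark in \<open>G\<close> during \<open>Dw \<omega>\<close> has mean
  \<open>\<nu> G\<close> times the mean length of \<open>Dw \<omega>\<close> by the compensation formula, and this is positive. So with positive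
  probability such a jump happens while the left limit is in the ball, and it leads to the target. Right-continuity
  replaces the random jump time by a fixed rational one.
\<close>

lemma reach_step:
  assumes sol: "is_solution \<iota> M F \<nu> N Zs \<A> \<sigma> x Y" and s: "0 \<le> s" and \<delta>: "0 < \<delta>"
    and G: "G \<in> fmeasurable \<nu>" "0 < emeasure \<nu> G"
    and img: "\<And>q k. q \<in> ball c \<rho> \<Longrightarrow> k \<in> G \<Longrightarrow> q + \<sigma> q k \<in> ball c' \<rho>'"
    and start: "0 < prob {\<omega> \<in> space M. Y s \<omega> \<in> ball c \<rho>}"
  shows "\<exists>u. s < u \<and> u < s + \<delta> \<and> 0 < prob {\<omega> \<in> space M. Y u \<omega> \<in> ball c' \<rho>'}"
proof (rule ccontr)
  assume contra: "\<not> ?thesis"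
  define T where "T = s + \<delta> / 2"
  have T: "0 < T" "s < T" using s \<delta> by (auto simp: T_def)
  have YF: "Y t \<in> borel_measurable (F t)" if "0 \<le> t" for t
    using sol that by (simp add: is_solution_def cadlag_adapted_def)
  have YM: "Y t \<in> borel_measurable M" if "0 \<le> t" for t using measurable_F_M[OF YF[OF that]] .
  have cad: "cadlag (\<lambda>r. Y r \<omega>)" if "\<omega> \<in> space M" for \<omega>
    using sol that by (simp add: is_solution_def cadlag_adapted_def)
  have Gs: "G \<in> sets \<nu>" using G by (simp add: fmeasurable_def)
  \<comment> \<open>A smaller ball: left limits of a path in it lie in its closure, which is inside the given one.\<close>
  obtain \<rho>0 where \<rho>0: "\<rho>0 < \<rho>" "0 < prob {\<omega> \<in> space M. Y s \<omega> \<in> ball c \<rho>0}"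
  proof (rule ccontr)
    assume "\<not> thesis"
    then have zero: "prob {\<omega> \<in> space M. Y s \<omega> \<in> ball c (\<rho> - 1 / real (Suc n))} = 0" for n
      using that[of "\<rho> - 1 / real (Suc n)"] by (auto simp: zero_less_measure_iff)
    have "{\<omega> \<in> space M. Y s \<omega> \<in> ball c (\<rho> - 1 / real (Suc n))} \<in> null_sets M" for n
      using zero[of n] YM[OF s] by (auto simp: null_sets_def emeasure_eq_measure)
    then have "(\<Union>n. {\<omega> \<in> space M. Y s \<omega> \<in> ball c (\<rho> - 1 / real (Suc n))}) \<in> null_sets M" by (rule null_sets_UN)
    moreover have "(\<Union>n. {\<omega> \<in> space M. Y s \<omega> \<in> ball c (\<rho> - 1 / real (Suc n))}) = {\<omega> \<in> space M. Y s \<omega> \<in> ball c \<rho>}"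
    proof (intro set_eqI iffI)
      fix \<omega> assume "\<omega> \<in> (\<Union>n. {\<omega> \<in> space M. Y s \<omega> \<in> ball c (\<rho> - 1 / real (Suc n))})"
      then obtain n where "\<omega> \<in> space M" "dist c (Y s \<omega>) < \<rho> - 1 / real (Suc n)" by auto
      moreover have "0 < 1 / real (Suc n)" by simp
      ultimately have "\<omega> \<in> space M" "dist c (Y s \<omega>) < \<rho>" by linarith+
      then show "\<omega> \<in> {\<omega> \<in> space M. Y s \<omega> \<in> ball c \<rho>}" by simp
    next
      fix \<omega> assume w: "\<omega> \<in> {\<omega> \<in> space M. Y s \<omega> \<in> ball c \<rho>}"
      then obtain n where "inverse (real (Suc n)) < \<rho> - dist c (Y s \<omega>)"
        using reals_Archimedean[of "\<rho> - dist c (Y s \<omega>)"] by auto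
      then have "\<omega> \<in> {\<omega> \<in> space M. Y s \<omega> \<in> ball c (\<rho> - 1 / real (Suc n))}" using w by (simp add: inverse_eq_divide)
      then show "\<omega> \<in> (\<Union>n. {\<omega> \<in> space M. Y s \<omega> \<in> ball c (\<rho> - 1 / real (Suc n))})" by blast
    qed
    ultimately show False using start by (simp add: measure_eq_0_null_sets)
  qed
  \<comment> \<open>\<open>(r, \<omega>) \<in> D\<close> for \<open>s < r \<le> T\<close> means that at all rational times of \<open>[s, r)\<close> the path is in the
    smaller closed ball. These times determine where the left limit at \<open>r\<close> is, and there are only countably
    many of them, so that \<open>D\<close> is predictable.\<close>
  define bad where "bad q = {\<omega> \<in> space M. Y q \<omega> \<notin> cball c \<rho>0}" for q
  define Qs where "Qs = \<rat> \<inter> {s..<T}"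
  define D where "D = {s<..T} \<times> space M - (\<Union>q\<in>Qs. {q<..T} \<times> bad q)"
  have Qs: "countable Qs" unfolding Qs_def using countable_rat by (rule countable_Int1)
  have Dp: "D \<in> sets (predictable M F)"
  proof -
    have rect: "{q<..T} \<times> A \<in> sets (predictable M F)" if "0 \<le> q" "q \<le> T" "A \<in> sets (F q)" for q A
      using pred_rects_later[OF that] by (auto simp: sets_predictable)
    have badF: "bad q \<in> sets (F q)" if "q \<in> Qs" for q
    proof -
      have "0 \<le> q" using that s by (auto simp: Qs_def)
      moreover have "- cball c \<rho>0 \<in> sets borel" by auto
      ultimately have "Y q -` (- cball c \<rho>0) \<inter> space (F q) \<in> sets (F q)"
        using YF by (intro measurable_sets) auto
      moreover have "Y q -` (- cball c \<rho>0) \<inter> space (F q) = bad q" by (auto simp: bad_def space_F)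
      ultimately show ?thesis by simp
    qed
    have "{q<..T} \<times> bad q \<in> sets (predictable M F)" if "q \<in> Qs" for q
      using rect[OF _ _ badF[OF that]] that s by (auto simp: Qs_def)
    then show ?thesis unfolding D_def
      using rect[OF s _ space_F_sets] T by (intro sets.Diff sets.countable_UN'[OF Qs]) auto
  qed
  define Dw where "Dw \<omega> = {s<..T} - (\<Union>q\<in>{q\<in>Qs. \<omega> \<in> bad q}. {q<..T})" for \<omega>
  have D_iff: "(r, \<omega>) \<in> D \<longleftrightarrow> r \<in> Dw \<omega>" if "\<omega> \<in> space M" for r \<omega>
    using that by (auto simp: D_def Dw_def)
  have Dwb: "Dw \<omega> \<in> sets borel" for \<omega>
    unfolding Dw_def using countable_subset[OF _ Qs, of "{q\<in>Qs. \<omega> \<in> bad q}"]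
    by (intro sets.Diff sets.countable_UN') auto
  have Dws: "Dw \<omega> \<subseteq> {0<..T}" for \<omega> using s by (auto simp: Dw_def)
  let ?g = "\<lambda>p. indicator D (fst p) :: ennreal"
  have gm: "?g \<in> borel_measurable pred_marks" using Dp by measurable
  let ?R = "\<lambda>\<omega>. \<integral>\<^sup>+p. indicator (G \<times> {0<..T}) p * ?g ((snd p, \<omega>), fst p) \<partial>N \<omega>"
  have R_eq: "?R \<omega> = emeasure (N \<omega>) (G \<times> Dw \<omega>)" if w: "\<omega> \<in> space M" for \<omega>
  proof -
    have "?R \<omega> = (\<integral>\<^sup>+p. indicator (G \<times> Dw \<omega>) p \<partial>N \<omega>)"
      using Dws[of \<omega>] by (intro nn_integral_cong) (auto simp: indicator_def D_iff[OF w])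
    moreover have "G \<times> Dw \<omega> \<in> sets (N \<omega>)"
      unfolding sets_N[OF w] using Gs Dwb Dws[of \<omega>] by (intro box_sets) auto
    ultimately show ?thesis by simp
  qed
  \<comment> \<open>A jump with mark in \<open>G\<close> at a time of \<open>Dw \<omega>\<close> would lead into the target ball, where the path would
    still be at some rational time.\<close>
  have "AE \<omega> in M. ?R \<omega> = 0"
  proof -
    have "AE \<omega> in M. \<forall>u\<in>\<rat> \<inter> {s<..<s + \<delta>}. Y u \<omega> \<notin> ball c' \<rho>'"
    proof (subst AE_ball_countable)
      show "countable (\<rat> \<inter> {s<..<s + \<delta>})" using countable_rat by (rule countable_Int1)
      show "\<forall>u\<in>\<rat> \<inter> {s<..<s + \<delta>}. AE \<omega> in M. Y u \<omega> \<notin> ball c' \<rho>'"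
      proof
        fix u assume u: "u \<in> \<rat> \<inter> {s<..<s + \<delta>}"
        then have "prob {\<omega> \<in> space M. Y u \<omega> \<in> ball c' \<rho>'} = 0"
          using contra by (auto simp: zero_less_measure_iff)
        moreover have "{\<omega> \<in> space M. Y u \<omega> \<in> ball c' \<rho>'} \<in> sets M" using YM[of u] u s by auto
        ultimately have "{\<omega> \<in> space M. Y u \<omega> \<in> ball c' \<rho>'} \<in> null_sets M"
          by (simp add: null_sets_def emeasure_eq_measure)
        then have "AE \<omega> in M. \<omega> \<notin> {\<omega> \<in> space M. Y u \<omega> \<in> ball c' \<rho>'}" by (rule AE_not_in)
        then show "AE \<omega> in M. Y u \<omega> \<notin> ball c' \<rho>'" using AE_space by eventually_elim auto
      qed
    qed
    moreover have GT: "G \<times> {0<..T} \<in> fmeasurable \<Lambda>" using G by (intro box_fmeasurable[where T=T]) auto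
    note AE_finite_integer_valued[OF GT] solution_jump[OF sol G(1) T(1)] AE_space
    ultimately show ?thesis
    proof eventually_elim
      case (elim \<omega>)
      show ?case
      proof (rule ccontr)
        assume "?R \<omega> \<noteq> 0"
        then have "emeasure (N \<omega>) (G \<times> Dw \<omega>) \<noteq> 0" using R_eq[OF elim(4)] by simp
        then obtain t where t: "t \<in> Dw \<omega>" "emeasure (N \<omega>) (G \<times> {t}) \<noteq> 0"
          using jump_time_exists[OF elim(4) Gs elim(2) Dwb Dws] by blast
        have t': "s < t" "t \<le> T" "0 < t" using t(1) s by (auto simp: Dw_def)
        let ?y = "left_lim (\<lambda>r. Y r \<omega>) t"
        have yc: "?y \<in> cball c \<rho>0"
        proof (rule ccontr)
          assume "?y \<notin> cball c \<rho>0"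
          then have "eventually (\<lambda>r. Y r \<omega> \<in> - cball c \<rho>0) (at_left t)"
            using cadlag_left_lim[OF cad[OF elim(4)] t'(3)]
            by (intro topological_tendstoD[where l="?y"]) auto
          then obtain b where b: "b < t" "\<And>r. b < r \<Longrightarrow> r < t \<Longrightarrow> Y r \<omega> \<notin> cball c \<rho>0"
            by (auto simp: eventually_at_left_field)
          obtain q where q: "q \<in> \<rat>" "max b s < q" "q < t" using Rats_dense_in_real[of "max b s" t] b(1) t'(1) by auto
          then have "q \<in> Qs" "\<omega> \<in> bad q" using b t' elim(4) by (auto simp: Qs_def bad_def)
          then show False using t(1) q(3) t'(2) by (auto simp: Dw_def)
        qed
        then have yb: "?y \<in> ball c \<rho>" using \<rho>0(1) by auto
        have tT: "t \<in> {0<..T}" using t' by simp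
        note sj = elim(3)[rule_format, OF tT t(2)]
        have S: "G \<times> {t} \<in> sets (N \<omega>)" using slice_sets[OF Gs, of t] t' sets_N[OF elim(4)] by auto
        have "?y + (LINT p:G \<times> {t}|N \<omega>. \<sigma> ?y (fst p)) \<in> ball c' \<rho>'"
          using sj img[OF yb] by (intro mean_in_ball S) auto
        then have Yt: "Y t \<omega> \<in> ball c' \<rho>'" using sj by simp
        have "((\<lambda>r. Y r \<omega>) \<longlongrightarrow> Y t \<omega>) (at_right t)"
          using cad[OF elim(4)] t' by (simp add: cadlag_def)
        then have "eventually (\<lambda>r. Y r \<omega> \<in> ball c' \<rho>') (at_right t)"
          using Yt by (intro topological_tendstoD) auto
        then obtain b where b: "t < b" "\<And>r. t < r \<Longrightarrow> r < b \<Longrightarrow> Y r \<omega> \<in> ball c' \<rho>'"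
          by (auto simp: eventually_at_right_field)
        have "t < s + \<delta>" using t' \<delta> by (simp add: T_def)
        then obtain q where q: "q \<in> \<rat>" "t < q" "q < min b (s + \<delta>)"
          using Rats_dense_in_real[of t "min b (s + \<delta>)"] b(1) by auto
        then have "q \<in> \<rat> \<inter> {s<..<s + \<delta>}" using t' by auto
        then show False using elim(1) b(2)[of q] q by auto
      qed
    qed
  qed
  then have "(\<integral>\<^sup>+\<omega>. ?R \<omega> \<partial>M) = (\<integral>\<^sup>+\<omega>. 0 \<partial>M)" by (rule nn_integral_cong_AE)
  then have "(\<integral>\<^sup>+(\<omega>, z, r). indicator (G \<times> {0<..T}) (z, r) * ?g ((r, \<omega>), z) \<partial>MP) = 0"
    using compensation[OF G(1) gm, of T] by simp
  moreover have "(\<lambda>(\<omega>, z, r). indicator (G \<times> {0<..T}) (z, r) * ?g ((r, \<omega>), z)) \<in> borel_measurable MP"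
  proof -
    have "G \<times> {0<..T} \<in> sets \<Lambda>" using Gs by (intro box_sets) auto
    then have "(\<lambda>x. indicator (G \<times> {0<..T}) (snd x) :: ennreal) \<in> borel_measurable MP" by measurable
    moreover have "(\<lambda>x. ?g ((snd (snd x), fst x), fst (snd x))) \<in> borel_measurable MP"
      using measurable_compose[OF reorder_measurable gm] by (simp add: case_prod_beta')
    ultimately show ?thesis by (simp add: case_prod_beta' borel_measurable_times_ennreal)
  qed
  ultimately have "AE x in MP. (\<lambda>(\<omega>, z, r). indicator (G \<times> {0<..T}) (z, r) * ?g ((r, \<omega>), z)) x = 0"
    by (simp add: nn_integral_0_iff_AE)
  from MP.AE_pair[OF this]
  have ae: "AE \<omega> in M. AE y in \<Lambda>. indicator (G \<times> {0<..T}) y * ?g ((snd y, \<omega>), fst y) = 0"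
    by (simp add: case_prod_beta')
  let ?A = "{\<omega> \<in> space M. Y s \<omega> \<in> ball c \<rho>0}"
  have "AE \<omega> in M. \<omega> \<notin> ?A"
    using ae AE_space
  proof eventually_elim
    case (elim \<omega>)
    have "AE y in \<Lambda>. y \<notin> G \<times> Dw \<omega>"
      using elim(1)
      by eventually_elim (use Dws[of \<omega>] in \<open>auto simp: indicator_def D_iff[OF elim(2)] split: if_splits\<close>)
    moreover have Dw0: "Dw \<omega> \<subseteq> {0..}" using Dws[of \<omega>] by auto
    ultimately have "G \<times> Dw \<omega> \<in> null_sets \<Lambda>"
      using box_sets[OF Gs Dwb Dw0] by (simp add: Measure_Space.AE_iff_null_sets)
    then have "emeasure \<nu> G * emeasure lborel (Dw \<omega>) = 0"
      using emeasure_box[OF Gs Dwb Dw0] by auto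
    then have null: "emeasure lborel (Dw \<omega>) = 0" using G(2) by auto
    show ?case
    proof
      assume w: "\<omega> \<in> ?A"
      have "((\<lambda>r. Y r \<omega>) \<longlongrightarrow> Y s \<omega>) (at_right s)" using cad[of \<omega>] w s by (simp add: cadlag_def)
      then have "eventually (\<lambda>r. Y r \<omega> \<in> ball c \<rho>0) (at_right s)"
        using w by (intro topological_tendstoD) auto
      then obtain b where b: "s < b" "\<And>r. s < r \<Longrightarrow> r < b \<Longrightarrow> Y r \<omega> \<in> ball c \<rho>0"
        by (auto simp: eventually_at_right_field)
      define d where "d = min b T"
      have d: "s < d" "d \<le> b" "d \<le> T" using b T by (auto simp: d_def)
      have "q \<ge> d" if q: "q \<in> Qs" "\<omega> \<in> bad q" for q
      proof (rule ccontr)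
        assume "\<not> d \<le> q"
        then have "q = s \<or> (s < q \<and> q < b)" using q d by (auto simp: Qs_def)
        then have "Y q \<omega> \<in> ball c \<rho>0" using w b by auto
        then show False using q by (auto simp: bad_def)
      qed
      then have "{s<..d} \<subseteq> Dw \<omega>" using d by (fastforce simp: Dw_def)
      then have "emeasure lborel {s<..d} \<le> emeasure lborel (Dw \<omega>)" using Dwb by (intro emeasure_mono) auto
      moreover have "0 < emeasure lborel {s<..d}" using d by simp
      ultimately show False using null by simp
    qed
  qed
  moreover have "?A \<in> sets M"
    using measurable_sets[OF YM[OF s], of "ball c \<rho>0"] by (simp add: vimage_def Int_def conj_commute)
  ultimately have "?A \<in> null_sets M" by (simp add: AE_iff_null_sets)
  then show False using \<rho>0(2) by (simp add: measure_eq_0_null_sets)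
qed

text \<open>
  Each step takes as little time as desired, so the whole chain ends before \<open>t\<close>.
\<close>

lemma reach_chain:
  assumes sol: "is_solution \<iota> M F \<nu> N Zs \<A> \<sigma> x Y" and u: "0 \<le> u" "u < t"
    and start: "0 < prob {\<omega> \<in> space M. Y u \<omega> \<in> ball (q 0) (r 0)}"
    and G: "\<And>i. i < n \<Longrightarrow> G (Suc i) \<in> fmeasurable \<nu>" "\<And>i. i < n \<Longrightarrow> 0 < emeasure \<nu> (G (Suc i))"
    and img: "\<And>i h k. i < n \<Longrightarrow> h \<in> ball (q i) (r i) \<Longrightarrow> k \<in> G (Suc i) \<Longrightarrow> h + \<sigma> h k \<in> ball (q (Suc i)) (r (Suc i))"
  shows "\<exists>s. u \<le> s \<and> s < t \<and> 0 < prob {\<omega> \<in> space M. Y s \<omega> \<in> ball (q n) (r n)}"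
  using G img
proof (induction n)
  case 0
  then show ?case using u start by auto
next
  case (Suc n)
  have "\<exists>s. u \<le> s \<and> s < t \<and> 0 < prob {\<omega> \<in> space M. Y s \<omega> \<in> ball (q n) (r n)}"
    using Suc.prems by (intro Suc.IH) auto
  then obtain s where s: "u \<le> s" "s < t" "0 < prob {\<omega> \<in> space M. Y s \<omega> \<in> ball (q n) (r n)}" by blast
  have s0: "0 \<le> s" using s u by simp
  have d: "0 < t - s" using s by simp
  have "\<exists>s'. s < s' \<and> s' < s + (t - s) \<and> 0 < prob {\<omega> \<in> space M. Y s' \<omega> \<in> ball (q (Suc n)) (r (Suc n))}"
    by (rule reach_step[OF sol s0 d Suc.prems(1)[of n] Suc.prems(2)[of n] Suc.prems(3)[of n] s(3)]) auto
  then obtain s' where "s < s'" "s' < s + (t - s)"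
    "0 < prob {\<omega> \<in> space M. Y s' \<omega> \<in> ball (q (Suc n)) (r (Suc n))}" by blast
  then show ?case using s by (intro exI[of _ s']) auto
qed

end

section \<open>Irreducibility\<close>

theorem theorem2p1:
  fixes \<iota> :: "'v::banach \<Rightarrow>\<^sub>L 'h::{real_inner, banach, second_countable_topology}"
    and M :: "'w measure" and F :: "real \<Rightarrow> 'w measure"
    and \<nu> :: "'z::metric_space measure" and N :: "'w \<Rightarrow> ('z \<times> real) measure"
    and Zs :: "nat \<Rightarrow> 'z set"
    and \<A> :: "'v \<Rightarrow> ('v \<Rightarrow>\<^sub>L real)" and \<sigma> :: "'h \<Rightarrow> 'z \<Rightarrow> 'h"
    and X :: "'h \<Rightarrow> real \<Rightarrow> 'w \<Rightarrow> 'h"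
  assumes setting: "levy_spde \<iota> M F \<nu> N Zs \<A> \<sigma>"
    and solutions: "\<forall>x. is_unique_solution \<iota> M F \<nu> N Zs \<A> \<sigma> x (X x)"
    and markov: "strong_markov M F X"
    and stay: "\<forall>h. \<exists>\<eta>h>0. \<forall>\<eta>\<in>{0<..\<eta>h}. \<exists>\<epsilon>\<in>{0<..\<eta>/2}. \<exists>t>0.
      0 < (INF h'\<in>ball h \<epsilon>. measure M {\<omega> \<in> space M. ennreal t \<le> exit_time (X h') h \<eta> \<omega>})"
    and jump: "\<forall>h y. h \<noteq> y \<longrightarrow> (\<forall>\<eta>bar>0. \<exists>n\<ge>1. \<exists>m\<ge>1. \<exists>l. l ` {1..n} \<subseteq> Zs m \<and>
      (\<forall>\<eta>\<in>{0<..<\<eta>bar/2}. \<exists>(\<epsilon> :: nat \<Rightarrow> real) (r :: nat \<Rightarrow> real).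
        (\<forall>i\<in>{1..n}. 0 < \<epsilon> i) \<and>
        0 < r 0 \<and> (\<forall>i<n. r i \<le> r (Suc i)) \<and> r n \<le> \<eta> \<and>
        (\<forall>i<n. {q + \<sigma> q k | q k. q \<in> ball (jump_chain \<sigma> l h i) (r i) \<and> k \<in> ball (l (Suc i)) (\<epsilon> (Suc i))}
                 \<subseteq> ball (jump_chain \<sigma> l h (Suc i)) (r (Suc i))) \<and>
        ball (jump_chain \<sigma> l h n) (r n) \<subseteq> ball y (\<eta>bar/2) \<and>
        (\<forall>i\<in>{1..n}. 0 < emeasure \<nu> (ball (l i) (\<epsilon> i))) \<and>
        (\<exists>m0\<ge>m. (\<Union>i\<in>{1..n}. ball (l i) (\<epsilon> i)) \<subseteq> Zs m0)))"
  shows "irreducible_family M X"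
proof -
  interpret levy_spde \<iota> M F \<nu> N Zs \<A> \<sigma> by (rule setting)
  show ?thesis unfolding irreducible_family_def
  proof (intro allI impI)
    fix t :: real and x :: 'h and B :: "'h set"
    assume t: "0 < t" and B: "open B \<and> B \<noteq> {}"
    have sol: "is_solution \<iota> M F \<nu> N Zs \<A> \<sigma> h (X h)" for h
      using solutions by (simp add: is_unique_solution_def)
    have XM: "X h s \<in> borel_measurable M" if "0 \<le> s" for h s
      using sol[of h] that by (intro measurable_F_M[of _ s]) (simp add: is_solution_def cadlag_adapted_def)
    have ev: "{\<omega> \<in> space M. X h s \<omega> \<in> U} \<in> sets M" if "0 \<le> s" "U \<in> sets borel" for h s U
      using measurable_sets[OF XM[OF that(1)] that(2), of h] by (simp add: vimage_def Int_def conj_commute)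
    obtain y where y: "y \<in> B" using B by blast
    obtain \<beta> where \<beta>: "0 < \<beta>" "ball y \<beta> \<subseteq> B" using B y by (meson openE)
    obtain \<eta>y where \<eta>y: "0 < \<eta>y" "\<forall>\<eta>\<in>{0<..\<eta>y}. \<exists>\<epsilon>\<in>{0<..\<eta>/2}. \<exists>t>0.
        0 < (INF h'\<in>ball y \<epsilon>. measure M {\<omega> \<in> space M. ennreal t \<le> exit_time (X h') y \<eta> \<omega>})"
      using stay[rule_format, of y] by (elim exE conjE)
    define \<eta> where "\<eta> = min \<beta> \<eta>y"
    have \<eta>: "\<eta> \<in> {0<..\<eta>y}" using \<beta> \<eta>y by (simp add: \<eta>_def)
    have \<eta>B: "ball y \<eta> \<subseteq> B" using \<beta>(2) subset_ball[of \<eta> \<beta> y] by (auto simp: \<eta>_def)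
    obtain \<epsilon> t0 where \<epsilon>': "\<epsilon> \<in> {0<..\<eta>/2}" and t0: "0 < t0"
      and INF_pos: "0 < (INF h'\<in>ball y \<epsilon>. measure M {\<omega> \<in> space M. ennreal t0 \<le> exit_time (X h') y \<eta> \<omega>})"
      using \<eta>y(2)[rule_format, OF \<eta>] by (elim bexE exE conjE)
    have \<epsilon>: "0 < \<epsilon>" using \<epsilon>' by simp
    define c where "c = (INF h'\<in>ball y \<epsilon>. measure M {\<omega> \<in> space M. ennreal t0 \<le> exit_time (X h') y \<eta> \<omega>})"
    have c: "0 < c" using INF_pos by (simp add: c_def)
    have stay_y: "c \<le> prob {\<omega> \<in> space M. X h v \<omega> \<in> B}" if h: "h \<in> ball y \<epsilon>" and v: "0 \<le> v" "v < t0" for h v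
    proof -
      have "c \<le> prob {\<omega> \<in> space M. ennreal t0 \<le> exit_time (X h) y \<eta> \<omega>}"
        unfolding c_def by (rule cINF_lower[OF _ h]) (auto intro!: bdd_belowI[of _ 0])
      also have "\<dots> \<le> prob {\<omega> \<in> space M. X h v \<omega> \<in> B}"
      proof (rule finite_measure_mono)
        show "{\<omega> \<in> space M. ennreal t0 \<le> exit_time (X h) y \<eta> \<omega>} \<subseteq> {\<omega> \<in> space M. X h v \<omega> \<in> B}"
        proof safe
          fix \<omega> assume le: "ennreal t0 \<le> exit_time (X h) y \<eta> \<omega>"
          show "X h v \<omega> \<in> B"
          proof (rule ccontr)
            assume "X h v \<omega> \<notin> B"
            then have "X h v \<omega> \<notin> ball y \<eta>" using \<eta>B by blast
            then have "exit_time (X h) y \<eta> \<omega> \<le> ennreal v"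
              unfolding exit_time_def using v by (intro Inf_lower) auto
            then have "ennreal t0 \<le> ennreal v" using le by (rule order_trans[rotated])
            then show False using v t0 by (simp add: ennreal_le_iff)
          qed
        qed
        show "{\<omega> \<in> space M. X h v \<omega> \<in> B} \<in> sets M" using v B by (intro ev) auto
      qed
      finally show ?thesis .
    qed
    define u where "u = t - min t t0 / 2"
    have u: "0 \<le> u" "u < t" "t - u < t0" using t t0 by (auto simp: u_def min_def)
    \<comment> \<open>shortly before \<open>t\<close> the process is near \<open>y\<close> with positive probability\<close>
    have "\<exists>s. u \<le> s \<and> s < t \<and> 0 < prob {\<omega> \<in> space M. X x s \<omega> \<in> ball y \<epsilon>}"
    proof -
      obtain h where h: "\<And>\<rho>. 0 < \<rho> \<Longrightarrow> 0 < prob {\<omega> \<in> space M. X x u \<omega> \<in> ball h \<rho>}"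
        using support_point[OF XM[OF u(1)], of x] by blast
      show ?thesis
      proof (cases "h = y")
        case True
        then show ?thesis using h[OF \<epsilon>] u by blast
      next
        case False
        have "0 < 2 * \<epsilon>" using \<epsilon> by simp
        from jump[rule_format, OF False this] obtain n m l where
          nml: "\<forall>\<eta>\<in>{0<..<2*\<epsilon>/2}. \<exists>(e :: nat \<Rightarrow> real) (r :: nat \<Rightarrow> real).
          (\<forall>i\<in>{1..n}. 0 < e i) \<and>
          0 < r 0 \<and> (\<forall>i<n. r i \<le> r (Suc i)) \<and> r n \<le> \<eta> \<and>
          (\<forall>i<n. {q + \<sigma> q k | q k. q \<in> ball (jump_chain \<sigma> l h i) (r i) \<and> k \<in> ball (l (Suc i)) (e (Suc i))}
                   \<subseteq> ball (jump_chain \<sigma> l h (Suc i)) (r (Suc i))) \<and>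
          ball (jump_chain \<sigma> l h n) (r n) \<subseteq> ball y (2*\<epsilon>/2) \<and>
          (\<forall>i\<in>{1..n}. 0 < emeasure \<nu> (ball (l i) (e i))) \<and>
          (\<exists>m0\<ge>m. (\<Union>i\<in>{1..n}. ball (l i) (e i)) \<subseteq> Zs m0)"
          by (elim exE conjE)
        have "\<epsilon> / 2 \<in> {0<..<2*\<epsilon>/2}" using \<epsilon> by simp
        from nml[rule_format, OF this] obtain e r m0 where r0: "0 < r 0"
          and img: "\<forall>i<n. {q + \<sigma> q k | q k. q \<in> ball (jump_chain \<sigma> l h i) (r i) \<and> k \<in> ball (l (Suc i)) (e (Suc i))}
                   \<subseteq> ball (jump_chain \<sigma> l h (Suc i)) (r (Suc i))"
          and last: "ball (jump_chain \<sigma> l h n) (r n) \<subseteq> ball y (2*\<epsilon>/2)"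
          and pos: "\<forall>i\<in>{1..n}. 0 < emeasure \<nu> (ball (l i) (e i))"
          and m0: "(\<Union>i\<in>{1..n}. ball (l i) (e i)) \<subseteq> Zs m0"
          by (elim exE conjE)
        have "\<exists>s. u \<le> s \<and> s < t \<and> 0 < prob {\<omega> \<in> space M. X x s \<omega> \<in> ball (jump_chain \<sigma> l h n) (r n)}"
        proof (rule reach_chain[OF sol u(1,2), where G="\<lambda>i. ball (l i) (e i)"])
          show "0 < prob {\<omega> \<in> space M. X x u \<omega> \<in> ball (jump_chain \<sigma> l h 0) (r 0)}" using h[OF r0] by simp
          fix i assume i: "i < n"
          then have i': "Suc i \<in> {1..n}" by simp
          show "0 < emeasure \<nu> (ball (l (Suc i)) (e (Suc i)))" by (rule pos[rule_format, OF i'])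
          have "ball (l (Suc i)) (e (Suc i)) \<subseteq> Zs m0" using m0 i' by blast
          then have "emeasure \<nu> (ball (l (Suc i)) (e (Suc i))) \<le> emeasure \<nu> (Zs m0)"
            using Zs_borel sets_\<nu> by (intro emeasure_mono) auto
          then show "ball (l (Suc i)) (e (Suc i)) \<in> fmeasurable \<nu>"
            using Zs_finite[of m0] by (auto simp: fmeasurable_def sets_\<nu> intro: le_less_trans)
          show "\<And>q k. q \<in> ball (jump_chain \<sigma> l h i) (r i) \<Longrightarrow> k \<in> ball (l (Suc i)) (e (Suc i)) \<Longrightarrow>
              q + \<sigma> q k \<in> ball (jump_chain \<sigma> l h (Suc i)) (r (Suc i))"
            using img[rule_format, OF i] by blast
        qed
        then obtain s where s: "u \<le> s" "s < t"
          "0 < prob {\<omega> \<in> space M. X x s \<omega> \<in> ball (jump_chain \<sigma> l h n) (r n)}" by blast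
        have "prob {\<omega> \<in> space M. X x s \<omega> \<in> ball (jump_chain \<sigma> l h n) (r n)} \<le> prob {\<omega> \<in> space M. X x s \<omega> \<in> ball y \<epsilon>}"
          using last s u by (intro finite_measure_mono ev) auto
        then show ?thesis using s by (intro exI[of _ s]) auto
      qed
    qed
    then obtain s where s: "u \<le> s" "s < t" and near: "0 < prob {\<omega> \<in> space M. X x s \<omega> \<in> ball y \<epsilon>}" by blast
    define v where "v = t - s"
    have v: "0 \<le> v" "v < t0" "s + v = t" and s0: "0 \<le> s" using s u by (auto simp: v_def)
    \<comment> \<open>and from there it stays in \<open>B\<close> until \<open>t\<close>\<close>
    define p where "p h = prob {\<omega> \<in> space M. X h v \<omega> \<in> B}" for h
    have Bb: "B \<in> sets borel" using B by simp
    have pm: "p \<in> borel_measurable borel"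
      using markov v(1) Bb unfolding strong_markov_def p_def[abs_def] by blast
    let ?P = "pre_sigma (\<lambda>_. s)"
    let ?f = "\<lambda>\<omega>. indicator B (X x t \<omega>) :: real"
    have ce: "AE \<omega> in M. real_cond_exp M ?P ?f \<omega> = p (X x s \<omega>)"
    proof -
      have "stopping_time F (\<lambda>_. s)" by (rule stopping_time_const)
      then have "AE \<omega> in M. real_cond_exp M ?P (\<lambda>\<omega>'. indicator B (X x (s + v) \<omega>')) \<omega>
          = prob {\<omega>' \<in> space M. X (X x s \<omega>) v \<omega>' \<in> B}"
        using markov s0 v(1) Bb unfolding strong_markov_def by blast
      then show ?thesis by (simp add: v(3) p_def)
    qed
    have sub: "subalgebra M ?P"
      unfolding subalgebra_def
    proof
      show "space ?P = space M" by (rule space_pre_sigma)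
      show "sets ?P \<subseteq> sets M"
      proof
        fix A assume "A \<in> sets ?P"
        then have "{\<omega> \<in> A. s \<le> s} \<in> sets (F s)" by (intro sets_pre_sigmaD[OF stopping_time_const])
        then show "A \<in> sets M" using sets_sub_F by auto
      qed
    qed
    interpret P: finite_measure_subalgebra M ?P using sub by unfold_locales
    have fE: "{\<omega> \<in> space M. X x t \<omega> \<in> B} \<in> sets M" using t Bb by (intro ev) auto
    have f_eq: "?f \<omega> = indicator {\<omega> \<in> space M. X x t \<omega> \<in> B} \<omega>" if "\<omega> \<in> space M" for \<omega>
      using that by (simp add: indicator_def)
    have fint: "integrable M ?f"
      using fE by (subst Bochner_Integration.integrable_cong[OF refl f_eq]) (auto simp: emeasure_eq_measure)
    have "prob {\<omega> \<in> space M. X x t \<omega> \<in> B} = expectation ?f"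
      using fE by (subst Bochner_Integration.integral_cong[OF refl f_eq]) (auto simp: Int_absorb2 Collect_conj_eq)
    also have "\<dots> = expectation (real_cond_exp M ?P ?f)"
      using P.real_cond_exp_int(2)[OF fint] by simp
    also have "\<dots> = expectation (\<lambda>\<omega>. p (X x s \<omega>))"
      using ce measurable_compose[OF XM[OF s0] pm] by (intro integral_cong_AE) auto
    also have "\<dots> \<ge> expectation (\<lambda>\<omega>. c * indicator {\<omega> \<in> space M. X x s \<omega> \<in> ball y \<epsilon>} \<omega>)"
    proof (rule integral_mono)
      have E: "{\<omega> \<in> space M. X x s \<omega> \<in> ball y \<epsilon>} \<in> sets M" using s0 by (intro ev) auto
      then show "integrable M (\<lambda>\<omega>. c * indicator {\<omega> \<in> space M. X x s \<omega> \<in> ball y \<epsilon>} \<omega>)"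
        by (auto simp: emeasure_eq_measure)
      show "integrable M (\<lambda>\<omega>. p (X x s \<omega>))"
        using measurable_compose[OF XM[OF s0] pm]
        by (intro integrable_const_bound[where B=1]) (auto simp: p_def)
      show "c * indicator {\<omega> \<in> space M. X x s \<omega> \<in> ball y \<epsilon>} \<omega> \<le> p (X x s \<omega>)" for \<omega>
        using stay_y[OF _ v(1,2), of "X x s \<omega>"] by (auto simp: p_def indicator_def)
    qed
    also have "expectation (\<lambda>\<omega>. c * indicator {\<omega> \<in> space M. X x s \<omega> \<in> ball y \<epsilon>} \<omega>)
        = c * prob {\<omega> \<in> space M. X x s \<omega> \<in> ball y \<epsilon>}"
    proof -
      have "{\<omega> \<in> space M. X x s \<omega> \<in> ball y \<epsilon>} \<inter> space M = {\<omega> \<in> space M. X x s \<omega> \<in> ball y \<epsilon>}" by auto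
      then show ?thesis by simp
    qed
    finally have "c * prob {\<omega> \<in> space M. X x s \<omega> \<in> ball y \<epsilon>} \<le> prob {\<omega> \<in> space M. X x t \<omega> \<in> B}" .
    moreover have "0 < c * prob {\<omega> \<in> space M. X x s \<omega> \<in> ball y \<epsilon>}" using c near by simp
    ultimately show "0 < prob {\<omega> \<in> space M. X x t \<omega> \<in> B}" by simp
  qed
qed

end
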